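(* Let $D\subset\mathbb C$ be a regular domain with a $C^2$-smooth open piece $\Gamma\subset\partial D$, and let $p_0\in\Gamma$, where $D$ has a $C^2$-smooth local defining function $\psi$ near $p_0$ (i.e. $U\cap D=\{\psi<0\}$ for some neighbourhood $U$ of $p_0$ and $d\psi\ne0$ on $\Gamma$). Let $\mathcal K$ be the curvature of the capacity metric $c_D(z)|dz|$. Then $\mathcal K(p)\to-4$ as $p\to p_0$, $p\in D$.
   Context: A regular domain is a domain on which the Dirichlet problem is solvable. $G_D(z,p)$ is the Green's function of $D$ with pole at $p$ (harmonic on $D\setminus\{p\}$, tending to $0$ as $z\to\partial D$, with $G_D(z,p)+\log|z-p|$ harmonic near $p$). The Robin function is $\Lambda_D(p)=\lim_{z\to p}(G_D(z,p)+\log|z-p|)$ and the capacity function is $c_D(p)=e^{-\Lambda_D(p)}$. The capacity metric is the conformal metric $c_D(z)|dz|$ on $D$, and its curvature is $$\mathcal K(z)=-4\,c_D(z)^{-2}\,\frac{\partial^2}{\partial z\,\partial\overline z}\log c_D(z).$$ *)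

theory Defs
  imports "HOL-Analysis.Analysis"
begin

section \<open>Functions of class C2 and harmonic functions\<close>

definition C2_derivs_on ::
    "(complex \<Rightarrow> real) \<Rightarrow> (complex \<Rightarrow> complex \<Rightarrow>\<^sub>L real) \<Rightarrow>
     (complex \<Rightarrow> complex \<Rightarrow>\<^sub>L complex \<Rightarrow>\<^sub>L real) \<Rightarrow> complex set \<Rightarrow> bool" where
  "C2_derivs_on u u' u'' S \<longleftrightarrow>
     (\<forall>z\<in>S. (u has_derivative blinfun_apply (u' z)) (at z)) \<and>
     (\<forall>z\<in>S. (u' has_derivative blinfun_apply (u'' z)) (at z)) \<and>
     continuous_on S u''"

text \<open>The sets \<open>S\<close> below are always open.\<close>

definition C2_on :: "(complex \<Rightarrow> real) \<Rightarrow> complex set \<Rightarrow> bool" where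
  "C2_on u S \<longleftrightarrow> (\<exists>u' u''. C2_derivs_on u u' u'' S)"

definition harmonic_on :: "(complex \<Rightarrow> real) \<Rightarrow> complex set \<Rightarrow> bool" where
  "harmonic_on u S \<longleftrightarrow>
     (\<exists>u' u''. C2_derivs_on u u' u'' S \<and>
        (\<forall>z\<in>S. blinfun_apply (blinfun_apply (u'' z) 1) 1 +
                blinfun_apply (blinfun_apply (u'' z) \<i>) \<i> = 0))"

section \<open>Regular domains\<close>

text \<open>
  Boundaries are taken in the finite plane. For unbounded domains a growth condition at infinity is
  then needed (it is what makes solutions of the Dirichlet problem and Green's functions unique as
  soon as the boundary is not polar). It is vacuous for bounded \<open>D\<close>, since
  \<open>D - cball 0 R = {}\<close> for large \<open>R\<close>. Domains that are regular with respect to their boundary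
  in the Riemann sphere are also regular in the present sense.
\<close>

definition bounded_near_infinity :: "(complex \<Rightarrow> real) \<Rightarrow> complex set \<Rightarrow> bool" where
  "bounded_near_infinity u S \<longleftrightarrow> (\<exists>R. bounded (u ` (S - cball 0 R)))"

definition solves_dirichlet ::
    "complex set \<Rightarrow> (complex \<Rightarrow> real) \<Rightarrow> (complex \<Rightarrow> real) \<Rightarrow> bool" where
  "solves_dirichlet D f u \<longleftrightarrow>
     harmonic_on u D \<and> (\<forall>\<zeta>\<in>frontier D. (u \<longlongrightarrow> f \<zeta>) (at \<zeta> within D)) \<and>
     bounded_near_infinity u D"

definition regular_domain :: "complex set \<Rightarrow> bool" where
  "regular_domain D \<longleftrightarrow>
     open D \<and> connected D \<and> D \<noteq> {} \<and>
     (\<forall>f. continuous_on (frontier D) f \<and> bounded (f ` frontier D) \<longrightarrow> (\<exists>u. solves_dirichlet D f u))"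

section \<open>Green's function, Robin function and capacity function\<close>

definition is_green_function :: "complex set \<Rightarrow> complex \<Rightarrow> (complex \<Rightarrow> real) \<Rightarrow> bool" where
  "is_green_function D p g \<longleftrightarrow>
     harmonic_on g (D - {p}) \<and>
     (\<forall>\<zeta>\<in>frontier D. (g \<longlongrightarrow> 0) (at \<zeta> within D)) \<and>
     bounded_near_infinity g D \<and>
     (\<exists>e>0. \<exists>h. harmonic_on h (ball p e) \<and>
        (\<forall>z\<in>ball p e - {p}. g z + ln (cmod (z - p)) = h z))"

text \<open>The choice only concerns the irrelevant values outside \<open>D - {p}\<close>.\<close>

definition green_function :: "complex set \<Rightarrow> complex \<Rightarrow> complex \<Rightarrow> real" where
  "green_function D p = (SOME g. is_green_function D p g)"

definition robin_function :: "complex set \<Rightarrow> complex \<Rightarrow> real" where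
  "robin_function D p = Lim (at p) (\<lambda>z. green_function D p z + ln (cmod (z - p)))"

definition capacity_function :: "complex set \<Rightarrow> complex \<Rightarrow> real" where
  "capacity_function D p = exp (- robin_function D p)"

section \<open>Curvature of a conformal metric\<close>

definition wirtinger :: "(complex \<Rightarrow> complex) \<Rightarrow> complex \<Rightarrow> complex" where
  "wirtinger f z = (frechet_derivative f (at z) 1 - \<i> * frechet_derivative f (at z) \<i>) / 2"

definition wirtinger_bar :: "(complex \<Rightarrow> complex) \<Rightarrow> complex \<Rightarrow> complex" where
  "wirtinger_bar f z = (frechet_derivative f (at z) 1 + \<i> * frechet_derivative f (at z) \<i>) / 2"

text \<open>The curvature of the metric \<open>\<rho>(z) |dz|\<close>.\<close>

definition metric_curvature :: "(complex \<Rightarrow> real) \<Rightarrow> complex \<Rightarrow> complex" where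
  "metric_curvature \<rho> z =
     - 4 * complex_of_real (\<rho> z) powi (- 2) *
       wirtinger (wirtinger_bar (\<lambda>w. complex_of_real (ln (\<rho> w)))) z"

section \<open>Boundary pieces of class C2\<close>

text \<open>
  \<open>\<psi>\<close> is a defining function of \<open>D\<close> on the open set \<open>U\<close>, along the boundary piece \<open>\<Gamma>\<close>;
  the condition on its differential is imposed at the points of \<open>\<Gamma>\<close> where \<open>\<psi>\<close> is defined.
\<close>

definition C2_defining_function ::
    "complex set \<Rightarrow> complex set \<Rightarrow> complex set \<Rightarrow> (complex \<Rightarrow> real) \<Rightarrow> bool" where
  "C2_defining_function D \<Gamma> U \<psi> \<longleftrightarrow>
     open U \<and> C2_on \<psi> U \<and> U \<inter> D = {z \<in> U. \<psi> z < 0} \<and>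
     (\<forall>\<zeta>\<in>\<Gamma> \<inter> U. frechet_derivative \<psi> (at \<zeta>) \<noteq> (\<lambda>_. 0))"

definition C2_boundary_piece :: "complex set \<Rightarrow> complex set \<Rightarrow> bool" where
  "C2_boundary_piece D \<Gamma> \<longleftrightarrow>
     \<Gamma> \<subseteq> frontier D \<and> openin (top_of_set (frontier D)) \<Gamma> \<and>
     (\<forall>\<zeta>\<in>\<Gamma>. \<exists>U \<psi>. \<zeta> \<in> U \<and> C2_defining_function D \<Gamma> U \<psi>)"

end

theory Submission
  imports Defs "HOL-Complex_Analysis.Complex_Analysis" "HOL-Real_Asymp.Real_Asymp"
begin

text \<open>
  Write the Robin function as \<open>\<Lambda>(p) = h(p, p)\<close>, where \<open>h(z, p) = G(z, p) + log |z - p|\<close>. As a function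
  of \<open>z\<close> it solves the Dirichlet problem with boundary values \<open>log |\<zeta> - p|\<close>. These depend
  harmonically on \<open>p\<close> and solving the Dirichlet problem is linear and contractive in the supremum norm,
  so \<open>h\<close> is harmonic in \<open>p\<close> as well.

  The proof compares \<open>h\<close> with a half plane. For \<open>p\<close> close to the boundary piece let \<open>q\<close> be a nearest boundary
  point, \<open>\<nu>\<close> the outer unit normal there and \<open>\<delta> = |p - q|\<close>. A boundary of class C2 admits tangent discs of
  one and the same radius \<open>r\<close> on both sides at all boundary points \<open>q\<close> near \<open>p\<^sub>0\<close>. In the
  coordinates \<open>x = (z - q) / \<nu>\<close>, \<open>y = (p - q) / \<nu>\<close> the kernel \<open>h\<close> of the inner disc and that of the exterior of
  the outer disc are \<open>log |x + cnj y + x * cnj y / r|\<close> and \<open>log |x + cnj y - x * cnj y / r|\<close>, and the maximum principle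
  puts \<open>h\<close> between them (\<open>robin_kernel_lower_bound\<close> and \<open>robin_kernel_upper_bound\<close>). Hence, if \<open>6 \<delta> \<le> r\<close>, on the bidisc of
  radius \<open>\<delta>/2\<close> around \<open>(p, p)\<close>, the kernel \<open>h\<close> differs from the kernel \<open>log |x + cnj y|\<close> of the half plane by at
  most \<open>6 \<delta> / r\<close>.

  This difference is harmonic in each variable. For such functions a bound \<open>M\<close> on a bidisc of
  radius \<open>\<rho>\<close> bounds the second derivatives of the restriction to the diagonal by a constant times
  \<open>M / \<rho>^2\<close> (\<open>separately_harmonic_diagonal_second_derivative\<close>). With \<open>\<rho> = \<delta>/2\<close> the error in the
  second derivatives of \<open>\<Lambda>\<close> is of order \<open>1 / (r \<delta>)\<close>, whereas \<open>c_D(p)^(-2)\<close> is about \<open>4 \<delta>^2\<close>. So the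
  curvature at \<open>p\<close> differs from that of the half plane, which is -4, by \<open>O(\<delta> / r)\<close>.
\<close>

section \<open>The complex gradient of a harmonic function\<close>

text \<open>
  This is \<open>u_x - i u_y\<close>, twice the Wirtinger derivative of \<open>u\<close>, normalised so that the differential of
  \<open>u\<close> at \<open>z\<close> is \<open>e \<mapsto> Re (cgrad u z * e)\<close>. A function is harmonic iff its complex gradient is holomorphic,
  and most of what follows uses harmonicity in this form.
\<close>

definition cgrad :: "(complex \<Rightarrow> real) \<Rightarrow> complex \<Rightarrow> complex" where
  "cgrad u z = Complex (frechet_derivative u (at z) 1) (- frechet_derivative u (at z) \<i>)"

lemma real_linear_eq_Re_mult:
  fixes A :: "complex \<Rightarrow> real"
  assumes "linear A"
  shows "A e = Re (Complex (A 1) (- A \<i>) * e)"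
proof -
  have "e = Re e *\<^sub>R 1 + Im e *\<^sub>R \<i>"
    by (simp add: complex_eq_iff)
  then have "A e = A (Re e *\<^sub>R 1 + Im e *\<^sub>R \<i>)"
    by (rule arg_cong)
  also have "\<dots> = Re e * A 1 + Im e * A \<i>"
    by (simp only: linear_add[OF assms] linear_scale[OF assms] real_scaleR_def)
  finally show ?thesis by simp
qed

lemma has_derivative_cgrad:
  assumes "u differentiable (at z)"
  shows "(u has_derivative (\<lambda>e. Re (cgrad u z * e))) (at z)"
proof -
  have *: "(u has_derivative frechet_derivative u (at z)) (at z)"
    using assms by (simp add: frechet_derivative_works)
  have "frechet_derivative u (at z) = (\<lambda>e. Re (cgrad u z * e))"
    unfolding cgrad_def using real_linear_eq_Re_mult[OF has_derivative_linear[OF *]] by blast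
  with * show ?thesis by simp
qed

lemma cgrad_eqI:
  assumes "(u has_derivative (\<lambda>e. Re (c * e))) (at z)"
  shows "cgrad u z = c"
  unfolding cgrad_def frechet_derivative_at[OF assms, symmetric] by (simp add: complex_eq_iff)

text \<open>
  The mixed second difference is symmetric in \<open>a\<close> and \<open>b\<close>; evaluating it by two applications of
  the mean value theorem gives the symmetry of the second derivative below.
\<close>

lemma mixed_difference_mvt:
  fixes u :: "complex \<Rightarrow> real"
  assumes u: "\<And>z. z \<in> cball c (2 * t) \<Longrightarrow> (u has_derivative blinfun_apply (u' z)) (at z)"
      and u': "\<And>z. z \<in> cball c (2 * t) \<Longrightarrow> (u' has_derivative blinfun_apply (u'' z)) (at z)"
      and t: "0 < t" and nz: "norm a \<le> 1" "norm b \<le> 1"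
  shows "\<exists>w \<in> cball c (2 * t).
    u (c + t *\<^sub>R a + t *\<^sub>R b) - u (c + t *\<^sub>R a) - u (c + t *\<^sub>R b) + u c = t\<^sup>2 * u'' w b a"
proof -
  have inb: "c + s *\<^sub>R a + r *\<^sub>R b \<in> cball c (2 * t)"
    if "0 \<le> s" "s \<le> t" "0 \<le> r" "r \<le> t" for s r
  proof -
    have "norm (s *\<^sub>R a + r *\<^sub>R b) \<le> s * norm a + r * norm b"
      using norm_triangle_ineq[of "s *\<^sub>R a" "r *\<^sub>R b"] that by simp
    also have "\<dots> \<le> t * 1 + t * 1"
      using that nz by (intro add_mono mult_mono) auto
    finally have "norm (s *\<^sub>R a + r *\<^sub>R b) \<le> 2 * t" by simp
    moreover have "c - (c + s *\<^sub>R a + r *\<^sub>R b) = - (s *\<^sub>R a + r *\<^sub>R b)" by simp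
    ultimately show ?thesis by (simp only: mem_cball dist_norm norm_minus_cancel)
  qed
  have inb0: "c + s *\<^sub>R a \<in> cball c (2 * t)" if "0 \<le> s" "s \<le> t" for s
    using inb[of s 0] that t by simp
  define g where "g s = u (c + s *\<^sub>R a + t *\<^sub>R b) - u (c + s *\<^sub>R a)" for s
  have "(g has_derivative (\<lambda>h. h * (u' (c + s *\<^sub>R a + t *\<^sub>R b) a - u' (c + s *\<^sub>R a) a))) (at s)"
    if "0 \<le> s" "s \<le> t" for s
  proof -
    have "((\<lambda>s. c + s *\<^sub>R a + t *\<^sub>R b) has_derivative (\<lambda>h. h *\<^sub>R a)) (at s)"
      "((\<lambda>s. c + s *\<^sub>R a) has_derivative (\<lambda>h. h *\<^sub>R a)) (at s)"
      by (auto intro!: derivative_eq_intros)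
    from this[THEN has_derivative_compose, OF u] show ?thesis
      unfolding g_def using inb[of s t] inb0[of s] t that
      by (auto intro!: derivative_eq_intros simp: blinfun.scaleR_right right_diff_distrib)
  qed
  then have "(g has_real_derivative (u' (c + s *\<^sub>R a + t *\<^sub>R b) a - u' (c + s *\<^sub>R a) a)) (at s)"
    if "0 \<le> s" "s \<le> t" for s
    using that by (simp add: has_field_derivative_def mult_commute_abs)
  from MVT2[OF t this] obtain \<sigma> where \<sigma>: "0 < \<sigma>" "\<sigma> < t"
    "g t - g 0 = t * (u' (c + \<sigma> *\<^sub>R a + t *\<^sub>R b) a - u' (c + \<sigma> *\<^sub>R a) a)"
    by auto
  define k where "k s = u' (c + \<sigma> *\<^sub>R a + s *\<^sub>R b) a" for s
  have "(k has_derivative (\<lambda>h. h * u'' (c + \<sigma> *\<^sub>R a + s *\<^sub>R b) b a)) (at s)"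
    if "0 \<le> s" "s \<le> t" for s
  proof -
    have "((\<lambda>s. c + \<sigma> *\<^sub>R a + s *\<^sub>R b) has_derivative (\<lambda>h. h *\<^sub>R b)) (at s)"
      by (auto intro!: derivative_eq_intros)
    from has_derivative_compose[OF this u'] inb[of \<sigma> s] \<sigma> that
    have "((\<lambda>s. u' (c + \<sigma> *\<^sub>R a + s *\<^sub>R b)) has_derivative
        (\<lambda>h. u'' (c + \<sigma> *\<^sub>R a + s *\<^sub>R b) (h *\<^sub>R b))) (at s)"
      by simp
    from bounded_linear.has_derivative[OF blinfun.bounded_linear_left this] show ?thesis
      by (simp add: k_def[abs_def] blinfun.scaleR_right blinfun.scaleR_left)
  qed
  then have "(k has_real_derivative u'' (c + \<sigma> *\<^sub>R a + s *\<^sub>R b) b a) (at s)"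
    if "0 \<le> s" "s \<le> t" for s
    using that by (simp add: has_field_derivative_def mult_commute_abs)
  from MVT2[OF t this] obtain \<tau> where \<tau>: "0 < \<tau>" "\<tau> < t"
    "k t - k 0 = t * u'' (c + \<sigma> *\<^sub>R a + \<tau> *\<^sub>R b) b a"
    by auto
  have "g t - g 0 = t\<^sup>2 * u'' (c + \<sigma> *\<^sub>R a + \<tau> *\<^sub>R b) b a"
    using \<sigma>(3) \<tau>(3) by (simp add: k_def power2_eq_square)
  then show ?thesis
    using inb[of \<sigma> \<tau>] \<sigma> \<tau> by (intro bexI[of _ "c + \<sigma> *\<^sub>R a + \<tau> *\<^sub>R b"]) (auto simp: g_def)
qed

lemma second_derivative_symmetric:
  fixes u :: "complex \<Rightarrow> real"
  assumes C2: "C2_derivs_on u u' u'' S" and S: "open S" "z \<in> S"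
      and nz: "norm a \<le> 1" "norm b \<le> 1"
  shows "u'' z a b = u'' z b a"
proof -
  obtain r where r: "r > 0" "cball z r \<subseteq> S"
    using S by (meson open_contains_cball)
  have tend: "((\<lambda>w. u'' w b a) \<longlongrightarrow> u'' z b a) (nhds z)" for a b
  proof -
    have "isCont u'' z"
      using C2 S by (auto simp: C2_derivs_on_def continuous_on_eq_continuous_at)
    then have "(u'' \<longlongrightarrow> u'' z) (nhds z)" by (simp only: isCont_def tendsto_at_iff_tendsto_nhds)
    then show ?thesis by (intro blinfun.tendsto tendsto_const)
  qed
  have *: "\<exists>w \<in> cball z (2 * t).
    u (z + t *\<^sub>R a + t *\<^sub>R b) - u (z + t *\<^sub>R a) - u (z + t *\<^sub>R b) + u z = t\<^sup>2 * u'' w b a"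
    if "0 < t" "t \<le> r / 2" "norm a \<le> 1" "norm b \<le> 1" for t a b
  proof (rule mixed_difference_mvt)
    have "cball z (2 * t) \<subseteq> S"
      using r that by (auto simp: subset_iff)
    then show "w \<in> cball z (2 * t) \<Longrightarrow> (u has_derivative blinfun_apply (u' w)) (at w)"
      "w \<in> cball z (2 * t) \<Longrightarrow> (u' has_derivative blinfun_apply (u'' w)) (at w)" for w
      using C2 by (auto simp: C2_derivs_on_def)
  qed (use that in auto)
  have "\<bar>u'' z a b - u'' z b a\<bar> \<le> e" if "e > 0" for e
  proof -
    have "e / 2 > 0" using that by simp
    then obtain d1 where d1: "d1 > 0" "\<And>w. w \<in> cball z d1 \<Longrightarrow> \<bar>u'' w b a - u'' z b a\<bar> < e/2"
    proof -
      have "\<forall>\<^sub>F w in nhds z. dist (u'' w b a) (u'' z b a) < e/2"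
        using tend[of b a] \<open>e/2 > 0\<close> by (rule tendstoD)
      then obtain d where "d > 0" "\<And>w. dist w z < d \<Longrightarrow> dist (u'' w b a) (u'' z b a) < e/2"
        by (auto simp: eventually_nhds_metric)
      then show ?thesis
        using that[of "d/2"] by (auto simp: dist_real_def dist_commute)
    qed
    obtain d2 where d2: "d2 > 0" "\<And>w. w \<in> cball z d2 \<Longrightarrow> \<bar>u'' w a b - u'' z a b\<bar> < e/2"
    proof -
      have "\<forall>\<^sub>F w in nhds z. dist (u'' w a b) (u'' z a b) < e/2"
        using tend[of a b] \<open>e/2 > 0\<close> by (rule tendstoD)
      then obtain d where "d > 0" "\<And>w. dist w z < d \<Longrightarrow> dist (u'' w a b) (u'' z a b) < e/2"
        by (auto simp: eventually_nhds_metric)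
      then show ?thesis
        using that[of "d/2"] by (auto simp: dist_real_def dist_commute)
    qed
    define t where "t = min (r/2) (min (d1/2) (d2/2))"
    have t: "0 < t" "t \<le> r/2" "2 * t \<le> d1" "2 * t \<le> d2"
      using r d1 d2 by (auto simp: t_def)
    obtain w1 where w1: "w1 \<in> cball z (2*t)"
      "u (z + t *\<^sub>R a + t *\<^sub>R b) - u (z + t *\<^sub>R a) - u (z + t *\<^sub>R b) + u z = t\<^sup>2 * u'' w1 b a"
      using *[OF t(1,2) nz] by blast
    obtain w2 where w2: "w2 \<in> cball z (2*t)"
      "u (z + t *\<^sub>R b + t *\<^sub>R a) - u (z + t *\<^sub>R b) - u (z + t *\<^sub>R a) + u z = t\<^sup>2 * u'' w2 a b"
      using *[OF t(1,2) nz(2,1)] by blast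
    have "t\<^sup>2 * u'' w1 b a = t\<^sup>2 * u'' w2 a b"
      using w1(2) w2(2) by (simp add: algebra_simps)
    then have "u'' w1 b a = u'' w2 a b" using t by simp
    moreover have "\<bar>u'' w1 b a - u'' z b a\<bar> < e/2" "\<bar>u'' w2 a b - u'' z a b\<bar> < e/2"
      using w1(1) w2(1) t d1 d2 by auto
    ultimately show ?thesis by linarith
  qed
  then show ?thesis
    using field_le_epsilon[of "\<bar>u'' z a b - u'' z b a\<bar>" 0] by simp
qed

text \<open>
  The differential with complex gradient \<open>c\<close>, as a bounded linear map: the format in which
  \<open>harmonic_on\<close> asks for derivatives.
\<close>

definition blinfun_Re_mult :: "complex \<Rightarrow> complex \<Rightarrow>\<^sub>L real" where
  "blinfun_Re_mult c = Blinfun (\<lambda>e. Re (c * e))"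

lemma blinfun_Re_mult_apply [simp]: "blinfun_apply (blinfun_Re_mult c) e = Re (c * e)"
proof -
  have "bounded_linear (\<lambda>e. Re (c * e))"
    by (rule bounded_linear_compose[OF bounded_linear_Re bounded_linear_mult_right])
  then show ?thesis by (simp only: blinfun_Re_mult_def bounded_linear_Blinfun_apply)
qed

lemma bounded_linear_blinfun_Re_mult: "bounded_linear blinfun_Re_mult"
proof (rule bounded_linear_intro[where K=1])
  show "norm (blinfun_Re_mult x) \<le> norm x * 1" for x
    by (rule norm_blinfun_bound)
      (simp_all only: blinfun_Re_mult_apply real_norm_def mult_1_right norm_ge_zero abs_Re_le_cmod
        flip: norm_mult)
qed (auto intro!: blinfun_eqI simp: algebra_simps blinfun.add_left blinfun.scaleR_left)

lemma harmonic_onI: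
  assumes S: "open S" and hol: "G holomorphic_on S"
      and u: "\<And>z. z \<in> S \<Longrightarrow> (u has_derivative (\<lambda>e. Re (G z * e))) (at z)"
  shows "harmonic_on u S"
proof -
  define u'' where "u'' z = blinfun_compose (Blinfun blinfun_Re_mult) (blinfun_mult_right (deriv G z))" for z
  have app: "blinfun_apply (u'' z) e = blinfun_Re_mult (deriv G z * e)" for z e
    by (simp add: u''_def bounded_linear_Blinfun_apply[OF bounded_linear_blinfun_Re_mult])
  have "C2_derivs_on u (\<lambda>z. blinfun_Re_mult (G z)) u'' S"
    unfolding C2_derivs_on_def
  proof (intro conjI ballI)
    show "(u has_derivative blinfun_apply (blinfun_Re_mult (G z))) (at z)" if "z \<in> S" for z
      using u[OF that] by (simp add: blinfun_Re_mult_apply[abs_def])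
    show "((\<lambda>z. blinfun_Re_mult (G z)) has_derivative blinfun_apply (u'' z)) (at z)" if "z \<in> S" for z
    proof -
      have "(G has_derivative (\<lambda>e. deriv G z * e)) (at z)"
        using hol S that by (simp add: holomorphic_derivI flip: has_field_derivative_def)
      from bounded_linear.has_derivative[OF bounded_linear_blinfun_Re_mult this]
      show ?thesis by (simp add: app[abs_def])
    qed
    have "continuous_on S (deriv G)"
      using hol S by (intro holomorphic_on_imp_continuous_on holomorphic_deriv)
    then show "continuous_on S u''"
      unfolding u''_def by (auto intro!: continuous_intros)
  qed
  then show ?thesis
    unfolding harmonic_on_def by (intro exI conjI ballI) (auto simp: app)
qed

text \<open>
  The two real equations that make \<open>u_x - i u_y\<close> complex differentiable are the symmetry of the second
  derivative and the Laplace equation.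
\<close>

lemma harmonic_onD:
  assumes S: "open S" and h: "harmonic_on u S"
  shows "\<And>z. z \<in> S \<Longrightarrow> u differentiable (at z)" "cgrad u holomorphic_on S"
proof -
  obtain u' u'' where C2: "C2_derivs_on u u' u'' S"
    and lap: "\<And>z. z \<in> S \<Longrightarrow> u'' z 1 1 + u'' z \<i> \<i> = 0"
    using h by (auto simp: harmonic_on_def)
  show diff: "\<And>z. z \<in> S \<Longrightarrow> u differentiable (at z)"
    using C2 by (auto simp: C2_derivs_on_def differentiable_def)
  have eq: "cgrad u z = Complex (u' z 1) (- u' z \<i>)" if "z \<in> S" for z
  proof (rule cgrad_eqI)
    have "(u has_derivative blinfun_apply (u' z)) (at z)"
      using C2 that by (auto simp: C2_derivs_on_def)
    moreover have "blinfun_apply (u' z) = (\<lambda>e. Re (Complex (u' z 1) (- u' z \<i>) * e))"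
      using real_linear_eq_Re_mult[OF bounded_linear.linear[OF blinfun.bounded_linear_right], of "u' z"]
      by (rule ext)
    ultimately show "(u has_derivative (\<lambda>e. Re (Complex (u' z 1) (- u' z \<i>) * e))) (at z)"
      by simp
  qed
  have "((\<lambda>z. Complex (u' z 1) (- u' z \<i>)) has_field_derivative Complex (u'' z 1 1) (- u'' z 1 \<i>)) (at z)"
    if z: "z \<in> S" for z
  proof -
    have u': "(u' has_derivative blinfun_apply (u'' z)) (at z)"
      using C2 that by (auto simp: C2_derivs_on_def)
    have app: "((\<lambda>z. u' z d) has_derivative (\<lambda>e. u'' z e d)) (at z)" for d
      by (rule bounded_linear.has_derivative[OF blinfun.bounded_linear_left u'])
    have "((\<lambda>z. complex_of_real (u' z 1) + complex_of_real (- u' z \<i>) * \<i>) has_derivative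
        (\<lambda>e. complex_of_real (u'' z e 1) + complex_of_real (- u'' z e \<i>) * \<i>)) (at z)"
      by (intro has_derivative_add has_derivative_mult_left has_derivative_of_real has_derivative_minus app)
    moreover have "(\<lambda>z. complex_of_real (u' z 1) + complex_of_real (- u' z \<i>) * \<i>) =
        (\<lambda>z. Complex (u' z 1) (- u' z \<i>))"
      by (simp add: fun_eq_iff complex_eq_iff)
    moreover
    have "(\<lambda>e. complex_of_real (u'' z e 1) + complex_of_real (- u'' z e \<i>) * \<i>) =
        (*) (Complex (u'' z 1 1) (- u'' z 1 \<i>))"
    proof
      fix e
      have lin: "linear (\<lambda>e. blinfun_apply (u'' z e) d)" for d
        by (intro bounded_linear.linear bounded_linear_compose[OF blinfun.bounded_linear_left blinfun.bounded_linear_right])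
      have sym: "u'' z \<i> 1 = u'' z 1 \<i>"
        by (rule second_derivative_symmetric[OF C2 S z]) auto
      have lap': "u'' z \<i> \<i> = - u'' z 1 1" using lap[OF z] by linarith
      have "u'' z e 1 = Re (Complex (u'' z 1 1) (- u'' z 1 \<i>) * e)"
        "- u'' z e \<i> = Im (Complex (u'' z 1 1) (- u'' z 1 \<i>) * e)"
        using real_linear_eq_Re_mult[OF lin[of 1], of e] real_linear_eq_Re_mult[OF lin[of \<i>], of e]
        unfolding sym lap' by simp_all
      then show "complex_of_real (u'' z e 1) + complex_of_real (- u'' z e \<i>) * \<i> =
        Complex (u'' z 1 1) (- u'' z 1 \<i>) * e"
        by (simp only: complex_eq_iff) simp
    qed
    ultimately show ?thesis
      by (simp only: has_field_derivative_def)
  qed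
  then have "(\<lambda>z. Complex (u' z 1) (- u' z \<i>)) holomorphic_on S"
    unfolding holomorphic_on_open[OF S] by blast
  then show "cgrad u holomorphic_on S"
    by (rule holomorphic_transform) (simp add: eq)
qed

lemma harmonic_on_iff:
  assumes "open S"
  shows "harmonic_on u S \<longleftrightarrow> (\<forall>z\<in>S. u differentiable (at z)) \<and> cgrad u holomorphic_on S"
proof
  show "harmonic_on u S" if "(\<forall>z\<in>S. u differentiable (at z)) \<and> cgrad u holomorphic_on S"
    using that by (intro harmonic_onI[OF assms, of "cgrad u"] has_derivative_cgrad) auto
qed (use harmonic_onD[OF assms] in auto)

section \<open>Interior estimates and uniform limits\<close>

lemma harmonic_on_subset:
  assumes "harmonic_on u S" "T \<subseteq> S"
  shows "harmonic_on u T"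
proof -
  obtain u' u'' where "C2_derivs_on u u' u'' S" "\<forall>z\<in>S. u'' z 1 1 + u'' z \<i> \<i> = 0"
    using assms(1) by (auto simp: harmonic_on_def)
  then have "C2_derivs_on u u' u'' T" "\<forall>z\<in>T. u'' z 1 1 + u'' z \<i> \<i> = 0"
    using assms(2) by (auto simp: C2_derivs_on_def intro: continuous_on_subset)
  then show ?thesis by (auto simp: harmonic_on_def)
qed

lemma harmonic_on_has_derivative:
  assumes "open S" "harmonic_on u S" "z \<in> S"
  shows "(u has_derivative (\<lambda>e. Re (cgrad u z * e))) (at z)"
  using assms by (intro has_derivative_cgrad harmonic_onD(1))

lemma harmonic_on_continuous_on:
  assumes "open S" "harmonic_on u S"
  shows "continuous_on S u"
  using harmonic_onD(1)[OF assms] differentiable_imp_continuous_within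
  by (intro continuous_at_imp_continuous_on) blast

text \<open>
  \<open>harmonic_on\<close> asks for derivatives chosen globally on \<open>S\<close>; the characterisation by the complex
  gradient is pointwise and so allows local solutions to be glued.
\<close>

lemma harmonic_on_local:
  assumes "open S" "\<And>z. z \<in> S \<Longrightarrow> \<exists>e>0. harmonic_on u (ball z e)"
  shows "harmonic_on u S"
proof -
  have "u differentiable (at z)" "\<exists>g'. (cgrad u has_field_derivative g') (at z)" if z: "z \<in> S" for z
  proof -
    obtain e where e: "e > 0" "harmonic_on u (ball z e)" using assms(2)[OF z] by blast
    then show "u differentiable (at z)" "\<exists>g'. (cgrad u has_field_derivative g') (at z)"
      using harmonic_onD[OF open_ball e(2)] holomorphic_on_open[OF open_ball] by force+
  qed
  then show ?thesis
    using assms(1) by (simp add: harmonic_on_iff holomorphic_on_open)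
qed

lemma harmonic_on_transform:
  assumes "open S" "harmonic_on u S" "\<And>z. z \<in> S \<Longrightarrow> u z = v z"
  shows "harmonic_on v S"
proof (rule harmonic_onI[OF assms(1) harmonic_onD(2)[OF assms(1,2)]])
  fix z assume "z \<in> S"
  then show "(v has_derivative (\<lambda>e. Re (cgrad u z * e))) (at z)"
    using has_derivative_transform_within_open[OF harmonic_on_has_derivative[OF assms(1,2)] assms(1)] assms(3)
    by blast
qed

lemma harmonic_on_linear_combination:
  assumes S: "open S" and u: "harmonic_on u S" and v: "harmonic_on v S"
  shows "harmonic_on (\<lambda>z. a * u z + b * v z) S"
    and "z \<in> S \<Longrightarrow> cgrad (\<lambda>z. a * u z + b * v z) z = of_real a * cgrad u z + of_real b * cgrad v z"
proof -
  have *: "((\<lambda>z. a * u z + b * v z) has_derivative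
      (\<lambda>e. Re ((of_real a * cgrad u z + of_real b * cgrad v z) * e))) (at z)" if "z \<in> S" for z
  proof -
    have "((\<lambda>z. a * u z + b * v z) has_derivative
      (\<lambda>e. a * Re (cgrad u z * e) + b * Re (cgrad v z * e))) (at z)"
      by (intro has_derivative_add has_derivative_mult_right harmonic_on_has_derivative[OF S] u v that)
    then show ?thesis by (simp add: algebra_simps)
  qed
  show "harmonic_on (\<lambda>z. a * u z + b * v z) S"
    using harmonic_onD(2)[OF S u] harmonic_onD(2)[OF S v]
    by (intro harmonic_onI[OF S _ *] holomorphic_intros)
  show "z \<in> S \<Longrightarrow> cgrad (\<lambda>z. a * u z + b * v z) z = of_real a * cgrad u z + of_real b * cgrad v z"
    using * by (rule cgrad_eqI)
qed

lemma harmonic_on_add: "open S \<Longrightarrow> harmonic_on u S \<Longrightarrow> harmonic_on v S \<Longrightarrow> harmonic_on (\<lambda>z. u z + v z) S"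
  using harmonic_on_linear_combination(1)[of S u v 1 1] by simp

lemma harmonic_on_diff: "open S \<Longrightarrow> harmonic_on u S \<Longrightarrow> harmonic_on v S \<Longrightarrow> harmonic_on (\<lambda>z. u z - v z) S"
  using harmonic_on_linear_combination(1)[of S u v 1 "-1"] by simp

lemma cgrad_diff:
  "open S \<Longrightarrow> harmonic_on u S \<Longrightarrow> harmonic_on v S \<Longrightarrow> z \<in> S \<Longrightarrow>
    cgrad (\<lambda>z. u z - v z) z = cgrad u z - cgrad v z"
  using harmonic_on_linear_combination(2)[of S u v z 1 "-1"] by simp

lemma harmonic_on_cmult: "open S \<Longrightarrow> harmonic_on u S \<Longrightarrow> harmonic_on (\<lambda>z. a * u z) S"
  using harmonic_on_linear_combination(1)[of S u u a 0] by simp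

lemma has_derivative_Re_holomorphic:
  assumes "(f has_field_derivative f') (at z)"
  shows "((\<lambda>z. Re (f z)) has_derivative (\<lambda>e. Re (f' * e))) (at z)"
  using bounded_linear.has_derivative[OF bounded_linear_Re assms[unfolded has_field_derivative_def]] .

lemma harmonic_on_Re:
  assumes "open S" "f holomorphic_on S"
  shows "harmonic_on (\<lambda>z. Re (f z)) S"
  by (rule harmonic_onI[OF assms(1) holomorphic_deriv[OF assms(2,1)]])
     (intro has_derivative_Re_holomorphic holomorphic_derivI[OF assms(2,1)])

lemma harmonic_on_const: "open S \<Longrightarrow> harmonic_on (\<lambda>z. c) S"
  using harmonic_on_Re[of S "\<lambda>z. of_real c"] by simp

lemma has_derivative_ln_cmod:
  assumes "z \<noteq> 0"
  shows "((\<lambda>z. ln (cmod z)) has_derivative (\<lambda>e. Re (1 / z * e))) (at z)"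
proof -
  have "(cmod has_derivative (\<lambda>e. inner e (sgn z))) (at z)"
    by (rule has_derivative_norm[OF assms])
  then have "((\<lambda>z. ln (cmod z)) has_derivative (\<lambda>e. inner e (sgn z) / cmod z)) (at z)"
    using assms by (auto intro!: derivative_eq_intros simp: divide_inverse mult.commute)
  moreover have "inner e (sgn z) / cmod z = Re (1 / z * e)" for e
  proof -
    have "inner e (sgn z) / cmod z = (Re e * Re z + Im e * Im z) / (cmod z)\<^sup>2"
      by (simp add: sgn_div_norm inner_complex_def power2_eq_square divide_inverse algebra_simps)
    also have "\<dots> = Re (e / z)"
      by (simp add: Re_divide cmod_power2)
    finally show ?thesis by simp
  qed
  ultimately show ?thesis by simp
qed

lemma harmonic_on_ln_cmod:
  assumes S: "open S" and f: "f holomorphic_on S" and nz: "\<And>z. z \<in> S \<Longrightarrow> f z \<noteq> 0"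
  shows "harmonic_on (\<lambda>z. ln (cmod (f z))) S"
proof (rule harmonic_onI[OF S, of "\<lambda>z. deriv f z / f z"])
  show "(\<lambda>z. deriv f z / f z) holomorphic_on S"
    using nz by (intro holomorphic_intros f S) auto
  fix z assume z: "z \<in> S"
  have "(f has_derivative (\<lambda>e. deriv f z * e)) (at z)"
    using holomorphic_derivI[OF f S z] by (simp add: has_field_derivative_def)
  from has_derivative_compose[OF this has_derivative_ln_cmod[OF nz[OF z]]]
  show "((\<lambda>z. ln (cmod (f z))) has_derivative (\<lambda>e. Re (deriv f z / f z * e))) (at z)"
    by simp
qed

text \<open>
  On a disc the holomorphic complex gradient has a primitive, whose real part is \<open>u\<close> up to a constant.
\<close>

lemma harmonic_conjugate:
  assumes h: "harmonic_on u (ball c r)"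
  obtains f where "f holomorphic_on ball c r" "\<And>z. z \<in> ball c r \<Longrightarrow> Re (f z) = u z"
    "\<And>z. z \<in> ball c r \<Longrightarrow> (f has_field_derivative cgrad u z) (at z)"
proof -
  obtain g where g: "\<And>z. z \<in> ball c r \<Longrightarrow> (g has_field_derivative cgrad u z) (at z within ball c r)"
    using holomorphic_convex_primitive'[OF convex_ball open_ball harmonic_onD(2)[OF open_ball h]] by blast
  have g': "(g has_field_derivative cgrad u z) (at z)" if "z \<in> ball c r" for z
    using g[OF that] that by (simp add: at_within_open[OF _ open_ball])
  have "((\<lambda>z. Re (g z) - u z) has_derivative (\<lambda>e. 0)) (at z within ball c r)" if "z \<in> ball c r" for z
    using has_derivative_diff[OF has_derivative_Re_holomorphic[OF g'[OF that]]
        harmonic_on_has_derivative[OF open_ball h that]]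
    by (simp add: has_derivative_at_withinI)
  from has_derivative_zero_constant[OF convex_ball this]
  obtain k where k: "\<And>z. z \<in> ball c r \<Longrightarrow> Re (g z) - u z = k" by blast
  show ?thesis
  proof (rule that[of "\<lambda>z. g z - of_real k"])
    show d: "((\<lambda>z. g z - of_real k) has_field_derivative cgrad u z) (at z)" if "z \<in> ball c r" for z
      using g'[OF that] by (auto intro!: derivative_eq_intros)
    then show "(\<lambda>z. g z - of_real k) holomorphic_on ball c r"
      unfolding holomorphic_on_open[OF open_ball] by blast
    show "Re (g z - of_real k) = u z" if "z \<in> ball c r" for z
      using k[OF that] by simp
  qed
qed

text \<open>
  If \<open>u = Re f\<close> then \<open>exp (f / M)\<close> is holomorphic with modulus between \<open>1/e\<close> and \<open>e\<close>. Cauchy's inequality on the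
  disc of radius \<open>r/2\<close> bounds its derivative by \<open>2 e / r\<close>, and dividing by the modulus at the centre
  bounds that of \<open>f / M\<close> by \<open>2 e^2 / r\<close>.
\<close>

lemma cgrad_bound:
  assumes h: "harmonic_on u (ball c r)" and r: "r > 0" and M: "M > 0"
      and b: "\<And>z. z \<in> ball c r \<Longrightarrow> \<bar>u z\<bar> \<le> M"
  shows "cmod (cgrad u c) \<le> 18 * M / r"
proof -
  obtain f where f: "f holomorphic_on ball c r" "\<And>z. z \<in> ball c r \<Longrightarrow> Re (f z) = u z"
    "\<And>z. z \<in> ball c r \<Longrightarrow> (f has_field_derivative cgrad u z) (at z)"
    using harmonic_conjugate[OF h] by metis
  define g where "g z = exp (f z / of_real M)" for z
  have ng: "cmod (g z) = exp (u z / M)" if "z \<in> ball c r" for z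
    using f(2)[OF that] M by (simp add: g_def Re_divide_of_real)
  have hol: "g holomorphic_on ball c r"
    unfolding g_def using f(1) M by (auto intro!: holomorphic_intros)
  have "(g has_field_derivative g c * (cgrad u c / of_real M)) (at c)"
    unfolding g_def using f(3)[of c] r M by (auto intro!: derivative_eq_intros)
  then have dg: "deriv g c = g c * (cgrad u c / of_real M)" by (rule DERIV_imp_deriv)
  have "cmod ((deriv ^^ 1) g c) \<le> fact 1 * exp 1 / (r/2)^1"
  proof (rule Cauchy_inequality)
    show "g holomorphic_on ball c (r/2)" "continuous_on (cball c (r/2)) g"
      using hol r by (auto intro!: holomorphic_on_subset[OF hol] holomorphic_on_imp_continuous_on)
    show "cmod (g x) \<le> exp 1" if "cmod (c - x) = r/2" for x
    proof -
      have "x \<in> ball c r" using that r by (simp add: dist_norm)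
      then show ?thesis using ng[of x] b[of x] M by (simp add: field_simps)
    qed
  qed (use r in auto)
  then have "exp (u c / M) * cmod (cgrad u c) / M \<le> 2 * exp 1 / r"
    using dg ng[of c] r M by (simp add: norm_mult norm_divide mult.commute)
  moreover have "exp (-1) * (cmod (cgrad u c) / M) \<le> exp (u c / M) * (cmod (cgrad u c) / M)"
    using b[of c] r M by (intro mult_right_mono) (auto simp: field_simps)
  ultimately have "exp (-1) * (cmod (cgrad u c) / M) \<le> 2 * exp 1 / r" by simp
  then have "cmod (cgrad u c) \<le> 2 * (exp 1 * exp 1) * M / r"
    using M r by (simp add: exp_minus field_simps)
  also have "\<dots> \<le> 2 * (3 * 3) * M / r"
    using exp_le M r by (intro divide_right_mono mult_right_mono mult_left_mono mult_mono) auto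
  finally show ?thesis by simp
qed

lemma cgrad_bound_ball:
  assumes h: "harmonic_on u (ball c r)" and M: "M > 0"
      and b: "\<And>z. z \<in> ball c r \<Longrightarrow> \<bar>u z\<bar> \<le> M" and w: "w \<in> ball c r"
  shows "cmod (cgrad u w) \<le> 18 * M / (r - dist c w)"
proof -
  have sub: "ball w (r - dist c w) \<subseteq> ball c r"
    by (simp add: ball_subset_ball_iff dist_commute)
  show ?thesis
    by (rule cgrad_bound) (use harmonic_on_subset[OF h sub] M b sub w in auto)
qed

lemma deriv_cgrad_bound:
  assumes h: "harmonic_on u (ball c r)" and r: "r > 0" and M: "M > 0"
      and b: "\<And>z. z \<in> ball c r \<Longrightarrow> \<bar>u z\<bar> \<le> M"
  shows "cmod (deriv (cgrad u) c) \<le> 144 * M / r\<^sup>2"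
proof -
  have hol: "cgrad u holomorphic_on ball c r" by (rule harmonic_onD(2)[OF open_ball h])
  have "cmod ((deriv ^^ 1) (cgrad u) c) \<le> fact 1 * (36 * M / r) / (r/4)^1"
  proof (rule Cauchy_inequality)
    show "cgrad u holomorphic_on ball c (r/4)" "continuous_on (cball c (r/4)) (cgrad u)"
      using hol r by (auto intro!: holomorphic_on_subset[OF hol] holomorphic_on_imp_continuous_on)
    show "cmod (cgrad u x) \<le> 36 * M / r" if "cmod (c - x) = r/4" for x
    proof -
      have "cmod (cgrad u x) \<le> 18 * M / (r - dist c x)"
        using that r by (intro cgrad_bound_ball[OF h M b]) (auto simp: dist_norm)
      also have "\<dots> \<le> 18 * M / (r / 2)"
        using that r M by (intro divide_left_mono) (auto simp: dist_norm)
      finally show ?thesis by simp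
    qed
  qed (use r in auto)
  then show ?thesis by (simp add: power2_eq_square)
qed

text \<open>
  The factor 576 is the bound of \<open>deriv_cgrad_bound\<close> for discs of radius \<open>r/2\<close> whose centres lie within
  \<open>r/2\<close> of \<open>c\<close>.
\<close>

lemma harmonic_taylor:
  assumes h: "harmonic_on u (ball c r)" and r: "r > 0" and M: "M > 0"
      and b: "\<And>z. z \<in> ball c r \<Longrightarrow> \<bar>u z\<bar> \<le> M" and e: "cmod e < r / 2"
  shows "\<bar>u (c + e) - u c - Re (cgrad u c * e)\<bar> \<le> 576 * M / r\<^sup>2 * (cmod e)\<^sup>2"
proof -
  obtain f where f: "f holomorphic_on ball c r" "\<And>z. z \<in> ball c r \<Longrightarrow> Re (f z) = u z"
    "\<And>z. z \<in> ball c r \<Longrightarrow> (f has_field_derivative cgrad u z) (at z)"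
    using harmonic_conjugate[OF h] by metis
  have hol: "cgrad u holomorphic_on ball c r" by (rule harmonic_onD(2)[OF open_ball h])
  define F where "F i = (if i = 0 then f else if i = Suc 0 then cgrad u else deriv (cgrad u))" for i :: nat
  have in_r: "x \<in> ball c r" if "x \<in> ball c (r/2)" for x
    using that r by auto
  have "cmod (F 0 (c + e) - (\<Sum>i\<le>1. F i c * (c + e - c) ^ i / fact i))
      \<le> 576 * M / r\<^sup>2 * cmod (c + e - c) ^ Suc 1 / fact 1"
  proof (rule complex_Taylor[where S = "ball c (r/2)"])
    show "(F i has_field_derivative F (Suc i) x) (at x within ball c (r/2))"
      if "x \<in> ball c (r/2)" "i \<le> 1" for i x
      using that f(3)[OF in_r[OF that(1)]] holomorphic_derivI[OF hol open_ball in_r[OF that(1)]]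
      by (auto simp: F_def le_Suc_eq intro: has_field_derivative_at_within)
    show "cmod (F (Suc 1) x) \<le> 576 * M / r\<^sup>2" if "x \<in> ball c (r/2)" for x
    proof -
      have sub: "ball x (r/2) \<subseteq> ball c r"
        using that by (auto simp: ball_subset_ball_iff dist_commute)
      have "cmod (deriv (cgrad u) x) \<le> 144 * M / (r/2)\<^sup>2"
        by (rule deriv_cgrad_bound) (use harmonic_on_subset[OF h sub] M b sub r in auto)
      then show ?thesis by (simp add: F_def power_divide)
    qed
  qed (use r e in \<open>auto simp: dist_norm\<close>)
  then have "cmod (f (c + e) - f c - cgrad u c * e) \<le> 576 * M / r\<^sup>2 * (cmod e)\<^sup>2"
    by (simp add: F_def power2_eq_square algebra_simps)
  moreover have "u (c + e) - u c - Re (cgrad u c * e) = Re (f (c + e) - f c - cgrad u c * e)"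
    using f(2)[of "c + e"] f(2)[of c] e r by (simp add: dist_norm)
  ultimately show ?thesis
    using abs_Re_le_cmod[of "f (c + e) - f c - cgrad u c * e"] by linarith
qed

text \<open>
  By the gradient estimate a uniformly convergent sequence of harmonic functions has locally uniformly
  convergent complex gradients. Their limit is holomorphic, and it is the complex gradient of the limit.
\<close>

lemma harmonic_uniform_limit:
  assumes h: "\<And>n. harmonic_on (v n) (ball c R)"
      and lim: "uniform_limit (ball c R) v u sequentially"
  shows "harmonic_on u (ball c R)"
proof (rule harmonic_on_local[OF open_ball])
  fix z assume z: "z \<in> ball c R"
  define r where "r = (R - dist c z) / 2"
  have r: "r > 0" using z by (simp add: r_def)
  have sub: "ball w r \<subseteq> ball c R" if "w \<in> ball z r" for w
  proof
    fix x assume "x \<in> ball w r"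
    then have "dist c x < dist c z + r + r"
      using that dist_triangle[of c x z] dist_triangle[of z x w] by simp
    then show "x \<in> ball c R" by (simp add: r_def)
  qed
  have subz: "ball z r \<subseteq> ball c R" using sub[of z] r by simp
  have close: "\<exists>N. \<forall>m\<ge>N. \<forall>n\<ge>N. \<forall>w\<in>ball z r. cmod (cgrad (v m) w - cgrad (v n) w) < e" if e: "e > 0" for e
  proof -
    define d where "d = e * r / 72"
    have d: "d > 0" using e r by (simp add: d_def)
    obtain N where "\<forall>n\<ge>N. \<forall>w\<in>ball c R. dist (v n w) (u w) < d"
      using uniform_limitD[OF lim d] unfolding eventually_sequentially by blast
    then have N: "\<bar>v n w - u w\<bar> < d" if "n \<ge> N" "w \<in> ball c R" for n w
      using that by (auto simp: dist_real_def)
    show ?thesis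
    proof (intro exI[of _ N] allI impI ballI)
      fix m n w assume mn: "m \<ge> N" "n \<ge> N" and w: "w \<in> ball z r"
      have hw: "harmonic_on (v k) (ball w r)" for k
        using harmonic_on_subset[OF h sub[OF w]] .
      have "cmod (cgrad (\<lambda>z. v m z - v n z) w) \<le> 18 * (2 * d) / r"
      proof (rule cgrad_bound[OF _ r])
        show "harmonic_on (\<lambda>z. v m z - v n z) (ball w r)"
          by (intro harmonic_on_diff open_ball hw)
        show "\<bar>v m x - v n x\<bar> \<le> 2 * d" if "x \<in> ball w r" for x
        proof -
          have "x \<in> ball c R" using sub[OF w] that by blast
          then show ?thesis using N[OF mn(1), of x] N[OF mn(2), of x] by linarith
        qed
      qed (use d in auto)
      also have "\<dots> < e" using e r by (simp add: d_def)
      finally show "cmod (cgrad (v m) w - cgrad (v n) w) < e"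
        using cgrad_diff[OF open_ball hw hw, of w m n] r by simp
    qed
  qed
  have "uniformly_convergent_on (ball z r) (\<lambda>n. cgrad (v n))"
  proof (intro Cauchy_uniformly_convergent, unfold uniformly_Cauchy_on_def dist_norm, intro allI impI)
    fix e :: real assume "e > 0"
    then obtain N where "\<forall>m\<ge>N. \<forall>n\<ge>N. \<forall>w\<in>ball z r. cmod (cgrad (v m) w - cgrad (v n) w) < e"
      using close by meson
    then show "\<exists>N. \<forall>w\<in>ball z r. \<forall>m\<ge>N. \<forall>n\<ge>N. cmod (cgrad (v m) w - cgrad (v n) w) < e"
      by (intro exI[of _ N]) blast
  qed
  then obtain G where G: "uniform_limit (ball z r) (\<lambda>n. cgrad (v n)) G sequentially"
    by (auto simp: uniformly_convergent_on_def)
  have holG: "G holomorphic_on ball z r"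
  proof (rule holomorphic_uniform_sequence[OF open_ball])
    show "cgrad (v n) holomorphic_on ball z r" for n
      using harmonic_onD(2)[OF open_ball harmonic_on_subset[OF h subz]] .
    show "\<exists>d>0. cball x d \<subseteq> ball z r \<and> uniform_limit (cball x d) (\<lambda>n. cgrad (v n)) G sequentially"
      if x: "x \<in> ball z r" for x
    proof -
      obtain d where "d > 0" "cball x d \<subseteq> ball z r"
        using open_contains_cball_eq[OF open_ball] x by metis
      then show ?thesis by (intro exI[of _ d] conjI uniform_limit_on_subset[OF G]) auto
    qed
  qed
  have pt: "(\<lambda>n. v n w) \<longlonglongrightarrow> u w" if "w \<in> ball c R" for w
    using tendsto_uniform_limitI[OF lim that] .
  have "\<exists>g. \<forall>x\<in>ball z r. (\<lambda>n. v n x) \<longlonglongrightarrow> g x \<and>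
      (g has_derivative (\<lambda>e. Re (G x * e))) (at x within ball z r)"
  proof (rule has_derivative_sequence[OF convex_ball])
    show "(v n has_derivative (\<lambda>e. Re (cgrad (v n) x * e))) (at x within ball z r)"
      if "x \<in> ball z r" for n x
      by (rule has_derivative_at_withinI[OF harmonic_on_has_derivative[OF open_ball h subsetD[OF subz that]]])
    show "\<forall>\<^sub>F n in sequentially. \<forall>x\<in>ball z r. \<forall>h. norm (Re (cgrad (v n) x * h) - Re (G x * h)) \<le> e * norm h"
      if "e > 0" for e
      using uniform_limitD[OF G that]
    proof eventually_elim
      case (elim n)
      show ?case
      proof (intro ballI allI)
        fix x h assume "x \<in> ball z r"
        then have "cmod (cgrad (v n) x - G x) \<le> e" using elim by (auto simp: dist_norm intro: less_imp_le)
        then have "cmod ((cgrad (v n) x - G x) * h) \<le> e * norm h"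
          by (simp add: norm_mult mult_right_mono)
        moreover have "Re (cgrad (v n) x * h) - Re (G x * h) = Re ((cgrad (v n) x - G x) * h)"
          by (simp add: algebra_simps)
        ultimately show "norm (Re (cgrad (v n) x * h) - Re (G x * h)) \<le> e * norm h"
          using abs_Re_le_cmod[of "(cgrad (v n) x - G x) * h"] by (simp only: real_norm_def)
      qed
    qed
    show "z \<in> ball z r" using r by simp
    show "(\<lambda>n. v n z) \<longlonglongrightarrow> u z" using pt z .
  qed
  then obtain g where g_all: "\<forall>x\<in>ball z r. (\<lambda>n. v n x) \<longlonglongrightarrow> g x \<and>
      (g has_derivative (\<lambda>e. Re (G x * e))) (at x within ball z r)"
    by (rule exE)
  have g: "(\<lambda>n. v n x) \<longlonglongrightarrow> g x"
    "(g has_derivative (\<lambda>e. Re (G x * e))) (at x within ball z r)" if "x \<in> ball z r" for x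
    using bspec[OF g_all that] by simp_all
  have eq: "g x = u x" if "x \<in> ball z r" for x
    using LIMSEQ_unique[OF g(1)[OF that] pt] that subz by blast
  have "harmonic_on g (ball z r)"
    using g(2) by (intro harmonic_onI[OF open_ball holG]) (simp add: at_within_open[OF _ open_ball])
  then have "harmonic_on u (ball z r)"
    by (rule harmonic_on_transform[OF open_ball _ eq])
  then show "\<exists>e>0. harmonic_on u (ball z e)" using r by blast
qed

section \<open>Separately harmonic functions on the diagonal\<close>

definition separately_harmonic_on :: "(complex \<Rightarrow> complex \<Rightarrow> real) \<Rightarrow> complex set \<Rightarrow> bool" where
  "separately_harmonic_on k S \<longleftrightarrow>
     (\<forall>w\<in>S. harmonic_on (\<lambda>z. k z w) S) \<and> (\<forall>z\<in>S. harmonic_on (\<lambda>w. k z w) S)"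

lemma separately_harmonic_on_swap:
  "separately_harmonic_on k S \<Longrightarrow> separately_harmonic_on (\<lambda>z w. k w z) S"
  by (simp add: separately_harmonic_on_def)

lemma separately_harmonic_on_subset:
  "separately_harmonic_on k S \<Longrightarrow> T \<subseteq> S \<Longrightarrow> separately_harmonic_on k T"
  unfolding separately_harmonic_on_def by (auto intro: harmonic_on_subset[of _ S T])

text \<open>
  Differentiation in the first variable keeps functions separately harmonic: in that variable the
  derivative is the real part of a holomorphic function, and in the other variable it is a uniform
  limit of difference quotients, each of which is harmonic.
\<close>

lemma separately_harmonic_partial:
  assumes k: "separately_harmonic_on k (ball c r)" and r: "r > 0" and M: "M > 0"
      and b: "\<And>z w. z \<in> ball c r \<Longrightarrow> w \<in> ball c r \<Longrightarrow> \<bar>k z w\<bar> \<le> M"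
      and d: "cmod d \<le> 1"
  shows "separately_harmonic_on (\<lambda>z w. Re (cgrad (\<lambda>x. k x w) z * d)) (ball c (r/2))"
    and "\<And>z w. z \<in> ball c (r/2) \<Longrightarrow> w \<in> ball c (r/2) \<Longrightarrow> \<bar>Re (cgrad (\<lambda>x. k x w) z * d)\<bar> \<le> 36 * M / r"
proof -
  have hz: "harmonic_on (\<lambda>z. k z w) (ball c r)" if "w \<in> ball c r" for w
    using k that by (simp add: separately_harmonic_on_def)
  have hw: "harmonic_on (\<lambda>w. k z w) (ball c r)" if "z \<in> ball c r" for z
    using k that by (simp add: separately_harmonic_on_def)
  have sub: "ball z (r/2) \<subseteq> ball c r" if "z \<in> ball c (r/2)" for z
    using that by (auto simp: ball_subset_ball_iff dist_commute)
  have half: "z \<in> ball c r" if "z \<in> ball c (r/2)" for z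
    using that r by simp
  have harm_w: "harmonic_on (\<lambda>w. Re (cgrad (\<lambda>x. k x w) z * d)) (ball c r)" if z: "z \<in> ball c (r/2)" for z
  proof (rule harmonic_uniform_limit)
    \<comment> \<open>The offset 5 keeps the steps below \<open>r/4\<close>, where the Taylor estimate on the disc of radius \<open>r/2\<close> applies.\<close>
    define t where "t n = r / (real n + 5)" for n
    have t: "0 < t n" "t n \<le> r / 5" for n
      using r by (auto simp: t_def field_simps)
    have td: "cmod (of_real (t n) * d) < r / 4" "cmod (of_real (t n) * d) \<le> t n" for n
    proof -
      show *: "cmod (of_real (t n) * d) \<le> t n"
        using t[of n] mult_left_mono[OF d, of "t n"] by (simp add: norm_mult)
      show "cmod (of_real (t n) * d) < r / 4"
        using * t(2)[of n] r by linarith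
    qed
    have zt: "z + of_real (t n) * d \<in> ball c r" for n
      using sub[OF z] td(1)[of n] r by (auto simp: dist_norm subset_iff)
    define q where "q n w = (1 / t n) * (k (z + of_real (t n) * d) w - k z w)" for n w
    show "harmonic_on (q n) (ball c r)" for n
      unfolding q_def by (intro harmonic_on_cmult harmonic_on_diff open_ball hw zt half z)
    define C where "C = 576 * M / (r/2)\<^sup>2"
    have C: "C > 0" using M r by (simp add: C_def)
    have est: "\<bar>q n w - Re (cgrad (\<lambda>x. k x w) z * d)\<bar> \<le> C * t n" if w: "w \<in> ball c r" for n w
    proof -
      let ?G = "cgrad (\<lambda>x. k x w) z"
      have "\<bar>k (z + of_real (t n) * d) w - k z w - Re (?G * (of_real (t n) * d))\<bar>
          \<le> C * (cmod (of_real (t n) * d))\<^sup>2"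
        unfolding C_def
      proof (rule harmonic_taylor[of "\<lambda>x. k x w"])
        show "harmonic_on (\<lambda>x. k x w) (ball z (r/2))"
          using harmonic_on_subset[OF hz[OF w] sub[OF z]] .
        show "\<And>x. x \<in> ball z (r/2) \<Longrightarrow> \<bar>k x w\<bar> \<le> M"
          using b w sub[OF z] by blast
        show "cmod (of_real (t n) * d) < r / 2 / 2" using td(1)[of n] by simp
      qed (use r M in auto)
      also have "\<dots> \<le> C * (t n)\<^sup>2"
        using C td(2)[of n] by (intro mult_left_mono power_mono) auto
      finally have *: "\<bar>k (z + of_real (t n) * d) w - k z w - Re (?G * (of_real (t n) * d))\<bar> \<le> C * (t n)\<^sup>2" .
      have "Re (?G * (of_real (t n) * d)) = t n * Re (?G * d)"
        by (simp add: algebra_simps)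
      then have "k (z + of_real (t n) * d) w - k z w - Re (?G * (of_real (t n) * d)) = t n * (q n w - Re (?G * d))"
        using t(1)[of n] by (simp add: q_def field_simps)
      then have "t n * \<bar>q n w - Re (?G * d)\<bar> \<le> t n * (C * t n)"
        using * t(1)[of n] by (simp add: abs_mult power2_eq_square mult_ac)
      then show ?thesis using t(1)[of n] by simp
    qed
    have lim0: "(\<lambda>n. C * t n) \<longlonglongrightarrow> 0"
      unfolding t_def by real_asymp
    show "uniform_limit (ball c r) q (\<lambda>w. Re (cgrad (\<lambda>x. k x w) z * d)) sequentially"
    proof (rule uniform_limitI)
      fix e :: real assume "e > 0"
      then have "\<forall>\<^sub>F n in sequentially. C * t n < e"
        using order_tendstoD(2)[OF lim0] by blast
      then show "\<forall>\<^sub>F n in sequentially. \<forall>w\<in>ball c r. dist (q n w) (Re (cgrad (\<lambda>x. k x w) z * d)) < e"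
      proof eventually_elim
        case (elim n)
        then show ?case using est[of _ n] by (fastforce simp: dist_real_def)
      qed
    qed
  qed
  have hol: "(\<lambda>z. cgrad (\<lambda>x. k x w) z * d) holomorphic_on ball c r" if "w \<in> ball c r" for w
    using harmonic_onD(2)[OF open_ball hz[OF that]] by (intro holomorphic_on_mult holomorphic_on_const)
  have sub2: "ball c (r/2) \<subseteq> ball c r" using half by blast
  show "separately_harmonic_on (\<lambda>z w. Re (cgrad (\<lambda>x. k x w) z * d)) (ball c (r/2))"
    unfolding separately_harmonic_on_def
  proof (intro conjI ballI)
    show "harmonic_on (\<lambda>z. Re (cgrad (\<lambda>x. k x w) z * d)) (ball c (r/2))" if "w \<in> ball c (r/2)" for w
      by (rule harmonic_on_subset[OF harmonic_on_Re[OF open_ball hol[OF half[OF that]]] sub2])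
    show "harmonic_on (\<lambda>w. Re (cgrad (\<lambda>x. k x w) z * d)) (ball c (r/2))" if "z \<in> ball c (r/2)" for z
      by (rule harmonic_on_subset[OF harm_w[OF that] sub2])
  qed
  show "\<bar>Re (cgrad (\<lambda>x. k x w) z * d)\<bar> \<le> 36 * M / r" if z: "z \<in> ball c (r/2)" and w: "w \<in> ball c (r/2)" for z w
  proof -
    have "cmod (cgrad (\<lambda>x. k x w) z) \<le> 18 * M / (r/2)"
    proof (rule cgrad_bound)
      show "harmonic_on (\<lambda>x. k x w) (ball z (r/2))"
        using harmonic_on_subset[OF hz[OF half[OF w]] sub[OF z]] .
      show "\<And>x. x \<in> ball z (r/2) \<Longrightarrow> \<bar>k x w\<bar> \<le> M"
        using b half[OF w] sub[OF z] by blast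
    qed (use r M in auto)
    then have "cmod (cgrad (\<lambda>x. k x w) z) * cmod d \<le> (18 * M / (r/2)) * 1"
      using d r M by (intro mult_mono) auto
    then show ?thesis
      using abs_Re_le_cmod[of "cgrad (\<lambda>x. k x w) z * d"] by (simp add: norm_mult)
  qed
qed

text \<open>
  The increment on the diagonal is split into an increment in the first variable, taken with the second
  one already moved to \<open>c + h\<close>, and one in the second variable. Taylor's formula handles both; moving the
  gradient in the first variable back from \<open>c + h\<close> to \<open>c\<close> uses that it is continuous in the second variable.
\<close>

lemma separately_harmonic_diagonal_derivative:
  assumes k: "separately_harmonic_on k (ball c r)" and r: "r > 0" and M: "M > 0"
      and b: "\<And>z w. z \<in> ball c r \<Longrightarrow> w \<in> ball c r \<Longrightarrow> \<bar>k z w\<bar> \<le> M"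
  shows "((\<lambda>z. k z z) has_derivative (\<lambda>e. Re ((cgrad (\<lambda>x. k x c) c + cgrad (k c) c) * e))) (at c)"
    and "cmod (cgrad (\<lambda>x. k x c) c + cgrad (k c) c) \<le> 36 * M / r"
proof -
  define G where "G w = cgrad (\<lambda>x. k x w) c" for w
  define H where "H = cgrad (k c) c"
  have hz: "harmonic_on (\<lambda>z. k z w) (ball c r)" if "w \<in> ball c r" for w
    using k that by (simp add: separately_harmonic_on_def)
  have hw: "harmonic_on (k c) (ball c r)"
    using k r by (simp add: separately_harmonic_on_def)
  have cont: "isCont (\<lambda>w. Re (G w * d)) c" if "cmod d \<le> 1" for d
  proof -
    have "harmonic_on (\<lambda>w. Re (G w * d)) (ball c (r/2))"
      using separately_harmonic_partial(1)[OF k r M b that] r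
      by (auto simp: G_def separately_harmonic_on_def)
    from harmonic_on_continuous_on[OF open_ball this] show ?thesis
      using r by (simp add: continuous_on_eq_continuous_at)
  qed
  have "isCont (\<lambda>w. of_real (Re (G w * 1)) + \<i> * of_real (- Re (G w * \<i>))) c"
    by (intro continuous_intros cont) auto
  moreover have "of_real (Re (G w * 1)) + \<i> * of_real (- Re (G w * \<i>)) = G w" for w
    by (simp add: complex_eq_iff)
  ultimately have "isCont G c" by simp
  then have G0: "(\<lambda>h. G (c + h)) \<midarrow>0\<rightarrow> G c"
    by (simp only: isCont_def LIM_offset_zero)
  define C where "C = 576 * M / r\<^sup>2"
  have bound: "norm (k (c + h) (c + h) - k c c - Re ((G c + H) * h)) / norm h
      \<le> 2 * C * cmod h + cmod (G (c + h) - G c)" if h: "h \<noteq> 0" "cmod h < r/2" for h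
  proof -
    have ch: "c + h \<in> ball c r" using h r by (simp add: dist_norm)
    have 1: "\<bar>k (c + h) (c + h) - k c (c + h) - Re (G (c + h) * h)\<bar> \<le> C * (cmod h)\<^sup>2"
      unfolding G_def C_def
      by (rule harmonic_taylor[of "\<lambda>x. k x (c + h)"]) (use hz[OF ch] r M b ch h in auto)
    have 2: "\<bar>k c (c + h) - k c c - Re (H * h)\<bar> \<le> C * (cmod h)\<^sup>2"
      unfolding H_def C_def
      by (rule harmonic_taylor[of "k c"]) (use hw r M b h in auto)
    have 3: "\<bar>Re ((G (c + h) - G c) * h)\<bar> \<le> cmod (G (c + h) - G c) * cmod h"
      using abs_Re_le_cmod[of "(G (c + h) - G c) * h"] by (simp add: norm_mult)
    have "k (c + h) (c + h) - k c c - Re ((G c + H) * h) =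
       (k (c + h) (c + h) - k c (c + h) - Re (G (c + h) * h)) + (k c (c + h) - k c c - Re (H * h))
        + Re ((G (c + h) - G c) * h)"
      by (simp add: algebra_simps)
    then have "\<bar>k (c + h) (c + h) - k c c - Re ((G c + H) * h)\<bar>
        \<le> C * (cmod h)\<^sup>2 + C * (cmod h)\<^sup>2 + cmod (G (c + h) - G c) * cmod h"
      using 1 2 3 by linarith
    also have "\<dots> = (2 * C * cmod h + cmod (G (c + h) - G c)) * cmod h"
      by (simp add: algebra_simps power2_eq_square)
    finally show ?thesis using h by (simp add: divide_le_eq)
  qed
  have "(\<lambda>h. 2 * C * cmod h + cmod (G (c + h) - G c)) \<midarrow>0\<rightarrow> 2 * C * cmod 0 + cmod (G c - G c)"
    by (intro tendsto_intros G0)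
  then have lim: "(\<lambda>h. 2 * C * cmod h + cmod (G (c + h) - G c)) \<midarrow>0\<rightarrow> 0" by simp
  have ev: "\<forall>\<^sub>F h in at 0. h \<noteq> 0 \<and> cmod h < r/2"
    using r by (auto simp: eventually_at intro!: exI[of _ "r/2"])
  have "(\<lambda>h. norm (k (c + h) (c + h) - k c c - Re ((G c + H) * h)) / norm h) \<midarrow>0\<rightarrow> 0"
  proof (rule tendsto_sandwich[OF _ _ tendsto_const lim])
    show "\<forall>\<^sub>F h in at 0. norm (k (c + h) (c + h) - k c c - Re ((G c + H) * h)) / norm h
        \<le> 2 * C * cmod h + cmod (G (c + h) - G c)"
      using ev by eventually_elim (use bound in blast)
  qed auto
  moreover have "bounded_linear (\<lambda>e. Re ((G c + H) * e))"
    by (rule bounded_linear_compose[OF bounded_linear_Re bounded_linear_mult_right])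
  ultimately show "((\<lambda>z. k z z) has_derivative (\<lambda>e. Re ((cgrad (\<lambda>x. k x c) c + cgrad (k c) c) * e))) (at c)"
    by (simp only: has_derivative_at G_def H_def)
  have "cmod (G c) \<le> 18 * M / r"
    unfolding G_def by (rule cgrad_bound) (use hz[of c] r M b in auto)
  moreover have "cmod H \<le> 18 * M / r"
    unfolding H_def by (rule cgrad_bound) (use hw r M b in auto)
  ultimately show "cmod (cgrad (\<lambda>x. k x c) c + cgrad (k c) c) \<le> 36 * M / r"
    using norm_triangle_ineq[of "G c" H] by (simp add: G_def H_def)
qed

text \<open>
  The first derivatives on the diagonal are themselves diagonal values of separately harmonic functions
  bounded by \<open>36 M / r\<close> on the bidisc of radius \<open>r/2\<close>, so that the formula for the first derivative
  applies a second time.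
\<close>

lemma separately_harmonic_diagonal_second_derivative:
  assumes k: "separately_harmonic_on k (ball c r)" and r: "r > 0" and M: "M > 0"
      and b: "\<And>z w. z \<in> ball c r \<Longrightarrow> w \<in> ball c r \<Longrightarrow> \<bar>k z w\<bar> \<le> M"
  obtains D A where
    "\<And>z. z \<in> ball c (r/2) \<Longrightarrow> ((\<lambda>z. k z z) has_derivative (\<lambda>e. Re (D z * e))) (at z)"
    "(D has_derivative A) (at c)"
    "\<And>e. cmod (A e) \<le> 10368 * M / r\<^sup>2 * cmod e"
proof -
  define D where "D z = cgrad (\<lambda>x. k x z) z + cgrad (k z) z" for z
  have 1: "((\<lambda>z. k z z) has_derivative (\<lambda>e. Re (D z * e))) (at z)" if z: "z \<in> ball c (r/2)" for z
  proof -
    have sub: "ball z (r/2) \<subseteq> ball c r"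
      using that by (auto simp: ball_subset_ball_iff dist_commute)
    have b': "\<bar>k x y\<bar> \<le> M" if "x \<in> ball z (r/2)" "y \<in> ball z (r/2)" for x y
      using b sub that by blast
    show ?thesis unfolding D_def
      by (rule separately_harmonic_diagonal_derivative(1)
          [OF separately_harmonic_on_subset[OF k sub] half_gt_zero[OF r] M b'])
  qed
  have key: "\<exists>a. ((\<lambda>z. Re (D z * d)) has_derivative (\<lambda>e. Re (a * e))) (at c) \<and> cmod a \<le> 5184 * M / r\<^sup>2"
    if d: "cmod d \<le> 1" for d
  proof -
    have r2: "r/2 > 0" and M2: "36 * M / r > 0" using r M by auto
    define K1 where "K1 = (\<lambda>z w. Re (cgrad (\<lambda>x. k x w) z * d))"
    define K2 where "K2 = (\<lambda>w z. Re (cgrad (\<lambda>x. k z x) w * d))"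
    have K1: "separately_harmonic_on K1 (ball c (r/2))"
      "\<And>z w. z \<in> ball c (r/2) \<Longrightarrow> w \<in> ball c (r/2) \<Longrightarrow> \<bar>K1 z w\<bar> \<le> 36 * M / r"
      unfolding K1_def by (rule separately_harmonic_partial[OF k r M b d]; assumption)+
    have K2: "separately_harmonic_on K2 (ball c (r/2))"
      "\<And>z w. z \<in> ball c (r/2) \<Longrightarrow> w \<in> ball c (r/2) \<Longrightarrow> \<bar>K2 z w\<bar> \<le> 36 * M / r"
      unfolding K2_def
      by (rule separately_harmonic_partial[OF separately_harmonic_on_swap[OF k] r M b d]; assumption)+
    define a1 where "a1 = cgrad (\<lambda>x. K1 x c) c + cgrad (K1 c) c"
    define a2 where "a2 = cgrad (\<lambda>x. K2 x c) c + cgrad (K2 c) c"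
    note a1 = separately_harmonic_diagonal_derivative[OF K1(1) r2 M2 K1(2), folded a1_def]
    note a2 = separately_harmonic_diagonal_derivative[OF K2(1) r2 M2 K2(2), folded a2_def]
    have "(\<lambda>z. Re (D z * d)) = (\<lambda>z. K1 z z + K2 z z)"
      by (simp add: fun_eq_iff D_def K1_def K2_def algebra_simps)
    moreover have "(\<lambda>e. Re ((a1 + a2) * e)) = (\<lambda>e. Re (a1 * e) + Re (a2 * e))"
      by (simp add: fun_eq_iff algebra_simps)
    ultimately have "((\<lambda>z. Re (D z * d)) has_derivative (\<lambda>e. Re ((a1 + a2) * e))) (at c)"
      using has_derivative_add[OF a1(1) a2(1)] by (simp only:)
    moreover have "cmod (a1 + a2) \<le> 5184 * M / r\<^sup>2"
      using norm_triangle_ineq[of a1 a2] a1(2) a2(2) by (simp add: power2_eq_square)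
    ultimately show ?thesis by blast
  qed
  have "cmod 1 \<le> 1" "cmod \<i> \<le> 1" by simp_all
  then obtain a b where
    "((\<lambda>z. Re (D z * 1)) has_derivative (\<lambda>e. Re (a * e))) (at c) \<and> cmod a \<le> 5184 * M / r\<^sup>2"
    "((\<lambda>z. Re (D z * \<i>)) has_derivative (\<lambda>e. Re (b * e))) (at c) \<and> cmod b \<le> 5184 * M / r\<^sup>2"
    by (elim key[elim_format] exE) (rule that)
  note a = conjunct1[OF this(1)] conjunct2[OF this(1)] and b = conjunct1[OF this(2)] conjunct2[OF this(2)]
  define A where "A e = complex_of_real (Re (a * e)) - \<i> * of_real (Re (b * e))" for e
  have "((\<lambda>z. complex_of_real (Re (D z * 1)) - \<i> * of_real (Re (D z * \<i>))) has_derivative A) (at c)"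
    unfolding A_def
    by (intro has_derivative_diff has_derivative_mult_right has_derivative_of_real a b)
  moreover have "complex_of_real (Re (D z * 1)) - \<i> * of_real (Re (D z * \<i>)) = D z" for z
    by (simp add: complex_eq_iff)
  ultimately have 2: "(D has_derivative A) (at c)" by simp
  have 3: "cmod (A e) \<le> 10368 * M / r\<^sup>2 * cmod e" for e
  proof -
    have "cmod (complex_of_real (Re (a * e))) \<le> cmod (a * e)"
      "cmod (\<i> * complex_of_real (Re (b * e))) \<le> cmod (b * e)"
      by (simp_all only: norm_mult[of \<i>] norm_ii mult_1 norm_of_real abs_Re_le_cmod)
    then have "cmod (A e) \<le> cmod (a * e) + cmod (b * e)"
      unfolding A_def using norm_triangle_ineq4 order_trans add_mono by meson
    also have "\<dots> \<le> 5184 * M / r\<^sup>2 * cmod e + 5184 * M / r\<^sup>2 * cmod e"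
      unfolding norm_mult by (intro add_mono mult_right_mono a b) auto
    finally show ?thesis by simp
  qed
  show ?thesis by (rule that[OF 1 2 3])
qed

text \<open>
  For real \<open>u\<close> the derivative \<open>wirtinger_bar\<close> is half the conjugate of the complex gradient, so that the
  derivative of the latter at \<open>c\<close> determines the mixed Wirtinger derivative there.
\<close>

lemma wirtinger_wirtinger_bar:
  assumes S: "open S" "c \<in> S"
      and u: "\<And>z. z \<in> S \<Longrightarrow> (u has_derivative (\<lambda>e. Re (D z * e))) (at z)"
      and D: "(D has_derivative A) (at c)"
  shows "wirtinger (wirtinger_bar (\<lambda>w. complex_of_real (u w))) c = (cnj (A 1) - \<i> * cnj (A \<i>)) / 4"
proof -
  have bar: "wirtinger_bar (\<lambda>w. complex_of_real (u w)) z = cnj (D z) / 2" if "z \<in> S" for z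
  proof -
    have "((\<lambda>w. complex_of_real (u w)) has_derivative (\<lambda>e. of_real (Re (D z * e)))) (at z)"
      by (intro has_derivative_of_real u that)
    from frechet_derivative_at[OF this, symmetric] show ?thesis
      by (simp add: wirtinger_bar_def complex_eq_iff)
  qed
  have "((\<lambda>z. cnj (D z) / 2) has_derivative (\<lambda>e. cnj (A e) / 2)) (at c)"
    by (intro bounded_linear.has_derivative[OF bounded_linear_divide] bounded_linear.has_derivative[OF bounded_linear_cnj] D)
  then have "((wirtinger_bar (\<lambda>w. complex_of_real (u w))) has_derivative (\<lambda>e. cnj (A e) / 2)) (at c)"
    by (rule has_derivative_transform_within_open[OF _ S]) (simp add: bar)
  from frechet_derivative_at[OF this, symmetric] show ?thesis
    by (simp add: wirtinger_def field_simps)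
qed

section \<open>The minimum principle and the Dirichlet problem\<close>

text \<open>
  The domain may be unbounded. Since it omits a disc around \<open>a\<close>, the function \<open>log |z - a| - log (r/2)\<close> is
  positive and harmonic on it and tends to infinity at infinity. Adding a small multiple of it to \<open>u\<close>
  makes the sublevel sets below a negative value compact, so a negative value would lead to an interior
  minimum. By the maximum modulus principle, the set where this minimum is attained is open; it is also
  compact and nonempty, which is impossible in the plane.
\<close>

lemma harmonic_minimum_principle:
  assumes W: "open W" and r: "r > 0" and ext: "\<And>z. z \<in> W \<Longrightarrow> r \<le> cmod (z - a)"
      and u: "harmonic_on u W"
      and bd: "\<And>\<zeta> \<epsilon>. \<zeta> \<in> frontier W \<Longrightarrow> \<epsilon> > 0 \<Longrightarrow> \<forall>\<^sub>F z in at \<zeta> within W. - \<epsilon> < u z"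
      and inf: "\<And>z. z \<in> W \<Longrightarrow> R < cmod z \<Longrightarrow> B \<le> u z"
      and z: "z1 \<in> W"
  shows "0 \<le> u z1"
proof (rule ccontr)
  assume neg: "\<not> 0 \<le> u z1"
  define L where "L z = ln (cmod (z - a)) - ln (r / 2)" for z
  have Lpos: "L z > 0" if "z \<in> W" for z
  proof -
    have "r / 2 < cmod (z - a)" using ext[OF that] r by linarith
    then have "ln (r / 2) < ln (cmod (z - a))"
      using r by (subst ln_less_cancel_iff) auto
    then show ?thesis by (simp add: L_def)
  qed
  have Lharm: "harmonic_on L W"
    unfolding L_def using ext r
    by (intro harmonic_on_diff harmonic_on_const W harmonic_on_ln_cmod holomorphic_intros) force
  \<comment> \<open>Chosen such that \<open>u + \<epsilon> * L\<close> is still negative at \<open>z1\<close>.\<close>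
  define \<epsilon> where "\<epsilon> = - u z1 / (2 * L z1)"
  have \<epsilon>: "\<epsilon> > 0" using neg Lpos[OF z] by (simp add: \<epsilon>_def field_simps)
  define w where "w z = u z + \<epsilon> * L z" for z
  have wharm: "harmonic_on w W"
    unfolding w_def by (intro harmonic_on_add harmonic_on_cmult W u Lharm)
  have wcont: "continuous_on W w" by (rule harmonic_on_continuous_on[OF W wharm])
  define m0 where "m0 = w z1"
  have m0: "m0 < 0"
    using neg Lpos[OF z] by (simp add: m0_def w_def \<epsilon>_def)
  define S where "S = {z \<in> W. w z \<le> m0}"
  have "closed S"
    unfolding closed_limpt
  proof (intro allI impI, rule ccontr)
    fix \<zeta> assume lp: "\<zeta> islimpt S" and nin: "\<zeta> \<notin> S"
    have "\<forall>\<^sub>F y in at \<zeta>. y \<notin> S"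
    proof (cases "\<zeta> \<in> W")
      case True
      then have "isCont w \<zeta>" "m0 < w \<zeta>"
        using wcont W nin by (auto simp: continuous_on_eq_continuous_at S_def)
      then have "\<forall>\<^sub>F y in at \<zeta>. m0 < w y"
        using order_tendstoD(1) isContD by blast
      then show ?thesis by eventually_elim (simp add: S_def)
    next
      case False
      show ?thesis
      proof (cases "\<zeta> \<in> closure W")
        case True
        then have "\<zeta> \<in> frontier W"
          using False W by (simp add: frontier_def interior_open)
        then have "\<forall>\<^sub>F y in at \<zeta> within W. - (- m0) < u y"
          using bd m0 by (metis neg_0_less_iff_less)
        then have "\<forall>\<^sub>F y in at \<zeta>. y \<in> W \<longrightarrow> m0 < u y"
          by (auto simp: eventually_at_filter elim: eventually_mono)
        then show ?thesis
        proof eventually_elim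
          case (elim y)
          then show ?case using mult_pos_pos[OF \<epsilon> Lpos, of y] by (auto simp: S_def w_def)
        qed
      next
        case out: False
        then have "\<forall>\<^sub>F y in nhds \<zeta>. y \<in> - closure W"
          by (intro eventually_nhds_in_open) auto
        then have "\<forall>\<^sub>F y in at \<zeta>. y \<in> - closure W"
          by (simp add: eventually_at_filter eventually_mono)
        then show ?thesis
        proof eventually_elim
          case (elim y)
          then show ?case using closure_subset[of W] by (auto simp: S_def)
        qed
      qed
    qed
    with lp show False by (simp add: islimpt_iff_eventually)
  qed
  moreover have "bounded S"
  proof -
    define T where "T = (m0 - B) / \<epsilon>"
    have "cmod y \<le> max R (cmod a + (r/2) * exp T)" if y: "y \<in> S" for y
    proof (rule ccontr)
      assume "\<not> cmod y \<le> max R (cmod a + (r/2) * exp T)"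
      then have big: "R < cmod y" "cmod a + (r/2) * exp T < cmod y" by auto
      then have "(r/2) * exp T < cmod (y - a)"
        using norm_triangle_ineq2[of y a] by linarith
      moreover have pos: "0 < (r/2) * exp T" using r by simp
      ultimately have "ln ((r/2) * exp T) < ln (cmod (y - a))"
        by (subst ln_less_cancel_iff) linarith+
      moreover have "ln ((r/2) * exp T) = ln (r/2) + T"
        using r by (subst ln_mult_pos) auto
      ultimately have "T < L y"
        by (simp add: L_def)
      then have "m0 - B < \<epsilon> * L y"
        using \<epsilon> by (simp add: T_def divide_less_eq mult.commute)
      moreover have "B \<le> u y" using inf y big by (simp add: S_def)
      ultimately have "m0 < w y" by (simp add: w_def)
      with y show False by (simp add: S_def)
    qed
    then show ?thesis by (auto simp: bounded_iff)
  qed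
  ultimately have cS: "compact S" by (simp add: compact_eq_bounded_closed)
  have "z1 \<in> S" using z by (simp add: S_def m0_def)
  have wcS: "continuous_on S w" using wcont by (rule continuous_on_subset) (auto simp: S_def)
  obtain z0 where z0: "z0 \<in> S" "\<And>y. y \<in> S \<Longrightarrow> w z0 \<le> w y"
    using continuous_attains_inf[OF cS _ wcS] \<open>z1 \<in> S\<close> by blast
  have min: "w z0 \<le> w y" if "y \<in> W" for y
    using z0(2)[of y] z0(1) that by (cases "y \<in> S") (auto simp: S_def)
  define K where "K = {z \<in> S. w z = w z0}"
  have "closed K"
    unfolding K_def by (rule continuous_closed_preimage_constant[OF wcS \<open>closed S\<close>])
  moreover have "open K"
    unfolding open_contains_ball
  proof
    fix x assume x: "x \<in> K"
    then have xW: "x \<in> W" and wx: "w x = w z0" by (auto simp: K_def S_def)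
    obtain e where e: "e > 0" "ball x e \<subseteq> W"
      using open_contains_ball_eq[OF W] xW by metis
    obtain f where f: "f holomorphic_on ball x e" "\<And>y. y \<in> ball x e \<Longrightarrow> Re (f y) = w y"
      using harmonic_conjugate[OF harmonic_on_subset[OF wharm e(2)]] by metis
    have "(\<lambda>y. exp (- f y)) constant_on ball x e"
    proof (rule maximum_modulus_principle)
      show "(\<lambda>y. exp (- f y)) holomorphic_on ball x e" by (intro holomorphic_intros f)
      show "x \<in> ball x e" using e by simp
      show "cmod (exp (- f y)) \<le> cmod (exp (- f x))" if "y \<in> ball x e" for y
        using min[of y] wx that e f(2)[of y] f(2)[of x] by auto
    qed auto
    then have "cmod (exp (- f y)) = cmod (exp (- f x))" if "y \<in> ball x e" for y
      using that e(1) unfolding constant_on_def by (metis centre_in_ball)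
    then have "w y = w z0" if "y \<in> ball x e" for y
      using that wx f(2)[of y] f(2)[of x] e by simp
    then have "ball x e \<subseteq> K" using e z0(1) by (auto simp: K_def S_def)
    then show "\<exists>e>0. ball x e \<subseteq> K" using e by blast
  qed
  moreover have "z0 \<in> K" using z0 by (simp add: K_def)
  ultimately have "K = UNIV" using clopen by blast
  moreover have "bounded K" using \<open>bounded S\<close> by (rule bounded_subset) (auto simp: K_def)
  ultimately show False using not_bounded_UNIV by metis
qed

lemma has_derivative_of_quadratic_bound:
  fixes f :: "complex \<Rightarrow> 'a::real_normed_vector"
  assumes A: "bounded_linear A" and d: "d > 0"
      and b: "\<And>e. cmod e < d \<Longrightarrow> norm (f (p + e) - f p - A e) \<le> C * (cmod e)\<^sup>2"
  shows "(f has_derivative A) (at p)"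
  unfolding has_derivative_at
proof (intro conjI A)
  have "(\<lambda>h. C * cmod h) \<midarrow>0\<rightarrow> C * cmod 0" by (intro tendsto_intros)
  then have lim: "(\<lambda>h. C * cmod h) \<midarrow>0\<rightarrow> 0" by simp
  have ev: "\<forall>\<^sub>F h in at 0. h \<noteq> 0 \<and> cmod h < d"
    using d by (auto simp: eventually_at intro!: exI[of _ d])
  show "(\<lambda>h. norm (f (p + h) - f p - A h) / norm h) \<midarrow>0\<rightarrow> 0"
  proof (rule tendsto_sandwich[OF _ _ tendsto_const lim])
    show "\<forall>\<^sub>F h in at 0. norm (f (p + h) - f p - A h) / norm h \<le> C * cmod h"
      using ev
    proof eventually_elim
      case (elim h)
      then show ?case using b[of h] by (simp add: divide_le_eq power2_eq_square mult_ac)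
    qed
  qed auto
qed

lemma ln_cmod_linear_approx:
  assumes "d > 0" "d \<le> cmod w" "cmod e < d / 2"
  shows "\<bar>ln (cmod (w - e)) - ln (cmod w) + Re (e / w)\<bar> \<le> 2 / d\<^sup>2 * (cmod e)\<^sup>2"
proof -
  define x where "x = - (e / w)"
  have w: "w \<noteq> 0" using assms by auto
  have xd: "cmod x \<le> cmod e / d"
    using assms w by (auto simp: x_def norm_divide intro!: divide_left_mono mult_pos_pos)
  moreover have "cmod e / d < 1/2" using assms by (simp add: field_simps)
  ultimately have x: "cmod x < 1/2" by linarith
  then have nz: "1 + x \<noteq> 0"
    by (metis add_eq_0_iff norm_minus_cancel norm_one not_less_iff_gr_or_eq one_less_numeral_iff
        divide_less_eq_1_pos semiring_norm(76) less_trans zero_less_numeral)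
  have "w - e = w * (1 + x)" using w by (simp add: x_def field_simps)
  then have "ln (cmod (w - e)) = ln (cmod w) + ln (cmod (1 + x))"
    using w nz by (simp add: norm_mult ln_mult)
  then have "ln (cmod (w - e)) - ln (cmod w) + Re (e / w) = Re (Ln (1 + x) - x)"
    using nz by (simp add: x_def)
  then have "\<bar>ln (cmod (w - e)) - ln (cmod w) + Re (e / w)\<bar> \<le> cmod (Ln (1 + x) - x)"
    by (simp only: abs_Re_le_cmod)
  also have "\<dots> \<le> (cmod x)\<^sup>2 / (1 - cmod x)"
    using x by (intro Ln_approx_linear) simp
  also have "\<dots> \<le> (cmod x)\<^sup>2 / (1/2)"
    using x by (intro divide_left_mono) auto
  also have "\<dots> \<le> 2 * (cmod e / d)\<^sup>2"
    using power_mono[OF xd, of 2] by simp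
  finally show ?thesis by (simp add: power_divide)
qed

lemma inverse_linear_approx:
  fixes w e :: complex
  assumes "d > 0" "d \<le> cmod w" "cmod e < d / 2"
  shows "cmod (- (1 / (w - e)) + 1 / w + e / w\<^sup>2) \<le> 2 / d^3 * (cmod e)\<^sup>2"
proof -
  have w: "w \<noteq> 0" and we: "d / 2 \<le> cmod (w - e)"
    using assms norm_triangle_ineq2[of w e] by auto
  then have "w - e \<noteq> 0" using assms(1) by auto
  then have "- (1 / (w - e)) + 1 / w + e / w\<^sup>2 = - e\<^sup>2 / (w\<^sup>2 * (w - e))"
    using w by (simp add: divide_simps) (simp add: algebra_simps power2_eq_square)
  then have "cmod (- (1 / (w - e)) + 1 / w + e / w\<^sup>2) = (cmod e)\<^sup>2 / ((cmod w)\<^sup>2 * cmod (w - e))"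
    by (simp add: norm_divide norm_mult norm_power)
  also have "\<dots> \<le> (cmod e)\<^sup>2 / (d\<^sup>2 * (d / 2))"
    using assms we by (intro divide_left_mono mult_mono power_mono mult_pos_pos) auto
  also have "\<dots> = 2 / d^3 * (cmod e)\<^sup>2"
    by (simp add: power2_eq_square power3_eq_cube)
  finally show ?thesis .
qed

lemma bounded_near_infinity_iff:
  "bounded_near_infinity u S \<longleftrightarrow> (\<exists>R B. \<forall>z\<in>S. R < cmod z \<longrightarrow> \<bar>u z\<bar> \<le> B)"
proof -
  have "(\<forall>z\<in>S - cball 0 R. \<bar>u z\<bar> \<le> B) \<longleftrightarrow> (\<forall>z\<in>S. R < cmod z \<longrightarrow> \<bar>u z\<bar> \<le> B)" for R B
    by auto
  then show ?thesis
    by (simp add: bounded_near_infinity_def bounded_iff)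
qed

lemma bounded_near_infinityD:
  assumes "bounded_near_infinity u S"
  obtains R B where "\<And>z. z \<in> S \<Longrightarrow> R < cmod z \<Longrightarrow> \<bar>u z\<bar> \<le> B"
  using assms unfolding bounded_near_infinity_iff by blast

lemma bounded_near_infinity_linear_combination:
  assumes "bounded_near_infinity u S" "bounded_near_infinity v S"
  shows "bounded_near_infinity (\<lambda>z. c * u z + d * v z) S"
proof -
  obtain R B where u: "\<And>z. z \<in> S \<Longrightarrow> R < cmod z \<Longrightarrow> \<bar>u z\<bar> \<le> B"
    using bounded_near_infinityD[OF assms(1)] by metis
  obtain R' B' where v: "\<And>z. z \<in> S \<Longrightarrow> R' < cmod z \<Longrightarrow> \<bar>v z\<bar> \<le> B'"
    using bounded_near_infinityD[OF assms(2)] by metis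
  have "\<bar>c * u z + d * v z\<bar> \<le> \<bar>c\<bar> * B + \<bar>d\<bar> * B'" if "z \<in> S" "max R R' < cmod z" for z
  proof -
    have "\<bar>c * u z + d * v z\<bar> \<le> \<bar>c\<bar> * \<bar>u z\<bar> + \<bar>d\<bar> * \<bar>v z\<bar>"
      using abs_triangle_ineq[of "c * u z" "d * v z"] by (simp add: abs_mult)
    also have "\<dots> \<le> \<bar>c\<bar> * B + \<bar>d\<bar> * B'"
      using u[of z] v[of z] that by (intro add_mono mult_left_mono) auto
    finally show ?thesis .
  qed
  then show ?thesis unfolding bounded_near_infinity_iff by blast
qed

lemma ln_cmod_ratio_bound:
  assumes "d > 0" "d \<le> cmod (z - p)" "d \<le> cmod (z - a)"
  shows "\<bar>ln (cmod (z - p)) - ln (cmod (z - a))\<bar> \<le> ln (1 + cmod (p - a) / d)"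
proof -
  have *: "ln (cmod (z - p)) - ln (cmod (z - a)) \<le> ln (1 + cmod (p - a) / d)"
    if "d \<le> cmod (z - p)" "d \<le> cmod (z - a)" for p a
  proof -
    have "cmod (z - p) \<le> cmod (z - a) + cmod (p - a)"
      using norm_triangle_ineq4[of "z - a" "p - a"] by simp
    also have "\<dots> \<le> cmod (z - a) + cmod (z - a) * (cmod (p - a) / d)"
      using that \<open>d > 0\<close> mult_right_mono[OF that(2), of "cmod (p - a) / d"] by simp
    finally have "cmod (z - p) \<le> cmod (z - a) * (1 + cmod (p - a) / d)"
      by (simp add: algebra_simps)
    then have "ln (cmod (z - p)) \<le> ln (cmod (z - a) * (1 + cmod (p - a) / d))"
      using that \<open>d > 0\<close> by (intro ln_mono) auto
    also have "\<dots> = ln (cmod (z - a)) + ln (1 + cmod (p - a) / d)"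
      using that \<open>d > 0\<close> by (intro ln_mult_pos) (auto intro: add_pos_nonneg)
    finally show ?thesis by simp
  qed
  show ?thesis
    using *[OF assms(2,3)] *[OF assms(3,2)] by (simp add: abs_le_iff norm_minus_commute)
qed

text \<open>
  The disc in the complement makes the minimum principle available, and its centre \<open>a\<close> turns the unbounded
  boundary values \<open>log |\<zeta> - p|\<close> into the bounded ones \<open>log |\<zeta> - p| - log |\<zeta> - a|\<close>.
\<close>

locale regular_domain_exterior_disc =
  fixes D :: "complex set" and a :: complex and r0 :: real
  assumes regular: "regular_domain D" and r0: "r0 > 0" and ext: "D \<inter> ball a r0 = {}"
begin

lemma open_D: "open D"
  using regular by (simp add: regular_domain_def)

lemma ext_D: "z \<in> D \<Longrightarrow> r0 \<le> cmod (z - a)"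
  using ext by (auto simp: disjoint_iff dist_norm norm_minus_commute)

lemma ext_frontier: "\<zeta> \<in> frontier D \<Longrightarrow> r0 \<le> cmod (\<zeta> - a)"
proof -
  assume "\<zeta> \<in> frontier D"
  moreover have "closure D \<inter> ball a r0 = {}"
    using ext open_Int_closure_eq_empty[OF open_ball, of a r0 D] by (simp add: Int_commute)
  ultimately have "\<zeta> \<notin> ball a r0" by (auto simp: frontier_def)
  then show ?thesis by (simp add: dist_norm norm_minus_commute)
qed

lemma frontier_far:
  assumes "p \<in> D"
  obtains d where "d > 0" "d \<le> r0" "ball p d \<subseteq> D" "\<And>\<zeta>. \<zeta> \<in> frontier D \<Longrightarrow> d \<le> cmod (\<zeta> - p)"
proof -
  obtain e where e: "e > 0" "ball p e \<subseteq> D"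
    using open_contains_ball_eq[OF open_D] assms by metis
  define d where "d = min e r0"
  have "D \<inter> frontier D = {}"
    using open_D by (auto simp: frontier_def interior_open)
  then have "e \<le> cmod (\<zeta> - p)" if "\<zeta> \<in> frontier D" for \<zeta>
    using e that by (force simp: dist_norm norm_minus_commute subset_iff)
  then show ?thesis
    using e r0 by (intro that[of d]) (auto simp: d_def subset_iff min_le_iff_disj)
qed

abbreviation boundary_data :: "(complex \<Rightarrow> 'b::real_normed_vector) \<Rightarrow> bool" where
  "boundary_data f \<equiv> continuous_on (frontier D) f \<and> bounded (f ` frontier D)"

definition dirichlet_solution :: "(complex \<Rightarrow> real) \<Rightarrow> complex \<Rightarrow> real" where
  "dirichlet_solution f = (SOME u. solves_dirichlet D f u)"

lemma dirichlet_solution: "boundary_data f \<Longrightarrow> solves_dirichlet D f (dirichlet_solution f)"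
  using regular unfolding regular_domain_def dirichlet_solution_def by (metis someI_ex)

lemma dirichlet_mono:
  assumes u: "solves_dirichlet D f u" and v: "solves_dirichlet D g v"
      and le: "\<And>\<zeta>. \<zeta> \<in> frontier D \<Longrightarrow> f \<zeta> \<le> g \<zeta>" and z: "z \<in> D"
  shows "u z \<le> v z"
proof -
  have "bounded_near_infinity (\<lambda>z. 1 * v z + (-1) * u z) D"
    using u v by (intro bounded_near_infinity_linear_combination) (auto simp: solves_dirichlet_def)
  then obtain R B where "\<forall>z\<in>D. R < cmod z \<longrightarrow> \<bar>1 * v z + (-1) * u z\<bar> \<le> B"
    unfolding bounded_near_infinity_iff by blast
  then have RB: "\<bar>v z - u z\<bar> \<le> B" if "z \<in> D" "R < cmod z" for z
    using that by simp
  have "0 \<le> v z - u z"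
  proof (rule harmonic_minimum_principle[OF open_D r0 ext_D, of "\<lambda>z. v z - u z" R "-B"])
    show "harmonic_on (\<lambda>z. v z - u z) D"
      using u v by (intro harmonic_on_diff open_D) (auto simp: solves_dirichlet_def)
    show "\<forall>\<^sub>F z in at \<zeta> within D. - \<epsilon> < v z - u z" if "\<zeta> \<in> frontier D" "\<epsilon> > 0" for \<zeta> \<epsilon>
    proof -
      have "((\<lambda>z. v z - u z) \<longlongrightarrow> g \<zeta> - f \<zeta>) (at \<zeta> within D)"
        using u v that(1) by (intro tendsto_diff) (auto simp: solves_dirichlet_def)
      moreover have "- \<epsilon> < g \<zeta> - f \<zeta>" using le[OF that(1)] that(2) by simp
      ultimately show ?thesis by (rule order_tendstoD(1))
    qed
    show "- B \<le> v z - u z" if "z \<in> D" "R < cmod z" for z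
      using RB[OF that] by linarith
  qed (use z in auto)
  then show ?thesis by simp
qed

lemma dirichlet_unique:
  assumes "solves_dirichlet D f u" "solves_dirichlet D f v" "z \<in> D"
  shows "u z = v z"
  using dirichlet_mono[OF assms(1,2)] dirichlet_mono[OF assms(2,1)] assms(3) by (simp add: antisym)

lemma solves_dirichlet_linear_combination:
  assumes "solves_dirichlet D f u" "solves_dirichlet D g v"
  shows "solves_dirichlet D (\<lambda>\<zeta>. c * f \<zeta> + d * g \<zeta>) (\<lambda>z. c * u z + d * v z)"
  using assms unfolding solves_dirichlet_def
  by (auto intro!: harmonic_on_linear_combination(1) open_D tendsto_intros
      bounded_near_infinity_linear_combination)

lemma boundary_data_linear_combination:
  fixes f g :: "complex \<Rightarrow> 'b::real_normed_algebra"
  assumes "boundary_data f" "boundary_data g"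
  shows "boundary_data (\<lambda>\<zeta>. c * f \<zeta> + d * g \<zeta>)"
proof
  show "continuous_on (frontier D) (\<lambda>\<zeta>. c * f \<zeta> + d * g \<zeta>)"
    using assms by (intro continuous_intros) auto
  obtain B where B: "\<And>\<zeta>. \<zeta> \<in> frontier D \<Longrightarrow> norm (f \<zeta>) \<le> B"
    using assms(1) by (auto simp: bounded_iff)
  obtain B' where B': "\<And>\<zeta>. \<zeta> \<in> frontier D \<Longrightarrow> norm (g \<zeta>) \<le> B'"
    using assms(2) by (auto simp: bounded_iff)
  have "norm (c * f \<zeta> + d * g \<zeta>) \<le> norm c * B + norm d * B'" if "\<zeta> \<in> frontier D" for \<zeta>
    using B[OF that] B'[OF that]
    by (intro order_trans[OF norm_triangle_ineq] add_mono order_trans[OF norm_mult_ineq] mult_left_mono) auto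
  then show "bounded ((\<lambda>\<zeta>. c * f \<zeta> + d * g \<zeta>) ` frontier D)"
    by (auto simp: bounded_iff)
qed

lemma dirichlet_solution_linear:
  assumes "boundary_data f" "boundary_data g" "z \<in> D"
  shows "dirichlet_solution (\<lambda>\<zeta>. c * f \<zeta> + d * g \<zeta>) z = c * dirichlet_solution f z + d * dirichlet_solution g z"
  using dirichlet_unique[OF dirichlet_solution[OF boundary_data_linear_combination[OF assms(1,2)]]
      solves_dirichlet_linear_combination[OF dirichlet_solution[OF assms(1)] dirichlet_solution[OF assms(2)]] assms(3)] .

lemma solves_dirichlet_const: "solves_dirichlet D (\<lambda>_. c) (\<lambda>_. c)"
  unfolding solves_dirichlet_def bounded_near_infinity_iff
  by (auto intro!: harmonic_on_const open_D)

lemma dirichlet_solution_bound: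
  assumes "boundary_data f" "\<And>\<zeta>. \<zeta> \<in> frontier D \<Longrightarrow> \<bar>f \<zeta>\<bar> \<le> B" "z \<in> D"
  shows "\<bar>dirichlet_solution f z\<bar> \<le> B"
proof -
  have "dirichlet_solution f z \<le> B"
    by (rule dirichlet_mono[OF dirichlet_solution[OF assms(1)] solves_dirichlet_const _ assms(3)])
      (use assms(2) in \<open>fastforce simp: abs_le_iff\<close>)
  moreover have "- B \<le> dirichlet_solution f z"
    by (rule dirichlet_mono[OF solves_dirichlet_const dirichlet_solution[OF assms(1)] _ assms(3)])
      (use assms(2) in \<open>fastforce simp: abs_le_iff\<close>)
  ultimately show ?thesis by linarith
qed

definition log_data :: "complex \<Rightarrow> complex \<Rightarrow> real" where
  "log_data p \<zeta> = ln (cmod (\<zeta> - p)) - ln (cmod (\<zeta> - a))"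

lemma log_data: assumes "p \<in> D" shows "boundary_data (log_data p)"
proof -
  obtain d where d: "d > 0" "d \<le> r0" "ball p d \<subseteq> D" "\<And>\<zeta>. \<zeta> \<in> frontier D \<Longrightarrow> d \<le> cmod (\<zeta> - p)"
    using frontier_far[OF assms] by metis
  have nz: "cmod (\<zeta> - p) \<noteq> 0" "cmod (\<zeta> - a) \<noteq> 0" if "\<zeta> \<in> frontier D" for \<zeta>
    using d(1) d(4)[OF that] ext_frontier[OF that] r0 by auto
  then have "continuous_on (frontier D) (log_data p)"
    unfolding log_data_def by (intro continuous_intros) auto
  moreover have "\<bar>log_data p \<zeta>\<bar> \<le> ln (1 + cmod (p - a) / d)" if "\<zeta> \<in> frontier D" for \<zeta>
    unfolding log_data_def
    using d that ext_frontier[OF that] by (intro ln_cmod_ratio_bound) auto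
  ultimately show ?thesis by (auto simp: bounded_iff)
qed

text \<open>
  The function \<open>G(z, p) + log |z - p|\<close>, including its value at \<open>z = p\<close>.
\<close>

definition robin_kernel :: "complex \<Rightarrow> complex \<Rightarrow> real" where
  "robin_kernel z p = dirichlet_solution (log_data p) z + ln (cmod (z - a))"

lemma robin_kernel_harmonic_fst:
  assumes "p \<in> D"
  shows "harmonic_on (\<lambda>z. robin_kernel z p) D"
proof -
  have "z - a \<noteq> 0" if "z \<in> D" for z using ext_D[OF that] r0 by auto
  then have "harmonic_on (\<lambda>z. ln (cmod (z - a))) D"
    by (intro harmonic_on_ln_cmod open_D holomorphic_intros) auto
  then show ?thesis
    unfolding robin_kernel_def using dirichlet_solution[OF log_data[OF assms]]
    by (intro harmonic_on_add open_D) (auto simp: solves_dirichlet_def)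
qed

lemma robin_kernel_boundary:
  assumes "p \<in> D" "\<zeta> \<in> frontier D"
  shows "((\<lambda>z. robin_kernel z p) \<longlongrightarrow> ln (cmod (\<zeta> - p))) (at \<zeta> within D)"
proof -
  have "((\<lambda>z. robin_kernel z p) \<longlongrightarrow> log_data p \<zeta> + ln (cmod (\<zeta> - a))) (at \<zeta> within D)"
    unfolding robin_kernel_def
    using dirichlet_solution[OF log_data[OF assms(1)]] assms(2) ext_frontier[OF assms(2)] r0
    by (intro tendsto_intros) (auto simp: solves_dirichlet_def)
  then show ?thesis by (simp add: log_data_def)
qed

lemma robin_kernel_near_infinity:
  assumes "p \<in> D"
  shows "bounded_near_infinity (\<lambda>z. robin_kernel z p - ln (cmod (z - q))) D"
proof -
  obtain R B where RB: "\<And>z. z \<in> D \<Longrightarrow> R < cmod z \<Longrightarrow> \<bar>dirichlet_solution (log_data p) z\<bar> \<le> B"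
    using dirichlet_solution[OF log_data[OF assms]] bounded_near_infinityD unfolding solves_dirichlet_def by metis
  \<comment> \<open>Far out, \<open>z\<close> is at distance at least 1 from \<open>q\<close> and, as everywhere in \<open>D\<close>, at least \<open>r0\<close> from \<open>a\<close>.\<close>
  define d where "d = min 1 r0"
  have "\<bar>robin_kernel z p - ln (cmod (z - q))\<bar> \<le> B + ln (1 + cmod (q - a) / d)"
    if z: "z \<in> D" "max R (cmod q + 1) < cmod z" for z
  proof -
    have "1 \<le> cmod (z - q)" using z norm_triangle_ineq2[of z q] by simp
    then have "\<bar>ln (cmod (z - q)) - ln (cmod (z - a))\<bar> \<le> ln (1 + cmod (q - a) / d)"
      using ext_D[OF z(1)] r0 by (intro ln_cmod_ratio_bound) (auto simp: d_def)
    then show ?thesis using RB[OF z(1)] z(2) by (simp add: robin_kernel_def)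
  qed
  then show ?thesis unfolding bounded_near_infinity_iff by blast
qed

lemma green_function_robin_kernel:
  assumes p: "p \<in> D"
  shows "is_green_function D p (\<lambda>z. robin_kernel z p - ln (cmod (z - p)))"
  unfolding is_green_function_def
proof (intro conjI ballI)
  have "harmonic_on (\<lambda>z. ln (cmod (z - p))) (D - {p})"
    by (intro harmonic_on_ln_cmod holomorphic_intros) (auto intro: open_D)
  then show "harmonic_on (\<lambda>z. robin_kernel z p - ln (cmod (z - p))) (D - {p})"
    using robin_kernel_harmonic_fst[OF p] open_D
    by (intro harmonic_on_diff) (auto intro: harmonic_on_subset)
  show "((\<lambda>z. robin_kernel z p - ln (cmod (z - p))) \<longlongrightarrow> 0) (at \<zeta> within D)" if "\<zeta> \<in> frontier D" for \<zeta>
  proof -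
    have "\<zeta> \<noteq> p" using that p open_D by (auto simp: frontier_def interior_open)
    then have "((\<lambda>z. robin_kernel z p - ln (cmod (z - p))) \<longlongrightarrow> ln (cmod (\<zeta> - p)) - ln (cmod (\<zeta> - p))) (at \<zeta> within D)"
      by (intro tendsto_intros robin_kernel_boundary p that) auto
    then show ?thesis by simp
  qed
  show "bounded_near_infinity (\<lambda>z. robin_kernel z p - ln (cmod (z - p))) D"
    by (rule robin_kernel_near_infinity[OF p])
  obtain e where e: "e > 0" "ball p e \<subseteq> D"
    using open_contains_ball_eq[OF open_D] p by metis
  show "\<exists>e>0. \<exists>h. harmonic_on h (ball p e) \<and>
      (\<forall>z\<in>ball p e - {p}. robin_kernel z p - ln (cmod (z - p)) + ln (cmod (z - p)) = h z)"
    using harmonic_on_subset[OF robin_kernel_harmonic_fst[OF p] e(2)]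
    by (intro exI[of _ e] exI[of _ "\<lambda>z. robin_kernel z p"] conjI e(1)) auto
qed

text \<open>
  The difference of two Green's functions with the same pole extends harmonically over the pole and solves
  the Dirichlet problem with boundary values 0.
\<close>

lemma green_function_unique:
  assumes p: "p \<in> D" and g: "is_green_function D p g" and z: "z \<in> D" "z \<noteq> p"
  shows "g z = robin_kernel z p - ln (cmod (z - p))"
proof -
  define k where "k z = robin_kernel z p - ln (cmod (z - p))" for z
  have k: "is_green_function D p k"
    unfolding k_def by (rule green_function_robin_kernel[OF p])
  obtain e h where e: "e > 0" and h: "harmonic_on h (ball p e)"
    "\<And>z. z \<in> ball p e - {p} \<Longrightarrow> g z + ln (cmod (z - p)) = h z"
    using g unfolding is_green_function_def by metis
  obtain e' where e': "e' > 0" "ball p e' \<subseteq> D"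
    using open_contains_ball_eq[OF open_D] p by metis
  define v where "v z = (if z = p then h p - robin_kernel p p else g z - k z)" for z
  have "harmonic_on v D"
  proof (rule harmonic_on_local[OF open_D])
    fix x assume x: "x \<in> D"
    show "\<exists>d>0. harmonic_on v (ball x d)"
    proof (cases "x = p")
      case True
      define d where "d = min e e'"
      have "harmonic_on (\<lambda>z. h z - robin_kernel z p) (ball p d)"
        using e' by (intro harmonic_on_diff open_ball harmonic_on_subset[OF h(1)]
            harmonic_on_subset[OF robin_kernel_harmonic_fst[OF p]]) (auto simp: d_def subset_iff)
      then have "harmonic_on v (ball p d)"
        by (rule harmonic_on_transform[OF open_ball]) (use h(2) in \<open>force simp: d_def v_def k_def\<close>)
      moreover have "d > 0" using e e' by (simp add: d_def)
      ultimately show ?thesis using True by blast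
    next
      case False
      have "open (D - {p})" using open_D by auto
      then obtain d where d: "d > 0" "ball x d \<subseteq> D - {p}"
        using open_contains_ball_eq x False by (metis Diff_iff singletonD)
      have "harmonic_on (\<lambda>z. g z - k z) (ball x d)"
        using g k by (intro harmonic_on_diff open_ball harmonic_on_subset[OF _ d(2)])
          (auto simp: is_green_function_def)
      then have "harmonic_on v (ball x d)"
        by (rule harmonic_on_transform[OF open_ball]) (use d(2) in \<open>auto simp: v_def\<close>)
      then show ?thesis using d by blast
    qed
  qed
  moreover have "(v \<longlongrightarrow> 0) (at \<zeta> within D)" if "\<zeta> \<in> frontier D" for \<zeta>
  proof -
    have "\<zeta> \<noteq> p" using that p open_D by (auto simp: frontier_def interior_open)
    then have "\<forall>\<^sub>F z in nhds \<zeta>. z \<in> - {p}"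
      by (intro eventually_nhds_in_open) auto
    then have "\<forall>\<^sub>F z in at \<zeta> within D. z \<noteq> p"
      by (auto simp: eventually_at_filter elim: eventually_mono)
    then have ev: "\<forall>\<^sub>F z in at \<zeta> within D. g z - k z = v z"
      by eventually_elim (simp add: v_def)
    have "((\<lambda>z. g z - k z) \<longlongrightarrow> 0 - 0) (at \<zeta> within D)"
      using g k that by (intro tendsto_diff) (auto simp: is_green_function_def)
    from Lim_transform_eventually[OF this ev] show ?thesis by simp
  qed
  moreover have "bounded_near_infinity v D"
  proof -
    have "bounded_near_infinity (\<lambda>z. 1 * g z + (-1) * k z) D"
      using g k by (intro bounded_near_infinity_linear_combination) (auto simp: is_green_function_def)
    then obtain R B where RB: "\<forall>z\<in>D. R < cmod z \<longrightarrow> \<bar>1 * g z + (-1) * k z\<bar> \<le> B"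
      unfolding bounded_near_infinity_iff by blast
    have "\<bar>v z\<bar> \<le> B" if "z \<in> D" "max R (cmod p) < cmod z" for z
      using bspec[OF RB, of z] that by (auto simp: v_def)
    then show ?thesis unfolding bounded_near_infinity_iff by blast
  qed
  ultimately have "solves_dirichlet D (\<lambda>_. 0) v"
    by (simp add: solves_dirichlet_def)
  from dirichlet_unique[OF this solves_dirichlet_const z(1)] z(2) show ?thesis
    by (simp add: v_def k_def)
qed

lemma robin_function_eq:
  assumes p: "p \<in> D"
  shows "robin_function D p = robin_kernel p p"
proof -
  have G: "is_green_function D p (green_function D p)"
    unfolding green_function_def by (rule someI[of "is_green_function D p", OF green_function_robin_kernel[OF p]])
  have "isCont (\<lambda>z. robin_kernel z p) p"
    using harmonic_on_continuous_on[OF open_D robin_kernel_harmonic_fst[OF p]] open_D p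
    by (simp add: continuous_on_eq_continuous_at)
  then have lim: "((\<lambda>z. robin_kernel z p) \<longlongrightarrow> robin_kernel p p) (at p)" by (simp add: isCont_def)
  have "\<forall>\<^sub>F z in at p. z \<in> D \<and> z \<noteq> p"
    using eventually_at_in_open[OF open_D p] by (auto elim: eventually_mono)
  then have "\<forall>\<^sub>F z in at p. robin_kernel z p = green_function D p z + ln (cmod (z - p))"
    by eventually_elim (use green_function_unique[OF p G] in auto)
  from Lim_transform_eventually[OF lim this]
  show ?thesis unfolding robin_function_def by (intro tendsto_Lim) auto
qed

text \<open>
  Complex boundary values allow the boundary data of the derivatives in the pole, such as
  \<open>1 / (\<zeta> - p)\<close>, to be solved for directly.
\<close>

definition dirichlet_solution_complex :: "(complex \<Rightarrow> complex) \<Rightarrow> complex \<Rightarrow> complex" where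
  "dirichlet_solution_complex f z = Complex (dirichlet_solution (\<lambda>\<zeta>. Re (f \<zeta>)) z) (dirichlet_solution (\<lambda>\<zeta>. Im (f \<zeta>)) z)"

lemma boundary_data_Re_Im:
  assumes "boundary_data f"
  shows "boundary_data (\<lambda>\<zeta>. Re (f \<zeta>))" "boundary_data (\<lambda>\<zeta>. Im (f \<zeta>))"
proof -
  obtain B where B: "\<And>\<zeta>. \<zeta> \<in> frontier D \<Longrightarrow> cmod (f \<zeta>) \<le> B"
    using assms by (auto simp: bounded_iff)
  show "boundary_data (\<lambda>\<zeta>. Re (f \<zeta>))" "boundary_data (\<lambda>\<zeta>. Im (f \<zeta>))"
    using assms B abs_Re_le_cmod abs_Im_le_cmod order_trans
    by (auto intro!: continuous_intros simp: bounded_iff) blast+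
qed

lemma dirichlet_solution_Re_mult:
  assumes f: "boundary_data f" and z: "z \<in> D"
  shows "dirichlet_solution (\<lambda>\<zeta>. Re (f \<zeta> * c)) z = Re (dirichlet_solution_complex f z * c)"
proof -
  have "(\<lambda>\<zeta>. Re (f \<zeta> * c)) = (\<lambda>\<zeta>. Re c * Re (f \<zeta>) + (- Im c) * Im (f \<zeta>))"
    by (simp add: fun_eq_iff algebra_simps)
  then have "dirichlet_solution (\<lambda>\<zeta>. Re (f \<zeta> * c)) z = Re c * dirichlet_solution (\<lambda>\<zeta>. Re (f \<zeta>)) z + (- Im c) * dirichlet_solution (\<lambda>\<zeta>. Im (f \<zeta>)) z"
    using dirichlet_solution_linear[OF boundary_data_Re_Im[OF f] z] by (simp only:)
  then show ?thesis by (simp add: dirichlet_solution_complex_def)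
qed

lemma dirichlet_solution_complex_linear:
  assumes f: "boundary_data f" and g: "boundary_data g" and z: "z \<in> D"
  shows "dirichlet_solution_complex (\<lambda>\<zeta>. f \<zeta> + c * g \<zeta>) z = dirichlet_solution_complex f z + c * dirichlet_solution_complex g z"
proof -
  have cg: "boundary_data (\<lambda>\<zeta>. g \<zeta> * c)"
    using boundary_data_linear_combination[OF g g, of c 0] by (simp add: mult.commute)
  have "(\<lambda>\<zeta>. Re (f \<zeta> + c * g \<zeta>)) = (\<lambda>\<zeta>. 1 * Re (f \<zeta>) + 1 * Re (g \<zeta> * c))"
    by (simp add: fun_eq_iff algebra_simps)
  then have 1: "dirichlet_solution (\<lambda>\<zeta>. Re (f \<zeta> + c * g \<zeta>)) z = dirichlet_solution (\<lambda>\<zeta>. Re (f \<zeta>)) z + Re (dirichlet_solution_complex g z * c)"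
    using dirichlet_solution_linear[OF boundary_data_Re_Im(1)[OF f] boundary_data_Re_Im(1)[OF cg] z, of 1 1]
      dirichlet_solution_Re_mult[OF g z, of c] by (simp only: mult_1)
  have "(\<lambda>\<zeta>. Im (f \<zeta> + c * g \<zeta>)) = (\<lambda>\<zeta>. 1 * Im (f \<zeta>) + 1 * Re (g \<zeta> * (- \<i> * c)))"
    by (simp add: fun_eq_iff algebra_simps)
  moreover have cg': "boundary_data (\<lambda>\<zeta>. g \<zeta> * (- \<i> * c))"
    using boundary_data_linear_combination[OF g g, of "- \<i> * c" 0] by (simp add: mult.commute)
  ultimately have 2: "dirichlet_solution (\<lambda>\<zeta>. Im (f \<zeta> + c * g \<zeta>)) z = dirichlet_solution (\<lambda>\<zeta>. Im (f \<zeta>)) z + Re (dirichlet_solution_complex g z * (- \<i> * c))"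
    using dirichlet_solution_linear[OF boundary_data_Re_Im(2)[OF f] boundary_data_Re_Im(1)[OF cg'] z, of 1 1]
      dirichlet_solution_Re_mult[OF g z, of "- \<i> * c"] by (simp only: mult_1)
  show ?thesis
    using 1 2 by (simp add: dirichlet_solution_complex_def[of "\<lambda>\<zeta>. f \<zeta> + c * g \<zeta>"] dirichlet_solution_complex_def[of f] complex_eq_iff algebra_simps)
qed

lemma dirichlet_solution_complex_bound:
  assumes f: "boundary_data f" and B: "\<And>\<zeta>. \<zeta> \<in> frontier D \<Longrightarrow> cmod (f \<zeta>) \<le> B" and z: "z \<in> D"
  shows "cmod (dirichlet_solution_complex f z) \<le> 2 * B"
proof -
  have "\<bar>dirichlet_solution (\<lambda>\<zeta>. Re (f \<zeta>)) z\<bar> \<le> B" "\<bar>dirichlet_solution (\<lambda>\<zeta>. Im (f \<zeta>)) z\<bar> \<le> B"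
    using B order_trans[OF abs_Re_le_cmod] order_trans[OF abs_Im_le_cmod]
    by (auto intro!: dirichlet_solution_bound boundary_data_Re_Im f z)
  then show ?thesis
    using cmod_le[of "dirichlet_solution_complex f z"] by (simp add: dirichlet_solution_complex_def)
qed

text \<open>
  For fixed \<open>z\<close> the value at \<open>z\<close> of the Dirichlet solution is a linear functional of the boundary values that is
  bounded in the supremum norm. The data \<open>log |\<zeta> - p|\<close> have the first order expansion
  \<open>- Re (e / (\<zeta> - p))\<close> in \<open>p\<close>, uniformly in \<open>\<zeta>\<close>, and \<open>- 1 / (\<zeta> - p)\<close> in turn is complex differentiable in \<open>p\<close>, again uniformly.
  Applying the functional gives the complex gradient in \<open>p\<close> and shows that it is holomorphic.
\<close>

lemma robin_kernel_harmonic_snd: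
  assumes z: "z \<in> D"
  shows "harmonic_on (robin_kernel z) D"
proof -
  define b where "b p \<zeta> = - (1 / (\<zeta> - p))" for p \<zeta> :: complex
  define b' where "b' p \<zeta> = - (1 / (\<zeta> - p)\<^sup>2)" for p \<zeta> :: complex
  have data: "boundary_data (b p)" "boundary_data (b' p)" if p: "p \<in> D" for p
  proof -
    obtain d where d: "d > 0" "\<And>\<zeta>. \<zeta> \<in> frontier D \<Longrightarrow> d \<le> cmod (\<zeta> - p)"
      using frontier_far[OF p] by metis
    have nz: "\<zeta> - p \<noteq> 0" if "\<zeta> \<in> frontier D" for \<zeta> using d(1) d(2)[OF that] by auto
    have "continuous_on (frontier D) (b p)" "continuous_on (frontier D) (b' p)"
      unfolding b_def b'_def using nz by (auto intro!: continuous_intros)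
    moreover have "cmod (b p \<zeta>) \<le> 1 / d" if "\<zeta> \<in> frontier D" for \<zeta>
      using d(1) d(2)[OF that] by (simp add: b_def norm_divide frac_le)
    moreover have "cmod (b' p \<zeta>) \<le> 1 / d\<^sup>2" if "\<zeta> \<in> frontier D" for \<zeta>
      using d(1) d(2)[OF that] by (simp add: b'_def norm_divide norm_power frac_le power_mono)
    ultimately show "boundary_data (b p)" "boundary_data (b' p)"
      by (auto simp: bounded_iff)
  qed
  define Q where "Q p = dirichlet_solution_complex (b p) z" for p
  show ?thesis
  proof (rule harmonic_onI[OF open_D, of Q])
    show "(robin_kernel z has_derivative (\<lambda>e. Re (Q p * e))) (at p)" if p: "p \<in> D" for p
    proof -
      obtain d where d: "d > 0" "ball p d \<subseteq> D" "\<And>\<zeta>. \<zeta> \<in> frontier D \<Longrightarrow> d \<le> cmod (\<zeta> - p)"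
        using frontier_far[OF p] by metis
      show ?thesis
      proof (rule has_derivative_of_quadratic_bound[of _ "d/2" _ _ "2 / d\<^sup>2"])
        show "bounded_linear (\<lambda>e. Re (Q p * e))"
          by (rule bounded_linear_compose[OF bounded_linear_Re bounded_linear_mult_right])
        fix e :: complex assume e: "cmod e < d / 2"
        then have pe: "p + e \<in> D" using d by (auto simp: subset_iff dist_norm)
        have be: "boundary_data (\<lambda>\<zeta>. Re (b p \<zeta> * e))"
          using boundary_data_Re_Im(1)[OF boundary_data_linear_combination[OF data(1)[OF p] data(1)[OF p], of e 0]]
          by (simp add: mult.commute)
        define F where "F \<zeta> = 1 * log_data (p + e) \<zeta> + (-1) * log_data p \<zeta>" for \<zeta>
        have F: "boundary_data F"
          unfolding F_def by (intro boundary_data_linear_combination log_data p pe)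
        have "dirichlet_solution (\<lambda>\<zeta>. 1 * F \<zeta> + (-1) * Re (b p \<zeta> * e)) z
            = robin_kernel z (p + e) - robin_kernel z p - Re (Q p * e)"
          using dirichlet_solution_linear[OF F be z, of 1 "-1"]
            dirichlet_solution_linear[OF log_data[OF pe] log_data[OF p] z, of 1 "-1", folded F_def]
            dirichlet_solution_Re_mult[OF data(1)[OF p] z, of e]
          by (simp add: robin_kernel_def Q_def)
        moreover have "\<bar>dirichlet_solution (\<lambda>\<zeta>. 1 * F \<zeta> + (-1) * Re (b p \<zeta> * e)) z\<bar> \<le> 2 / d\<^sup>2 * (cmod e)\<^sup>2"
        proof (rule dirichlet_solution_bound[OF boundary_data_linear_combination[OF F be] _ z])
          fix \<zeta> assume \<zeta>: "\<zeta> \<in> frontier D"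
          have "1 * F \<zeta> + (-1) * Re (b p \<zeta> * e)
              = ln (cmod (\<zeta> - p - e)) - ln (cmod (\<zeta> - p)) + Re (e / (\<zeta> - p))"
            by (simp add: F_def b_def log_data_def diff_diff_eq)
          then show "\<bar>1 * F \<zeta> + (-1) * Re (b p \<zeta> * e)\<bar> \<le> 2 / d\<^sup>2 * (cmod e)\<^sup>2"
            using ln_cmod_linear_approx[OF d(1) d(3)[OF \<zeta>] e] by (simp only:)
        qed
        ultimately show "norm (robin_kernel z (p + e) - robin_kernel z p - Re (Q p * e)) \<le> 2 / d\<^sup>2 * (cmod e)\<^sup>2"
          by simp
      qed (use d in auto)
    qed
    have "(Q has_field_derivative dirichlet_solution_complex (b' p) z) (at p)" if p: "p \<in> D" for p
    proof -
      obtain d where d: "d > 0" "ball p d \<subseteq> D" "\<And>\<zeta>. \<zeta> \<in> frontier D \<Longrightarrow> d \<le> cmod (\<zeta> - p)"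
        using frontier_far[OF p] by metis
      show ?thesis
        unfolding has_field_derivative_def
      proof (rule has_derivative_of_quadratic_bound[of _ "d/2" _ _ "4 / d^3"])
        fix e :: complex assume e: "cmod e < d / 2"
        then have pe: "p + e \<in> D" using d by (auto simp: subset_iff dist_norm)
        define F where "F \<zeta> = b (p + e) \<zeta> + (-1) * b p \<zeta>" for \<zeta>
        have F: "boundary_data F"
          using boundary_data_linear_combination[OF data(1)[OF pe] data(1)[OF p], of 1 "-1"]
          by (simp add: F_def[abs_def])
        have F': "boundary_data (\<lambda>\<zeta>. F \<zeta> + (- e) * b' p \<zeta>)"
          using boundary_data_linear_combination[OF F data(2)[OF p], of 1 "- e"] by simp
        have "dirichlet_solution_complex (\<lambda>\<zeta>. F \<zeta> + (- e) * b' p \<zeta>) z = Q (p + e) - Q p - dirichlet_solution_complex (b' p) z * e"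
          using dirichlet_solution_complex_linear[OF F data(2)[OF p] z, of "- e"]
            dirichlet_solution_complex_linear[OF data(1)[OF pe] data(1)[OF p] z, of "-1", folded F_def]
          by (simp add: Q_def)
        moreover have "cmod (dirichlet_solution_complex (\<lambda>\<zeta>. F \<zeta> + (- e) * b' p \<zeta>) z) \<le> 2 * (2 / d^3 * (cmod e)\<^sup>2)"
        proof (rule dirichlet_solution_complex_bound[OF F' _ z])
          fix \<zeta> assume \<zeta>: "\<zeta> \<in> frontier D"
          have "F \<zeta> + (- e) * b' p \<zeta> = - (1 / (\<zeta> - p - e)) + 1 / (\<zeta> - p) + e / (\<zeta> - p)\<^sup>2"
            by (simp add: F_def b_def b'_def diff_diff_eq)
          then show "cmod (F \<zeta> + (- e) * b' p \<zeta>) \<le> 2 / d^3 * (cmod e)\<^sup>2"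
            using inverse_linear_approx[OF d(1) d(3)[OF \<zeta>] e] by (simp only:)
        qed
        ultimately show "norm (Q (p + e) - Q p - dirichlet_solution_complex (b' p) z * e) \<le> 4 / d^3 * (cmod e)\<^sup>2"
          by simp
      qed (use d in \<open>auto intro: bounded_linear_mult_right\<close>)
    qed
    then show "Q holomorphic_on D"
      unfolding holomorphic_on_open[OF open_D] by blast
  qed
qed

end

section \<open>Tangent discs at a boundary of class C2\<close>

lemma C2_quadratic_taylor:
  assumes C2: "C2_derivs_on u u' u'' S" and sub: "ball c R \<subseteq> S"
      and M: "\<And>z. z \<in> ball c R \<Longrightarrow> norm (u'' z) \<le> M"
      and q: "q \<in> ball c R" and z: "z \<in> ball c R"
  shows "\<bar>u z - u q - u' q (z - q)\<bar> \<le> M * (cmod (z - q))\<^sup>2"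
proof -
  have du: "(u has_derivative blinfun_apply (u' x)) (at x within T)" if "x \<in> ball c R" for x T
    by (rule has_derivative_at_withinI) (use C2 sub that in \<open>auto simp: C2_derivs_on_def\<close>)
  have du': "(u' has_derivative blinfun_apply (u'' x)) (at x within T)" if "x \<in> ball c R" for x T
    by (rule has_derivative_at_withinI) (use C2 sub that in \<open>auto simp: C2_derivs_on_def\<close>)
  have lip: "norm (u' x - u' q) \<le> M * cmod (x - q)" if "x \<in> ball c R" for x
    by (rule differentiable_bound[OF convex_ball du', of c R M])
       (use M that q in \<open>auto simp: norm_blinfun.rep_eq[symmetric]\<close>)
  have seg: "closed_segment q z \<subseteq> ball c R"
    using q z by (simp add: closed_segment_subset)
  have "norm ((u z - u' q z) - (u q - u' q q)) \<le> (M * cmod (z - q)) * cmod (z - q)"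
  proof (rule differentiable_bound[OF convex_closed_segment[of q z], of "\<lambda>x. u x - u' q x" "\<lambda>x e. u' x e - u' q e"])
    fix x assume x: "x \<in> closed_segment q z"
    then have xb: "x \<in> ball c R" using seg by blast
    show "((\<lambda>x. u x - u' q x) has_derivative (\<lambda>e. u' x e - u' q e)) (at x within closed_segment q z)"
      by (intro has_derivative_diff du xb bounded_linear_imp_has_derivative blinfun.bounded_linear_right)
    show "onorm (\<lambda>e. u' x e - u' q e) \<le> M * cmod (z - q)"
    proof -
      have "M \<ge> 0" using M[OF q] norm_ge_zero order_trans by blast
      have "onorm (\<lambda>e. u' x e - u' q e) = norm (u' x - u' q)"
        by (simp add: norm_blinfun.rep_eq minus_blinfun.rep_eq)
      also have "\<dots> \<le> M * cmod (x - q)" by (rule lip[OF xb])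
      also have "\<dots> \<le> M * cmod (z - q)"
        using segment_bound(1)[OF x] \<open>M \<ge> 0\<close> by (intro mult_left_mono) (auto simp: norm_minus_commute)
      finally show ?thesis .
    qed
  qed auto
  then show ?thesis
    by (simp add: blinfun.diff_right power2_eq_square algebra_simps)
qed

lemma cmod_diff_scaleR_square:
  fixes x y :: complex
  shows "(cmod (x - t *\<^sub>R y))\<^sup>2 = (cmod x)\<^sup>2 - 2 * t * (x \<bullet> y) + t\<^sup>2 * (cmod y)\<^sup>2"
  unfolding cmod_power2 inner_complex_def by (simp add: power2_eq_square algebra_simps)

lemma isCont_eventually_nhds:
  fixes f :: "complex \<Rightarrow> real"
  assumes "isCont f x"
  shows "a < f x \<Longrightarrow> \<forall>\<^sub>F z in nhds x. a < f z" "f x < a \<Longrightarrow> \<forall>\<^sub>F z in nhds x. f z < a"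
proof -
  have "(f \<longlongrightarrow> f x) (nhds x)"
    using assms by (simp add: isCont_def tendsto_at_iff_tendsto_nhds)
  then show "a < f x \<Longrightarrow> \<forall>\<^sub>F z in nhds x. a < f z" "f x < a \<Longrightarrow> \<forall>\<^sub>F z in nhds x. f z < a"
    by (auto dest: order_tendstoD)
qed

text \<open>
  In a disc of radius \<open>r\<close> that touches the line orthogonal to \<open>\<nu>\<close> at 0, the normal coordinate dominates the quadratic
  error of a Taylor expansion as soon as \<open>r\<close> is small.
\<close>

lemma half_plane_coordinate_disc:
  fixes w \<nu> :: complex
  assumes "cmod \<nu> = 1" "r > 0" "cmod (w - of_real r * \<nu>) < r"
  shows "(cmod w)\<^sup>2 / (2 * r) < w \<bullet> \<nu>" "cmod w < 2 * r"
proof -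
  have "(cmod (w - of_real r * \<nu>))\<^sup>2 < r\<^sup>2"
    using assms by (intro power_strict_mono) auto
  moreover have "(cmod (w - of_real r * \<nu>))\<^sup>2 = (cmod w)\<^sup>2 - 2 * r * (w \<bullet> \<nu>) + r\<^sup>2"
    using cmod_diff_scaleR_square[of w r \<nu>] assms by (simp add: scaleR_conv_of_real)
  ultimately show "(cmod w)\<^sup>2 / (2 * r) < w \<bullet> \<nu>"
    using assms(2) by (simp add: field_simps)
  have "cmod w \<le> cmod (w - of_real r * \<nu>) + cmod (of_real r * \<nu>)"
    using norm_triangle_ineq[of "w - of_real r * \<nu>" "of_real r * \<nu>"] by simp
  then show "cmod w < 2 * r" using assms by (simp add: norm_mult)
qed

text \<open>
  Near \<open>p0\<close> the gradient of \<open>\<psi>\<close> has length at least \<open>m\<close> and the second derivative has norm at most \<open>M\<close>. In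
  the discs of radius \<open>r \<le> m / (2 M)\<close> that touch the boundary at \<open>q\<close>, the linear part of \<open>\<psi>\<close> at \<open>q\<close>
  exceeds the quadratic error, so \<open>\<psi>\<close> has a constant sign in each of them. This is where the smoothness of
  the boundary enters, and \<open>r\<close> is the same for all \<open>q\<close>.
\<close>

lemma C2_boundary_tangent_discs:
  assumes D: "open D" and def: "C2_defining_function D \<Gamma> U \<psi>" and p0: "p0 \<in> \<Gamma>" "p0 \<in> U"
  obtains r \<eta> where "r > 0" "\<eta> > 0"
    "\<And>q. q \<in> frontier D \<Longrightarrow> cmod (q - p0) < \<eta> \<Longrightarrow>
      \<exists>\<nu>. cmod \<nu> = 1 \<and> ball (q - of_real r * \<nu>) r \<subseteq> D \<and> D \<inter> ball (q + of_real r * \<nu>) r = {}"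
proof -
  obtain \<psi>' \<psi>'' where C2: "C2_derivs_on \<psi> \<psi>' \<psi>'' U" and U: "open U"
    and UD: "U \<inter> D = {z \<in> U. \<psi> z < 0}" and grad: "frechet_derivative \<psi> (at p0) \<noteq> (\<lambda>_. 0)"
    using def p0 unfolding C2_defining_function_def C2_on_def by blast
  have d\<psi>: "(\<psi> has_derivative blinfun_apply (\<psi>' z)) (at z)" if "z \<in> U" for z
    using C2 that by (auto simp: C2_derivs_on_def)
  have d\<psi>': "(\<psi>' has_derivative blinfun_apply (\<psi>'' z)) (at z)" if "z \<in> U" for z
    using C2 that by (auto simp: C2_derivs_on_def)
  define n where "n z = Complex (\<psi>' z 1) (\<psi>' z \<i>)" for z
  have n: "\<psi>' z e = n z \<bullet> e" for z e
  proof -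
    have "\<psi>' z e = Re (Complex (\<psi>' z 1) (- \<psi>' z \<i>) * e)"
      by (rule real_linear_eq_Re_mult[OF bounded_linear.linear[OF blinfun.bounded_linear_right]])
    then show ?thesis by (simp add: n_def inner_complex_def)
  qed
  have n0: "n p0 \<noteq> 0"
  proof
    assume "n p0 = 0"
    then have "blinfun_apply (\<psi>' p0) = (\<lambda>_. 0)" using n[of p0] by (simp add: fun_eq_iff)
    then show False using grad frechet_derivative_at[OF d\<psi>[OF p0(2)]] by simp
  qed
  define m where "m = cmod (n p0) / 2"
  have m: "m > 0" using n0 by (simp add: m_def)
  define M where "M = norm (\<psi>'' p0) + 1"
  have M: "M > 0" unfolding M_def by (simp add: add_nonneg_pos)
  have "isCont \<psi>' p0"
    using d\<psi>'[OF p0(2)] has_derivative_continuous by blast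
  then have "isCont (\<lambda>z. of_real (\<psi>' z 1) + \<i> * of_real (\<psi>' z \<i>)) p0"
    by (intro continuous_intros)
  moreover have "of_real (\<psi>' z 1) + \<i> * of_real (\<psi>' z \<i>) = n z" for z
    by (simp add: n_def complex_eq_iff)
  ultimately have ncont: "isCont n p0" by simp
  have "isCont \<psi>'' p0"
    using C2 U p0 by (auto simp: C2_derivs_on_def continuous_on_eq_continuous_at)
  then have "isCont (\<lambda>z. norm (\<psi>'' z)) p0" by (intro continuous_intros)
  then have "\<forall>\<^sub>F z in nhds p0. norm (\<psi>'' z) < M"
    by (rule isCont_eventually_nhds) (simp add: M_def)
  moreover have "\<forall>\<^sub>F z in nhds p0. m < cmod (n z)"
  proof -
    have "isCont (\<lambda>z. cmod (n z)) p0" using ncont by (intro continuous_intros)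
    then show ?thesis
      by (rule isCont_eventually_nhds) (use n0 in \<open>simp add: m_def\<close>)
  qed
  moreover have "\<forall>\<^sub>F z in nhds p0. z \<in> U" using U p0 by (intro eventually_nhds_in_open) auto
  ultimately have "\<forall>\<^sub>F z in nhds p0. norm (\<psi>'' z) < M \<and> m < cmod (n z) \<and> z \<in> U"
    by eventually_elim auto
  then obtain R where R: "R > 0" "\<And>z. z \<in> ball p0 R \<Longrightarrow> norm (\<psi>'' z) < M \<and> m < cmod (n z) \<and> z \<in> U"
    by (auto simp: eventually_nhds_metric dist_commute)
  define r where "r = min (R / 4) (m / (2 * M))"
  have r: "r > 0" "r \<le> R / 4" "r \<le> m / (2 * M)" using R m M by (auto simp: r_def)
  then have rM: "M \<le> m / (2 * r)" using M by (simp add: field_simps)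
  show ?thesis
  proof (rule that[of r "R/2"])
    fix q assume q: "q \<in> frontier D" "cmod (q - p0) < R / 2"
    then have qR: "q \<in> ball p0 R" using R(1) by (simp add: dist_norm norm_minus_commute)
    have qU: "q \<in> U" using R(2)[OF qR] by simp
    have "\<psi> q = 0"
    proof (rule antisym)
      have "q \<notin> D" using q(1) D by (simp add: frontier_def interior_open)
      then show "0 \<le> \<psi> q" using UD qU by force
      show "\<psi> q \<le> 0"
      proof (rule ccontr)
        assume "\<not> \<psi> q \<le> 0"
        moreover have "isCont \<psi> q" using d\<psi>[OF qU] has_derivative_continuous by blast
        ultimately have "\<forall>\<^sub>F z in nhds q. 0 < \<psi> z"
          by (intro isCont_eventually_nhds) auto
        moreover have "\<forall>\<^sub>F z in nhds q. z \<in> U" using U qU by (intro eventually_nhds_in_open) auto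
        ultimately have "\<forall>\<^sub>F z in nhds q. z \<notin> D"
        proof eventually_elim
          case (elim z)
          then show ?case using UD by force
        qed
        then obtain V where V: "open V" "q \<in> V" "\<forall>z\<in>V. z \<notin> D"
          by (auto simp: eventually_nhds)
        then have "V \<inter> closure D = {}"
          using open_Int_closure_eq_empty[OF V(1), of D] by blast
        then show False using V(2) q(1) by (auto simp: frontier_def)
      qed
    qed
    define \<nu> where "\<nu> = n q / of_real (cmod (n q))"
    have nq: "m < cmod (n q)" using R(2)[OF qR] by simp
    have nq0: "n q \<noteq> 0"
    proof
      assume "n q = 0"
      with nq m show False by simp
    qed
    then have \<nu>: "cmod \<nu> = 1" by (simp add: \<nu>_def norm_divide)
    have n\<nu>: "n q = cmod (n q) *\<^sub>R \<nu>" using nq0 by (simp add: \<nu>_def scaleR_conv_of_real)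
    have taylor: "\<bar>\<psi> z - cmod (n q) * ((z - q) \<bullet> \<nu>)\<bar> \<le> M * (cmod (z - q))\<^sup>2" and zU: "z \<in> U"
      if z: "cmod (z - q) < 2 * r" for z
    proof -
      have "cmod (z - p0) \<le> cmod (z - q) + cmod (q - p0)"
        using norm_triangle_ineq[of "z - q" "q - p0"] by simp
      then have zR: "z \<in> ball p0 R"
        using z q(2) r by (simp add: dist_norm norm_minus_commute)
      then show "z \<in> U" using R(2) by blast
      have "ball p0 R \<subseteq> U" "\<And>z. z \<in> ball p0 R \<Longrightarrow> norm (\<psi>'' z) \<le> M"
        using R(2) less_imp_le by blast+
      from C2_quadratic_taylor[OF C2 this qR zR]
      have "\<bar>\<psi> z - \<psi> q - n q \<bullet> (z - q)\<bar> \<le> M * (cmod (z - q))\<^sup>2" by (simp only: n)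
      moreover have "n q \<bullet> (z - q) = cmod (n q) * ((z - q) \<bullet> \<nu>)"
        by (subst n\<nu>) (simp add: inner_commute)
      ultimately show "\<bar>\<psi> z - cmod (n q) * ((z - q) \<bullet> \<nu>)\<bar> \<le> M * (cmod (z - q))\<^sup>2"
        using \<open>\<psi> q = 0\<close> by simp
    qed
    have quad: "M * (cmod w)\<^sup>2 \<le> cmod (n q) * ((cmod w)\<^sup>2 / (2 * r))" for w
    proof -
      have "M \<le> cmod (n q) / (2 * r)"
        using rM nq r(1) divide_right_mono[of m "cmod (n q)" "2 * r"] by linarith
      then have "M * (cmod w)\<^sup>2 \<le> cmod (n q) / (2 * r) * (cmod w)\<^sup>2"
        by (intro mult_right_mono) auto
      then show ?thesis by simp
    qed
    have inner: "ball (q - of_real r * \<nu>) r \<subseteq> D"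
    proof
      fix z assume z: "z \<in> ball (q - of_real r * \<nu>) r"
      have "cmod ((q - z) - of_real r * \<nu>) < r"
        using z by (simp add: dist_norm algebra_simps)
      note disc = half_plane_coordinate_disc[OF \<nu> r(1) this]
      have zq: "cmod (z - q) = cmod (q - z)" by (rule norm_minus_commute)
      have "cmod (n q) * ((cmod (q - z))\<^sup>2 / (2 * r)) < cmod (n q) * ((q - z) \<bullet> \<nu>)"
        using disc(1) nq m by (intro mult_strict_left_mono) auto
      moreover have "(z - q) \<bullet> \<nu> = - ((q - z) \<bullet> \<nu>)" by (simp add: inner_diff_left)
      ultimately have "\<psi> z < 0"
        using taylor[of z] quad[of "q - z"] disc(2) unfolding zq by simp
      then show "z \<in> D" using UD zU[of z] disc(2) zq by auto
    qed
    have outer: "D \<inter> ball (q + of_real r * \<nu>) r = {}"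
    proof (rule ccontr)
      assume "D \<inter> ball (q + of_real r * \<nu>) r \<noteq> {}"
      then obtain z where zD: "z \<in> D" and z: "z \<in> ball (q + of_real r * \<nu>) r" by blast
      have "(z - q) - of_real r * \<nu> = - (q + of_real r * \<nu> - z)" by simp
      then have "cmod ((z - q) - of_real r * \<nu>) < r"
        using z by (simp only: mem_ball dist_norm norm_minus_cancel)
      note disc = half_plane_coordinate_disc[OF \<nu> r(1) this]
      have "cmod (n q) * ((cmod (z - q))\<^sup>2 / (2 * r)) < cmod (n q) * ((z - q) \<bullet> \<nu>)"
        using disc(1) nq m by (intro mult_strict_left_mono) auto
      then have "0 < \<psi> z"
        using taylor[of z] quad[of "z - q"] disc(2) by simp
      then show False using UD zU[OF disc(2)] zD by force
    qed
    show "\<exists>\<nu>. cmod \<nu> = 1 \<and> ball (q - of_real r * \<nu>) r \<subseteq> D \<and> D \<inter> ball (q + of_real r * \<nu>) r = {}"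
      using \<nu> inner outer by blast
  qed (use r R in auto)
qed

lemma nearest_boundary_point:
  assumes D: "open D" and p: "p \<in> D" and p0: "p0 \<in> frontier D"
  obtains q where "q \<in> frontier D" "cmod (p - q) \<le> cmod (p - p0)" "ball p (cmod (p - q)) \<subseteq> D"
proof -
  obtain q where q: "q \<in> frontier D" "\<And>y. y \<in> frontier D \<Longrightarrow> dist p q \<le> dist p y"
    using distance_attains_inf[OF frontier_closed, of D p] p0 by blast
  have "ball p (cmod (p - q)) \<subseteq> D"
  proof (rule ccontr)
    assume "\<not> ball p (cmod (p - q)) \<subseteq> D"
    moreover have "p \<in> ball p (cmod (p - q))"
      using q(1) p D by (auto simp: frontier_def interior_open)
    ultimately have "ball p (cmod (p - q)) \<inter> D \<noteq> {}" "ball p (cmod (p - q)) - D \<noteq> {}"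
      using p by blast+
    then have "ball p (cmod (p - q)) \<inter> frontier D \<noteq> {}"
      by (rule connected_Int_frontier[OF connected_ball])
    then obtain y where "y \<in> frontier D" "dist p y < cmod (p - q)" by auto
    then show False using q(2)[of y] by (simp add: dist_norm)
  qed
  with q p0 show ?thesis using that[of q] by (auto simp: dist_norm)
qed

text \<open>
  The disc around \<open>p\<close> lies in \<open>D\<close> and the tangent disc outside, so their centres are at distance at least
  \<open>\<delta> + r\<close>. As both discs have \<open>q\<close> on their boundary, equality holds in the triangle inequality, and \<open>q\<close>
  lies between the centres.
\<close>

lemma inner_normal_direction:
  fixes p q \<nu> :: complex
  assumes \<nu>: "cmod \<nu> = 1" and r: "r > 0" and pq: "p \<noteq> q"
      and sub: "ball p (cmod (p - q)) \<subseteq> D" and dis: "D \<inter> ball (q + of_real r * \<nu>) r = {}"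
  shows "p = q - of_real (cmod (p - q)) * \<nu>"
proof -
  define \<delta> where "\<delta> = cmod (p - q)"
  have \<delta>: "\<delta> > 0" using pq by (simp add: \<delta>_def)
  define x where "x = p - q"
  define y where "y = q + of_real r * \<nu>"
  have far: "\<delta> + r \<le> cmod (p - y)"
  proof (rule ccontr)
    assume c: "\<not> \<delta> + r \<le> cmod (p - y)"
    define s where "s = \<delta> / (\<delta> + r)"
    have s: "0 < s" "s < 1" "s * (\<delta> + r) = \<delta>" "(1 - s) * (\<delta> + r) = r"
      using \<delta> r by (auto simp: s_def field_simps)
    define z where "z = p + of_real s * (y - p)"
    have "p - z = of_real s * (p - y)" "y - z = of_real (1 - s) * (y - p)"
      by (auto simp: z_def algebra_simps)
    then have "cmod (p - z) = s * cmod (p - y)" "cmod (y - z) = (1 - s) * cmod (p - y)"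
      using s by (auto simp: norm_mult norm_minus_commute simp del: of_real_diff)
    moreover have "s * cmod (p - y) < s * (\<delta> + r)" "(1 - s) * cmod (p - y) < (1 - s) * (\<delta> + r)"
      using c s by (intro mult_strict_left_mono; linarith)+
    ultimately have "z \<in> ball p \<delta>" "z \<in> ball y r"
      using s by (simp_all add: dist_norm)
    then show False using sub dis unfolding \<delta>_def y_def by blast
  qed
  have "p - y = x - r *\<^sub>R \<nu>" by (simp add: x_def y_def scaleR_conv_of_real)
  then have "(\<delta> + r)\<^sup>2 \<le> (norm (x - r *\<^sub>R \<nu>))\<^sup>2"
    using far \<delta> r by (intro power_mono) auto
  also have "\<dots> = \<delta>\<^sup>2 - 2 * r * (x \<bullet> \<nu>) + r\<^sup>2 * (cmod \<nu>)\<^sup>2"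
    by (simp add: cmod_diff_scaleR_square \<delta>_def x_def)
  finally have "2 * r * \<delta> \<le> 2 * r * (- (x \<bullet> \<nu>))"
    using \<nu> by (simp add: power2_eq_square algebra_simps)
  then have *: "x \<bullet> \<nu> \<le> - \<delta>"
    using mult_le_cancel_left_pos[of "2 * r" \<delta> "- (x \<bullet> \<nu>)"] r by simp
  have "(norm (x + \<delta> *\<^sub>R \<nu>))\<^sup>2 = (norm x)\<^sup>2 + 2 * \<delta> * (x \<bullet> \<nu>) + \<delta>\<^sup>2 * (cmod \<nu>)\<^sup>2"
    using cmod_diff_scaleR_square[of x "- \<delta>" \<nu>] by simp
  also have "\<dots> = 2 * \<delta> * (\<delta> + x \<bullet> \<nu>)"
    using \<nu> by (simp add: \<delta>_def x_def power2_eq_square algebra_simps)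
  also have "\<dots> \<le> 0" using * \<delta> by (simp add: mult_nonneg_nonpos)
  finally have "x + \<delta> *\<^sub>R \<nu> = 0" by simp
  then have "p - q + of_real \<delta> * \<nu> = 0" by (simp add: x_def scaleR_conv_of_real)
  then show ?thesis unfolding \<delta>_def by (simp add: algebra_simps add_eq_0_iff)
qed

section \<open>Comparison with the half plane\<close>

text \<open>
  With \<open>x = (z - q) / \<nu>\<close> and \<open>y = (p - q) / \<nu>\<close> this is \<open>x + cnj y - t * x * cnj y\<close>. The logarithm of its modulus is
  \<open>G(z, p) + log |z - p|\<close> for the half plane \<open>Re x < 0\<close> if \<open>t = 0\<close>, for the exterior of the disc with centre \<open>x = r\<close> and
  radius \<open>r\<close> if \<open>t = 1/r\<close>, and for the disc with centre \<open>x = -r\<close> and radius \<open>r\<close> if \<open>t = -1/r\<close>. The inversion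
  \<open>x \<mapsto> 1/x\<close> maps all three to half planes bounded by vertical lines, so they share one formula.
\<close>

definition reflection_kernel :: "complex \<Rightarrow> complex \<Rightarrow> real \<Rightarrow> complex \<Rightarrow> complex \<Rightarrow> complex" where
  "reflection_kernel q \<nu> t z p =
     (z - q) * cnj \<nu> + cnj ((p - q) * cnj \<nu>) - of_real t * ((z - q) * cnj \<nu>) * cnj ((p - q) * cnj \<nu>)"

text \<open>
  A defining function of these three model domains: they are the sets where it is negative.
\<close>

definition tangent_level :: "complex \<Rightarrow> complex \<Rightarrow> real \<Rightarrow> complex \<Rightarrow> real" where
  "tangent_level q \<nu> t z = 2 * Re ((z - q) * cnj \<nu>) - t * (cmod (z - q))\<^sup>2"

text \<open>
  So the modulus of the kernel is \<open>|z - p|\<close> when \<open>z\<close> lies on the boundary of the model domain, and it is larger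
  when \<open>z\<close> and \<open>p\<close> both lie inside.
\<close>

lemma reflection_kernel_identity:
  assumes "cmod \<nu> = 1"
  shows "(cmod (reflection_kernel q \<nu> t z p))\<^sup>2 =
     (cmod (z - p))\<^sup>2 + tangent_level q \<nu> t z * tangent_level q \<nu> t p"
proof -
  define x where "x = (z - q) * cnj \<nu>"
  define y where "y = (p - q) * cnj \<nu>"
  have 1: "cmod (z - p) = cmod (x - y)" "cmod (z - q) = cmod x" "cmod (p - q) = cmod y"
    using assms by (simp_all add: x_def y_def norm_mult flip: left_diff_distrib)
  have "(cmod (x + cnj y - of_real t * x * cnj y))\<^sup>2 =
     (cmod (x - y))\<^sup>2 + (2 * Re x - t * (cmod x)\<^sup>2) * (2 * Re y - t * (cmod y)\<^sup>2)"
    unfolding cmod_power2 by (simp add: power2_eq_square algebra_simps)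
  then show ?thesis
    by (simp add: reflection_kernel_def tangent_level_def 1 flip: x_def y_def)
qed

lemma cmod_minus_center:
  assumes "cmod \<nu> = 1"
  shows "(cmod (z - (q + of_real s * \<nu>)))\<^sup>2 = (cmod (z - q))\<^sup>2 - 2 * s * Re ((z - q) * cnj \<nu>) + s\<^sup>2"
proof -
  have "Re ((z - q) * cnj \<nu>) = (z - q) \<bullet> \<nu>" by (simp add: inner_complex_def)
  moreover have "z - (q + of_real s * \<nu>) = (z - q) - s *\<^sub>R \<nu>"
    by (simp add: scaleR_conv_of_real)
  ultimately show ?thesis
    using cmod_diff_scaleR_square[of "z - q" s \<nu>] by (simp only: assms power_one mult_1_right)
qed

lemma tangent_level_eq:
  assumes "cmod \<nu> = 1" "r \<noteq> 0"
  shows "tangent_level q \<nu> (1 / r) z = (r\<^sup>2 - (cmod (z - (q + of_real r * \<nu>)))\<^sup>2) / r"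
  unfolding tangent_level_def cmod_minus_center[OF assms(1)]
  using assms(2) by (simp add: field_simps power2_eq_square)

lemma cmod_ge_of_square_ge: "(cmod x)\<^sup>2 \<ge> (cmod y)\<^sup>2 \<Longrightarrow> cmod y \<le> cmod x"
  using power2_le_imp_le norm_ge_zero by blast

lemma reflection_kernel_holomorphic [holomorphic_intros]:
  "(\<lambda>z. reflection_kernel q \<nu> t z p) holomorphic_on S"
  unfolding reflection_kernel_def by (intro holomorphic_intros)

context regular_domain_exterior_disc
begin

text \<open>
  Green's function is nonnegative, by the minimum principle on \<open>D\<close> without the pole.
\<close>

lemma robin_kernel_ge_ln:
  assumes p: "p \<in> D" and z: "z \<in> D" "z \<noteq> p"
  shows "ln (cmod (z - p)) \<le> robin_kernel z p"
proof -
  let ?u = "\<lambda>z. robin_kernel z p - ln (cmod (z - p))"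
  have green: "is_green_function D p ?u" by (rule green_function_robin_kernel[OF p])
  have W: "open (D - {p})" using open_D by auto
  obtain R B where RB: "\<And>z. z \<in> D \<Longrightarrow> R < cmod z \<Longrightarrow> \<bar>?u z\<bar> \<le> B"
    using robin_kernel_near_infinity[OF p, of p] unfolding bounded_near_infinity_iff by blast
  have "0 \<le> ?u z"
  proof (rule harmonic_minimum_principle[OF W r0, of a ?u R "- B"])
    show "\<And>z. z \<in> D - {p} \<Longrightarrow> r0 \<le> cmod (z - a)" using ext_D by blast
    show "harmonic_on ?u (D - {p})" using green by (simp add: is_green_function_def)
    show "- B \<le> ?u z" if "z \<in> D - {p}" "R < cmod z" for z
      using RB[of z] that by (auto simp: abs_le_iff)
    show "z \<in> D - {p}" using z by simp
    fix \<zeta> \<epsilon> assume \<zeta>: "\<zeta> \<in> frontier (D - {p})" and \<epsilon>: "(0::real) < \<epsilon>"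
    have clo: "\<zeta> \<in> closure D" "\<zeta> \<notin> D - {p}"
      using \<zeta> W closure_mono[of "D - {p}" D] by (auto simp: frontier_def interior_open)
    show "\<forall>\<^sub>F z in at \<zeta> within D - {p}. - \<epsilon> < ?u z"
    proof (cases "\<zeta> = p")
      case True
      have "continuous_on D (\<lambda>z. robin_kernel z p)"
        by (rule harmonic_on_continuous_on[OF open_D robin_kernel_harmonic_fst[OF p]])
      then have "isCont (\<lambda>z. robin_kernel z p) p"
        using open_D p by (simp add: continuous_on_eq_continuous_at)
      then have "\<forall>\<^sub>F z in nhds p. robin_kernel p p - 1 < robin_kernel z p"
        by (rule isCont_eventually_nhds) simp
      moreover have "\<forall>\<^sub>F z in nhds p. cmod (z - p) < exp (robin_kernel p p - 1)"
        by (rule isCont_eventually_nhds(2)) (auto intro!: continuous_intros)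
      ultimately have "\<forall>\<^sub>F z in nhds p. z \<noteq> p \<longrightarrow> - \<epsilon> < ?u z"
      proof eventually_elim
        case (elim z)
        show ?case
        proof
          assume "z \<noteq> p"
          then have "ln (cmod (z - p)) < ln (exp (robin_kernel p p - 1))"
            using elim(2) by (subst ln_less_cancel_iff) auto
          then show "- \<epsilon> < ?u z" using elim(1) \<epsilon> by simp
        qed
      qed
      then show ?thesis
        unfolding True by (simp add: eventually_at_filter eventually_mono)
    next
      case False
      then have fr: "\<zeta> \<in> frontier D" using clo open_D by (auto simp: frontier_def interior_open)
      have "(?u \<longlongrightarrow> 0) (at \<zeta> within D)" using green fr by (simp add: is_green_function_def)
      then have "(?u \<longlongrightarrow> 0) (at \<zeta> within D - {p})" by (rule tendsto_within_subset) auto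
      then show ?thesis using \<epsilon> by (intro order_tendstoD(1)) auto
    qed
  qed
  then show ?thesis by simp
qed

text \<open>
  On the boundary of \<open>D\<close>, which lies in the closure of the exterior of the outer disc, the kernel of that
  exterior is at least \<open>log |\<zeta> - p|\<close>.
\<close>

lemma robin_kernel_upper_bound:
  assumes \<nu>: "cmod \<nu> = 1" and r: "r > 0" and out: "D \<inter> ball (q + of_real r * \<nu>) r = {}"
      and p: "p \<in> D" and z: "z \<in> D"
  shows "robin_kernel z p \<le> ln (cmod (reflection_kernel q \<nu> (1 / r) z p))"
    and "reflection_kernel q \<nu> (1 / r) z p \<noteq> 0"
proof -
  let ?N = "\<lambda>z. reflection_kernel q \<nu> (1 / r) z p"
  let ?A = "tangent_level q \<nu> (1 / r)"
  have clo: "closure D \<inter> ball (q + of_real r * \<nu>) r = {}"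
    using out open_Int_closure_eq_empty[OF open_ball, of "q + of_real r * \<nu>" r D] by (simp add: Int_commute)
  have Aclo: "?A x \<le> 0" if "x \<in> closure D" for x
  proof -
    have "x \<notin> ball (q + of_real r * \<nu>) r" using clo that by blast
    then have "r\<^sup>2 \<le> (cmod (x - (q + of_real r * \<nu>)))\<^sup>2"
      using r by (intro power_mono) (auto simp: dist_norm norm_minus_commute)
    then show ?thesis using r \<nu> by (simp add: tangent_level_eq divide_le_0_iff)
  qed
  have AD: "?A x < 0" if "x \<in> D" for x
  proof -
    have "D \<inter> cball (q + of_real r * \<nu>) r = {}"
      using out open_Int_closure_eq_empty[OF open_D, of "ball (q + of_real r * \<nu>) r"] r by simp
    then have "x \<notin> cball (q + of_real r * \<nu>) r" using that by blast
    then have "r\<^sup>2 < (cmod (x - (q + of_real r * \<nu>)))\<^sup>2"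
      using r by (intro power_strict_mono) (auto simp: dist_norm norm_minus_commute)
    then show ?thesis using r \<nu> by (simp add: tangent_level_eq divide_less_0_iff)
  qed
  have Nge: "cmod (x - p) \<le> cmod (?N x)" if "x \<in> closure D" for x
  proof (rule cmod_ge_of_square_ge)
    have "0 \<le> ?A x * ?A p" using Aclo[OF that] AD[OF p] by (simp add: mult_nonpos_nonpos)
    then show "(cmod (x - p))\<^sup>2 \<le> (cmod (?N x))\<^sup>2"
      using reflection_kernel_identity[OF \<nu>, of q "1 / r" x p] by simp
  qed
  have Nnz: "?N x \<noteq> 0" if "x \<in> D" for x
  proof -
    have "0 < ?A x * ?A p" using AD[OF that] AD[OF p] by (simp add: mult_neg_neg)
    then have "0 < (cmod (?N x))\<^sup>2"
      unfolding reflection_kernel_identity[OF \<nu>, of q "1 / r" x p] by (rule add_nonneg_pos[rotated]) simp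
    then show ?thesis by auto
  qed
  show "reflection_kernel q \<nu> (1 / r) z p \<noteq> 0" by (rule Nnz[OF z])
  obtain R B where RB: "\<And>z. z \<in> D \<Longrightarrow> R < cmod z \<Longrightarrow> \<bar>robin_kernel z p - ln (cmod (z - p))\<bar> \<le> B"
    using robin_kernel_near_infinity[OF p, of p] unfolding bounded_near_infinity_iff by blast
  let ?u = "\<lambda>z. ln (cmod (?N z)) - robin_kernel z p"
  have "0 \<le> ?u z"
  proof (rule harmonic_minimum_principle[OF open_D r0 ext_D, of ?u "max R (cmod p)" "- B"])
    show "harmonic_on ?u D"
      by (intro harmonic_on_diff harmonic_on_ln_cmod open_D reflection_kernel_holomorphic Nnz
          robin_kernel_harmonic_fst p)
    show "- B \<le> ?u x" if x: "x \<in> D" "max R (cmod p) < cmod x" for x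
    proof -
      have "0 < cmod (x - p)" using x by auto
      then have "ln (cmod (x - p)) \<le> ln (cmod (?N x))"
        using Nge[of x] x closure_subset[of D] by (intro ln_mono) auto
      then show ?thesis using RB[of x] x by (simp add: abs_le_iff)
    qed
    fix \<zeta> \<epsilon> assume \<zeta>: "\<zeta> \<in> frontier D" and \<epsilon>: "(0::real) < \<epsilon>"
    have \<zeta>c: "\<zeta> \<in> closure D" and "\<zeta> \<noteq> p"
      using \<zeta> p open_D by (auto simp: frontier_def interior_open)
    then have pos: "0 < cmod (\<zeta> - p)" "cmod (\<zeta> - p) \<le> cmod (?N \<zeta>)" using Nge by auto
    have "isCont ?N \<zeta>" unfolding reflection_kernel_def by (intro continuous_intros)
    then have "(?N \<longlongrightarrow> ?N \<zeta>) (at \<zeta> within D)"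
      by (meson continuous_at_imp_continuous_at_within continuous_within)
    then have "(?u \<longlongrightarrow> ln (cmod (?N \<zeta>)) - ln (cmod (\<zeta> - p))) (at \<zeta> within D)"
      using pos by (intro tendsto_diff robin_kernel_boundary p \<zeta> tendsto_ln tendsto_norm) auto
    moreover have "- \<epsilon> < ln (cmod (?N \<zeta>)) - ln (cmod (\<zeta> - p))"
      using pos \<epsilon> ln_mono[of "cmod (\<zeta> - p)" "cmod (?N \<zeta>)"] by linarith
    ultimately show "\<forall>\<^sub>F z in at \<zeta> within D. - \<epsilon> < ?u z" by (rule order_tendstoD(1))
  qed (use z in auto)
  then show "robin_kernel z p \<le> ln (cmod (?N z))" by simp
qed

text \<open>
  On the boundary of the inner disc its own kernel equals \<open>log |\<zeta> - p|\<close>, while that of \<open>D\<close> is at least this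
  large because Green's function of \<open>D\<close> is nonnegative.
\<close>

lemma robin_kernel_lower_bound:
  assumes \<nu>: "cmod \<nu> = 1" and r: "r > 0" and sub: "ball (q - of_real r * \<nu>) r \<subseteq> D"
      and p: "p \<in> ball (q - of_real r * \<nu>) r" and z: "z \<in> ball (q - of_real r * \<nu>) r"
  shows "ln (cmod (reflection_kernel q \<nu> (- 1 / r) z p)) \<le> robin_kernel z p"
proof -
  let ?N = "\<lambda>z. reflection_kernel q \<nu> (- 1 / r) z p"
  let ?A = "tangent_level q \<nu> (- 1 / r)"
  let ?c = "q - of_real r * \<nu>"
  let ?W = "ball ?c r"
  have pD: "p \<in> D" using p sub by blast
  have Aeq: "?A x = ((cmod (x - ?c))\<^sup>2 - r\<^sup>2) / r" for x
    using tangent_level_eq[OF \<nu>, of "- r" q x] r by (simp add: field_simps)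
  have AW: "?A x < 0" if "x \<in> ?W" for x
  proof -
    have "(cmod (x - ?c))\<^sup>2 < r\<^sup>2"
      using that r by (intro power_strict_mono) (auto simp: dist_norm norm_minus_commute)
    then show ?thesis using r unfolding Aeq by (simp add: divide_less_0_iff)
  qed
  have Nnz: "?N x \<noteq> 0" if "x \<in> ?W" for x
  proof -
    have "0 < ?A x * ?A p" using AW[OF that] AW[OF p] by (simp add: mult_neg_neg)
    then have "0 < (cmod (?N x))\<^sup>2"
      unfolding reflection_kernel_identity[OF \<nu>, of q "- 1 / r" x p] by (rule add_nonneg_pos[rotated]) simp
    then show ?thesis by auto
  qed
  let ?u = "\<lambda>z. robin_kernel z p - ln (cmod (?N z))"
  have "0 \<le> ?u z"
  proof (rule harmonic_minimum_principle[OF open_ball r0, of ?c r a ?u "cmod ?c + r" 0])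
    show "\<And>z. z \<in> ?W \<Longrightarrow> r0 \<le> cmod (z - a)" using ext_D sub by blast
    show "harmonic_on ?u ?W"
      by (intro harmonic_on_diff harmonic_on_ln_cmod open_ball reflection_kernel_holomorphic Nnz
          harmonic_on_subset[OF robin_kernel_harmonic_fst[OF pD] sub])
    show "0 \<le> ?u x" if x: "x \<in> ?W" "cmod ?c + r < cmod x" for x
      using x norm_triangle_ineq2[of x ?c] by (auto simp: dist_norm norm_minus_commute)
    show "z \<in> ?W" by (rule z)
    fix \<zeta> \<epsilon> assume "\<zeta> \<in> frontier ?W" and \<epsilon>: "(0::real) < \<epsilon>"
    then have \<zeta>: "cmod (\<zeta> - ?c) = r" using r by (simp add: dist_norm norm_minus_commute)
    have "\<zeta> \<noteq> p" using \<zeta> p by (auto simp: dist_norm norm_minus_commute)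
    have "?A \<zeta> = 0" unfolding Aeq \<zeta> by simp
    then have "(cmod (?N \<zeta>))\<^sup>2 = (cmod (\<zeta> - p))\<^sup>2"
      using reflection_kernel_identity[OF \<nu>, of q "- 1 / r" \<zeta> p] by simp
    then have N\<zeta>: "cmod (?N \<zeta>) = cmod (\<zeta> - p)" by (rule power2_eq_imp_eq) auto
    have "isCont ?N \<zeta>" unfolding reflection_kernel_def by (intro continuous_intros)
    then have "(?N \<longlongrightarrow> ?N \<zeta>) (at \<zeta> within ?W)"
      by (meson continuous_at_imp_continuous_at_within continuous_within)
    moreover have "cmod (\<zeta> - p) \<noteq> 0" using \<open>\<zeta> \<noteq> p\<close> by simp
    ultimately have limN: "((\<lambda>z. ln (cmod (?N z))) \<longlongrightarrow> ln (cmod (\<zeta> - p))) (at \<zeta> within ?W)"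
      unfolding N\<zeta>[symmetric] by (intro tendsto_ln tendsto_norm)
    have "\<exists>l \<ge> ln (cmod (\<zeta> - p)). ((\<lambda>z. robin_kernel z p) \<longlongrightarrow> l) (at \<zeta> within ?W)"
    proof (cases "\<zeta> \<in> D")
      case True
      have "continuous_on D (\<lambda>z. robin_kernel z p)"
        by (rule harmonic_on_continuous_on[OF open_D robin_kernel_harmonic_fst[OF pD]])
      then have "((\<lambda>z. robin_kernel z p) \<longlongrightarrow> robin_kernel \<zeta> p) (at \<zeta> within D)"
        using True by (simp add: continuous_on_def)
      then show ?thesis
        using robin_kernel_ge_ln[OF pD True \<open>\<zeta> \<noteq> p\<close>] tendsto_within_subset[OF _ sub] by blast
    next
      case False
      have "\<zeta> \<in> closure ?W" using \<zeta> r by (simp add: dist_norm norm_minus_commute)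
      then have "\<zeta> \<in> frontier D"
        using False closure_mono[OF sub] open_D by (auto simp: frontier_def interior_open)
      then show ?thesis
        using tendsto_within_subset[OF robin_kernel_boundary[OF pD] sub] by blast
    qed
    then obtain l where l: "l \<ge> ln (cmod (\<zeta> - p))" "((\<lambda>z. robin_kernel z p) \<longlongrightarrow> l) (at \<zeta> within ?W)"
      by blast
    have "(?u \<longlongrightarrow> l - ln (cmod (\<zeta> - p))) (at \<zeta> within ?W)"
      by (rule tendsto_diff[OF l(2) limN])
    then show "\<forall>\<^sub>F z in at \<zeta> within ?W. - \<epsilon> < ?u z"
      using l(1) \<epsilon> by (intro order_tendstoD(1)) auto
  qed
  then show ?thesis by simp
qed

text \<open>
  All three kernels have the form \<open>N0 * (1 - t * X)\<close>, where \<open>N0\<close> is the kernel of the half plane. Near \<open>q - \<delta> \<nu>\<close> one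
  has \<open>|X| \<le> 3 \<delta>\<close>, so that the disc kernels with \<open>t = 1/r\<close> and \<open>t = -1/r\<close> are within \<open>6 \<delta> / r\<close> of the half plane after
  taking logarithms.
\<close>

lemma robin_kernel_half_plane_approx:
  assumes \<nu>: "cmod \<nu> = 1" and r: "r > 0"
      and sub: "ball (q - of_real r * \<nu>) r \<subseteq> D" and out: "D \<inter> ball (q + of_real r * \<nu>) r = {}"
      and \<delta>: "0 < \<delta>" "6 * \<delta> \<le> r"
      and z: "z \<in> ball (q - of_real \<delta> * \<nu>) (\<delta>/2)" and w: "w \<in> ball (q - of_real \<delta> * \<nu>) (\<delta>/2)"
  shows "\<bar>robin_kernel z w - ln (cmod (reflection_kernel q \<nu> 0 z w))\<bar> \<le> 6 * \<delta> / r"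
proof -
  have loc: "x \<in> ball (q - of_real r * \<nu>) r" "x \<in> D" "Re ((x - q) * cnj \<nu>) < - \<delta> / 2"
    "cmod ((x - q) * cnj \<nu>) \<le> 3 * \<delta> / 2"
    if x: "x \<in> ball (q - of_real \<delta> * \<nu>) (\<delta>/2)" for x
  proof -
    have xd: "cmod (x - q + of_real \<delta> * \<nu>) < \<delta> / 2"
      using x by (simp add: dist_norm norm_minus_commute algebra_simps)
    have "x - q + of_real r * \<nu> = (x - q + of_real \<delta> * \<nu>) + of_real (r - \<delta>) * \<nu>"
      by (simp add: algebra_simps)
    then have "cmod (x - q + of_real r * \<nu>) \<le> cmod (x - q + of_real \<delta> * \<nu>) + cmod (of_real (r - \<delta>) * \<nu>)"
      by (simp only: norm_triangle_ineq)
    also have "cmod (of_real (r - \<delta>) * \<nu>) = r - \<delta>"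
      using \<nu> \<delta> by (simp add: norm_mult del: of_real_diff)
    finally have "cmod (x - q + of_real r * \<nu>) < r" using xd \<delta> by linarith
    then show xb: "x \<in> ball (q - of_real r * \<nu>) r"
      by (simp add: dist_norm norm_minus_commute algebra_simps)
    then show "x \<in> D" using sub by blast
    have \<nu>\<nu>: "\<nu> * cnj \<nu> = 1" using \<nu> by (simp add: complex_norm_square[symmetric])
    have e: "(x - q) * cnj \<nu> = (x - q + of_real \<delta> * \<nu>) * cnj \<nu> - of_real \<delta>"
      using \<nu>\<nu> by (simp add: algebra_simps)
    have ed: "cmod ((x - q + of_real \<delta> * \<nu>) * cnj \<nu>) < \<delta> / 2"
      using xd \<nu> by (simp add: norm_mult)
    then show "Re ((x - q) * cnj \<nu>) < - \<delta> / 2"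
      using abs_Re_le_cmod[of "(x - q + of_real \<delta> * \<nu>) * cnj \<nu>"] unfolding e by simp
    have "cmod ((x - q) * cnj \<nu>) \<le> cmod ((x - q + of_real \<delta> * \<nu>) * cnj \<nu>) + cmod (complex_of_real \<delta>)"
      unfolding e by (rule norm_triangle_ineq4)
    then show "cmod ((x - q) * cnj \<nu>) \<le> 3 * \<delta> / 2" using ed \<delta> by simp
  qed
  define x where "x = (z - q) * cnj \<nu>"
  define y where "y = (w - q) * cnj \<nu>"
  note zl = loc[OF z, folded x_def] and wl = loc[OF w, folded y_def]
  define N0 where "N0 = x + cnj y"
  have N0: "reflection_kernel q \<nu> 0 z w = N0"
    by (simp add: reflection_kernel_def N0_def x_def y_def)
  have "\<delta> \<le> \<bar>Re N0\<bar>" using zl(3) wl(3) by (simp add: N0_def)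
  then have N0ge: "\<delta> \<le> cmod N0" using abs_Re_le_cmod[of N0] by linarith
  then have N0nz: "N0 \<noteq> 0" using \<delta> by auto
  define X where "X = x * cnj y / N0"
  have "cmod X \<le> (3 * \<delta> / 2) * (3 * \<delta> / 2) / \<delta>"
    unfolding X_def norm_divide norm_mult
    using zl(4) wl(4) N0ge \<delta> by (intro frac_le mult_mono) auto
  also have "\<dots> \<le> 3 * \<delta>" using \<delta> by simp
  finally have Xle: "cmod X \<le> 3 * \<delta>" .
  have Nt: "reflection_kernel q \<nu> t z w = N0 * (1 - of_real t * X)" for t
  proof -
    have "reflection_kernel q \<nu> t z w = N0 - of_real t * (x * cnj y)"
      by (simp add: reflection_kernel_def N0_def x_def y_def)
    also have "x * cnj y = N0 * X" using N0nz by (simp add: X_def)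
    finally show ?thesis by (simp add: algebra_simps)
  qed
  have small: "\<bar>ln (cmod (reflection_kernel q \<nu> t z w)) - ln (cmod N0)\<bar> \<le> 6 * \<delta> / r" if t: "\<bar>t\<bar> = 1 / r" for t
  proof -
    define Y where "Y = - of_real t * X"
    have "cmod Y = cmod X / r" using t by (simp add: Y_def norm_mult)
    then have Yle: "cmod Y \<le> 3 * \<delta> / r" using Xle r by (simp add: divide_right_mono)
    also have "\<dots> \<le> 1 / 2" using \<delta> r by (simp add: field_simps)
    finally have Y2: "cmod Y \<le> 1 / 2" .
    have low: "1 - cmod Y \<le> cmod (1 + Y)" "cmod (1 + Y) \<le> 1 + cmod Y"
      using norm_triangle_ineq2[of 1 "- Y"] norm_triangle_ineq[of 1 Y] by simp_all
    have "ln (cmod (1 + Y)) \<le> cmod (1 + Y) - 1"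
      using low Y2 by (intro ln_le_minus_one) linarith
    then have up: "ln (cmod (1 + Y)) \<le> 2 * cmod Y" using low norm_ge_zero[of Y] by linarith
    have "- cmod Y - 2 * (cmod Y)\<^sup>2 \<le> ln (1 - cmod Y)"
      using Y2 by (intro ln_one_minus_pos_lower_bound) auto
    moreover have "(cmod Y)\<^sup>2 \<le> cmod Y * (1 / 2)"
      unfolding power2_eq_square using Y2 by (intro mult_left_mono) auto
    moreover have "ln (1 - cmod Y) \<le> ln (cmod (1 + Y))"
      using low Y2 by (intro ln_mono) linarith+
    ultimately have "- (2 * cmod Y) \<le> ln (cmod (1 + Y))" by linarith
    with up have "\<bar>ln (cmod (1 + Y))\<bar> \<le> 2 * cmod Y" by linarith
    also have "\<dots> \<le> 6 * \<delta> / r" using Yle by simp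
    finally have lnY: "\<bar>ln (cmod (1 + Y))\<bar> \<le> 6 * \<delta> / r" .
    have "1 + Y \<noteq> 0" using low Y2 by auto
    then have "ln (cmod (reflection_kernel q \<nu> t z w)) = ln (cmod N0) + ln (cmod (1 + Y))"
      unfolding Nt using N0nz by (simp add: Y_def norm_mult ln_mult_pos)
    then show ?thesis using lnY by simp
  qed
  have "robin_kernel z w \<le> ln (cmod (reflection_kernel q \<nu> (1 / r) z w))"
    by (rule robin_kernel_upper_bound(1)[OF \<nu> r out wl(2) zl(2)])
  moreover have "ln (cmod (reflection_kernel q \<nu> (- 1 / r) z w)) \<le> robin_kernel z w"
    by (rule robin_kernel_lower_bound[OF \<nu> r sub wl(1) zl(1)])
  ultimately show ?thesis
    using small[of "1 / r"] small[of "- 1 / r"] r unfolding N0 by (simp add: abs_le_iff)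
qed

text \<open>
  The logarithm of the capacity function is \<open>- k(z, z) - log (- 2 Re (c z))\<close>, where \<open>k\<close> is the deviation from the half plane. The second
  summand contributes \<open>1 / (4 \<delta>^2)\<close> to the mixed Wirtinger derivative at \<open>p\<close>, the first one \<open>O(1 / (r \<delta>))\<close>.
  After multiplication by \<open>c_D(p)^(-2) = 4 \<delta>^2 exp (2 k(p, p))\<close>, what remains is the distance from -4.
\<close>

lemma curvature_estimate:
  assumes \<nu>: "cmod \<nu> = 1" and r: "r > 0"
      and sub: "ball (q - of_real r * \<nu>) r \<subseteq> D" and out: "D \<inter> ball (q + of_real r * \<nu>) r = {}"
      and \<delta>: "0 < \<delta>" "6 * \<delta> \<le> r"
  shows "cmod (metric_curvature (capacity_function D) (q - of_real \<delta> * \<nu>) + 4)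
     \<le> 4 * (exp (12 * \<delta> / r) - 1) + exp (12 * \<delta> / r) * (1990656 * \<delta> / r)"
proof -
  define p where "p = q - of_real \<delta> * \<nu>"
  let ?B = "ball p (\<delta>/2)"
  define c where "c z = (z - q) * cnj \<nu>" for z
  have \<nu>\<nu>: "\<nu> * cnj \<nu> = 1" using \<nu> by (simp add: complex_norm_square[symmetric])
  have cp: "c p = - of_real \<delta>" using \<nu>\<nu> by (simp add: c_def p_def mult.assoc)
  have cneg: "Re (c z) < 0" if "z \<in> ?B" for z
  proof -
    have "c z = (z - p) * cnj \<nu> + c p" by (simp add: c_def algebra_simps)
    moreover have "cmod ((z - p) * cnj \<nu>) < \<delta> / 2"
      using that \<nu> by (simp add: norm_mult dist_norm norm_minus_commute)
    ultimately show ?thesis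
      using abs_Re_le_cmod[of "(z - p) * cnj \<nu>"] \<delta> by (simp add: cp)
  qed
  have BD: "?B \<subseteq> D"
  proof
    fix x assume x: "x \<in> ?B"
    have "q - of_real r * \<nu> - x = (p - x) + of_real (\<delta> - r) * \<nu>"
      by (simp add: p_def algebra_simps)
    then have "cmod (q - of_real r * \<nu> - x) \<le> cmod (p - x) + cmod (of_real (\<delta> - r) * \<nu>)"
      by (simp only: norm_triangle_ineq)
    also have "cmod (of_real (\<delta> - r) * \<nu>) = r - \<delta>"
      using \<nu> \<delta> by (simp add: norm_mult del: of_real_diff)
    finally have "x \<in> ball (q - of_real r * \<nu>) r" using x \<delta> by (simp add: dist_norm)
    then show "x \<in> D" using sub by blast
  qed
  define M where "M = 6 * \<delta> / r"
  have M: "M > 0" using \<delta> r by (simp add: M_def)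
  have d2: "\<delta> / 2 > 0" using \<delta> by simp
  define k where "k z w = robin_kernel z w - ln (cmod (reflection_kernel q \<nu> 0 z w))" for z w
  have kM: "\<bar>k z w\<bar> \<le> M" if "z \<in> ?B" "w \<in> ?B" for z w
    unfolding k_def M_def
    using that unfolding p_def by (intro robin_kernel_half_plane_approx[OF \<nu> r sub out \<delta>])
  have N0: "reflection_kernel q \<nu> 0 z w = c z + cnj (c w)" for z w
    by (simp add: reflection_kernel_def c_def)
  have nz: "c z + cnj (c w) \<noteq> 0" if "z \<in> ?B" "w \<in> ?B" for z w
    using cneg[OF that(1)] cneg[OF that(2)] by (auto simp: complex_eq_iff)
  have sep: "separately_harmonic_on k ?B"
    unfolding separately_harmonic_on_def
  proof (intro conjI ballI)
    show "harmonic_on (\<lambda>z. k z w) ?B" if w: "w \<in> ?B" for w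
      unfolding k_def N0
    proof (intro harmonic_on_diff open_ball harmonic_on_ln_cmod nz w)
      show "harmonic_on (\<lambda>z. robin_kernel z w) ?B"
        by (rule harmonic_on_subset[OF robin_kernel_harmonic_fst[OF subsetD[OF BD w]] BD])
    qed (auto simp: c_def intro!: holomorphic_intros)
    show "harmonic_on (\<lambda>w. k z w) ?B" if z: "z \<in> ?B" for z
    proof -
      have eq: "cmod (c z + cnj (c w)) = cmod (c w + cnj (c z))" for w
      proof -
        have "cnj (c z + cnj (c w)) = c w + cnj (c z)" by simp
        then show ?thesis by (metis complex_mod_cnj)
      qed
      show ?thesis
        unfolding k_def N0 eq
      proof (intro harmonic_on_diff open_ball harmonic_on_ln_cmod nz z)
        show "harmonic_on (\<lambda>w. robin_kernel z w) ?B"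
          by (rule harmonic_on_subset[OF robin_kernel_harmonic_snd[OF subsetD[OF BD z]] BD])
      qed (auto simp: c_def intro!: holomorphic_intros)
    qed
  qed
  obtain E A where
    E: "\<And>z. z \<in> ball p (\<delta>/2/2) \<Longrightarrow> ((\<lambda>z. k z z) has_derivative (\<lambda>e. Re (E z * e))) (at z)" and
    A: "(E has_derivative A) (at p)" "\<And>e. cmod (A e) \<le> 10368 * M / (\<delta>/2)\<^sup>2 * cmod e"
  proof (rule separately_harmonic_diagonal_second_derivative[OF sep d2 M kM])
    fix E A
    assume "\<And>z. z \<in> ball p (\<delta>/2/2) \<Longrightarrow> ((\<lambda>z. k z z) has_derivative (\<lambda>e. Re (E z * e))) (at z)"
      "(E has_derivative A) (at p)" "\<And>e. cmod (A e) \<le> 10368 * M / (\<delta>/2)\<^sup>2 * cmod e"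
    then show thesis by (rule that)
  qed
  have pB: "p \<in> ball p (\<delta>/2/2)" using \<delta> by simp
  have robin: "robin_function D z = k z z + ln (- 2 * Re (c z))" if "z \<in> ?B" for z
  proof -
    have "c z + cnj (c z) = of_real (2 * Re (c z))" by (simp add: complex_eq_iff)
    then have "cmod (reflection_kernel q \<nu> 0 z z) = - 2 * Re (c z)"
      using cneg[OF that] unfolding N0 by simp
    then show ?thesis using robin_function_eq BD that by (auto simp: k_def)
  qed
  define G where "G z = - (E z + cnj \<nu> / of_real (Re (c z)))" for z
  have dlog: "((\<lambda>w. ln (capacity_function D w)) has_derivative (\<lambda>e. Re (G z * e))) (at z)"
    if z: "z \<in> ball p (\<delta>/2/2)" for z
  proof -
    have zB: "z \<in> ?B" using z \<delta> by auto
    have dc: "((\<lambda>w. Re (c w)) has_derivative (\<lambda>e. Re (cnj \<nu> * e))) (at z)"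
    proof (rule has_derivative_Re_holomorphic)
      show "(c has_field_derivative cnj \<nu>) (at z)"
        unfolding c_def by (auto intro!: derivative_eq_intros)
    qed
    have "((\<lambda>w. ln (- 2 * Re (c w))) has_derivative (\<lambda>e. (-2 * Re (cnj \<nu> * e)) * inverse (- 2 * Re (c z)))) (at z)"
      using cneg[OF zB] dc
      by (intro has_derivative_ln has_derivative_mult_right) auto
    from has_derivative_minus[OF has_derivative_add[OF E[OF z] this]]
    have "((\<lambda>w. - (k w w + ln (- 2 * Re (c w)))) has_derivative
      (\<lambda>e. - (Re (E z * e) + (-2 * Re (cnj \<nu> * e)) * inverse (- 2 * Re (c z))))) (at z)" .
    moreover have "- (Re (E z * e) + (-2 * Re (cnj \<nu> * e)) * inverse (- 2 * Re (c z))) = Re (G z * e)" for e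
    proof -
      have "Re (cnj \<nu> / of_real (Re (c z)) * e) = Re (cnj \<nu> * e) / Re (c z)"
      proof -
        have "cnj \<nu> / of_real (Re (c z)) * e = (cnj \<nu> * e) / of_real (Re (c z))" by simp
        then show ?thesis by (simp only: Re_divide_of_real)
      qed
      moreover have "(-2 * Re (cnj \<nu> * e)) * inverse (- 2 * Re (c z)) = Re (cnj \<nu> * e) / Re (c z)"
      proof -
        have cancel: "(-2 * R) * inverse (- 2 * x) = R / x" if "x \<noteq> 0" for R x :: real
          using that by (simp add: field_simps)
        show ?thesis by (rule cancel) (use cneg[OF zB] in simp)
      qed
      moreover have "G z * e = - (E z * e + cnj \<nu> / of_real (Re (c z)) * e)"
        by (simp only: G_def distrib_right mult_minus_left)
      ultimately show ?thesis by (simp only: uminus_complex.sel plus_complex.sel)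
    qed
    ultimately have "((\<lambda>w. - (k w w + ln (- 2 * Re (c w)))) has_derivative (\<lambda>e. Re (G z * e))) (at z)"
      by simp
    then show ?thesis
      by (rule has_derivative_transform_within_open[OF _ open_ball zB])
        (simp add: capacity_function_def robin)
  qed
  define A' where "A' e = - (A e - cnj \<nu> * of_real (Re (cnj \<nu> * e)) / of_real (\<delta>\<^sup>2))" for e
  have dG: "(G has_derivative A') (at p)"
  proof -
    have dc: "((\<lambda>w. Re (c w)) has_derivative (\<lambda>e. Re (cnj \<nu> * e))) (at p)"
    proof (rule has_derivative_Re_holomorphic)
      show "(c has_field_derivative cnj \<nu>) (at p)"
        unfolding c_def by (auto intro!: derivative_eq_intros)
    qed
    have "((\<lambda>z. inverse (complex_of_real (Re (c z)))) has_derivative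
       (\<lambda>e. - (inverse (of_real (Re (c p))) * of_real (Re (cnj \<nu> * e)) * inverse (of_real (Re (c p)))))) (at p)"
      by (rule Deriv.has_derivative_inverse[OF _ has_derivative_of_real[OF dc]]) (use \<delta> in \<open>simp add: cp\<close>)
    from has_derivative_minus[OF has_derivative_add[OF A(1) has_derivative_mult_right[OF this, of "cnj \<nu>"]]]
    have "((\<lambda>z. - (E z + cnj \<nu> * inverse (complex_of_real (Re (c z))))) has_derivative
       (\<lambda>e. - (A e + cnj \<nu> * - (inverse (of_real (Re (c p))) * of_real (Re (cnj \<nu> * e)) * inverse (of_real (Re (c p))))))) (at p)" .
    moreover have "(\<lambda>z. - (E z + cnj \<nu> * inverse (complex_of_real (Re (c z))))) = G"
      by (simp add: G_def fun_eq_iff divide_inverse)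
    moreover have "(\<lambda>e. - (A e + cnj \<nu> * - (inverse (of_real (Re (c p))) * of_real (Re (cnj \<nu> * e)) * inverse (of_real (Re (c p)))))) = A'"
      by (simp add: A'_def fun_eq_iff cp divide_inverse power2_eq_square mult_ac)
    ultimately show ?thesis by (simp only:)
  qed
  have W: "wirtinger (wirtinger_bar (\<lambda>w. complex_of_real (ln (capacity_function D w)))) p
      = (cnj (A' 1) - \<i> * cnj (A' \<i>)) / 4"
    by (rule wirtinger_wirtinger_bar[OF open_ball pB dlog dG])
  define F where "F = - (cnj (A 1) - \<i> * cnj (A \<i>)) / 4"
  have "(cnj (A' 1) - \<i> * cnj (A' \<i>)) / 4 = F + (\<nu> * (of_real (Re (cnj \<nu>)) - \<i> * of_real (Re (cnj \<nu> * \<i>)))) / (4 * of_real (\<delta>\<^sup>2))"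
    using \<delta> by (simp add: A'_def F_def field_simps)
  also have "of_real (Re (cnj \<nu>)) - \<i> * of_real (Re (cnj \<nu> * \<i>)) = cnj \<nu>"
    by (simp add: complex_eq_iff)
  finally have W2: "wirtinger (wirtinger_bar (\<lambda>w. complex_of_real (ln (capacity_function D w)))) p
      = F + 1 / (4 * of_real (\<delta>\<^sup>2))"
    unfolding W \<nu>\<nu> .
  have Fle: "cmod F \<le> 124416 / (r * \<delta>)"
  proof -
    have "cmod F \<le> (cmod (A 1) + cmod (A \<i>)) / 4"
      using norm_triangle_ineq4[of "cnj (A 1)" "\<i> * cnj (A \<i>)"]
      by (simp add: F_def norm_mult norm_divide norm_minus_commute)
    also have "\<dots> \<le> (2 * (10368 * M / (\<delta>/2)\<^sup>2)) / 4"
      using A(2)[of 1] A(2)[of \<i>] by simp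
    also have "\<dots> = 124416 / (r * \<delta>)"
      using \<delta> r by (simp add: M_def power2_eq_square field_simps)
    finally show ?thesis .
  qed
  have cap: "complex_of_real (capacity_function D p) powi (- 2) = of_real (exp (2 * k p p) * (4 * \<delta>\<^sup>2))"
  proof -
    have "capacity_function D p = exp (- (k p p + ln (2 * \<delta>)))"
      using robin[of p] \<delta> by (simp add: capacity_function_def cp)
    also have "\<dots> = inverse (exp (k p p) * (2 * \<delta>))"
      unfolding exp_minus exp_add using \<delta> by simp
    finally have "inverse (capacity_function D p) = exp (k p p) * (2 * \<delta>)"
      by (simp only: inverse_inverse_eq)
    then have "(inverse (capacity_function D p))\<^sup>2 = exp (2 * k p p) * (4 * \<delta>\<^sup>2)"
      by (simp add: power_mult_distrib exp_double)
    moreover have "complex_of_real (capacity_function D p) powi (- 2) = of_real ((inverse (capacity_function D p))\<^sup>2)"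
      by (simp add: power_int_def power_inverse)
    ultimately show ?thesis by simp
  qed
  define y where "y = exp (2 * k p p)"
  have "metric_curvature (capacity_function D) p + 4 =
      - 4 * of_real (y * (4 * \<delta>\<^sup>2)) * (F + 1 / (4 * of_real (\<delta>\<^sup>2))) + 4"
    unfolding metric_curvature_def W2 cap y_def by simp
  also have "\<dots> = 4 * of_real (1 - y) - of_real (16 * y * \<delta>\<^sup>2) * F"
    using \<delta> by (simp add: field_simps)
  finally have "cmod (metric_curvature (capacity_function D) p + 4) \<le>
      cmod (4 * of_real (1 - y)) + cmod (of_real (16 * y * \<delta>\<^sup>2) * F)"
    by (simp only: norm_triangle_ineq4)
  also have "\<dots> = 4 * \<bar>1 - y\<bar> + 16 * y * \<delta>\<^sup>2 * cmod F"
    by (simp add: norm_mult y_def del: of_real_diff of_real_mult of_real_power)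
  also have "\<dots> \<le> 4 * (exp (12 * \<delta> / r) - 1) + exp (12 * \<delta> / r) * (1990656 * \<delta> / r)"
  proof (rule add_mono)
    have kp: "\<bar>k p p\<bar> \<le> 6 * \<delta> / r" using kM[of p p] \<delta> by (simp add: M_def)
    then have yle: "y \<le> exp (12 * \<delta> / r)" unfolding y_def by (simp add: abs_le_iff)
    have "exp (- (12 * \<delta> / r)) \<le> y" using kp unfolding y_def by (simp add: abs_le_iff)
    moreover have "1 - exp (- (12 * \<delta> / r)) \<le> exp (12 * \<delta> / r) - 1"
    proof -
      have "1 + 12 * \<delta> / r \<le> exp (12 * \<delta> / r)" "1 + (- (12 * \<delta> / r)) \<le> exp (- (12 * \<delta> / r))"
        by (rule exp_ge_add_one_self)+
      then show ?thesis by linarith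
    qed
    ultimately have "\<bar>1 - y\<bar> \<le> exp (12 * \<delta> / r) - 1" using yle by linarith
    then show "4 * \<bar>1 - y\<bar> \<le> 4 * (exp (12 * \<delta> / r) - 1)" by simp
    have "16 * y * \<delta>\<^sup>2 * cmod F \<le> 16 * exp (12 * \<delta> / r) * \<delta>\<^sup>2 * (124416 / (r * \<delta>))"
      using yle Fle by (intro mult_mono) (auto simp: y_def)
    also have "\<dots> = exp (12 * \<delta> / r) * (1990656 * \<delta> / r)"
      using \<delta> r by (simp add: power2_eq_square field_simps)
    finally show "16 * y * \<delta>\<^sup>2 * cmod F \<le> exp (12 * \<delta> / r) * (1990656 * \<delta> / r)" .
  qed
  finally show ?thesis unfolding p_def .
qed

end

theorem proposition1p4:
  fixes D \<Gamma> U :: "complex set" and \<psi> :: "complex \<Rightarrow> real" and p\<^sub>0 :: complex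
  assumes "regular_domain D"
    and "C2_boundary_piece D \<Gamma>"
    and "p\<^sub>0 \<in> \<Gamma>"
    and "p\<^sub>0 \<in> U"
    and "C2_defining_function D \<Gamma> U \<psi>"
  shows "(metric_curvature (capacity_function D) \<longlongrightarrow> - 4) (at p\<^sub>0 within D)"
proof -
  have D: "open D" using assms(1) by (simp add: regular_domain_def)
  have p0: "p\<^sub>0 \<in> frontier D" using assms(2,3) by (auto simp: C2_boundary_piece_def)
  obtain r \<eta> where r: "r > 0" and \<eta>: "\<eta> > 0" and discs:
    "\<And>q. q \<in> frontier D \<Longrightarrow> cmod (q - p\<^sub>0) < \<eta> \<Longrightarrow>
      \<exists>\<nu>. cmod \<nu> = 1 \<and> ball (q - of_real r * \<nu>) r \<subseteq> D \<and> D \<inter> ball (q + of_real r * \<nu>) r = {}"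
    using C2_boundary_tangent_discs[OF D assms(5,3,4)] by metis
  obtain \<nu>0 where "D \<inter> ball (p\<^sub>0 + of_real r * \<nu>0) r = {}"
    using discs[OF p0] \<eta> by auto
  then interpret regular_domain_exterior_disc D "p\<^sub>0 + of_real r * \<nu>0" r
    using assms(1) r by unfold_locales
  \<comment> \<open>The error bound of \<open>curvature_estimate\<close>. It is monotone in the distance to the boundary, which is at most the
    distance to \<open>p\<^sub>0\<close>, and vanishes at 0.\<close>
  define g where "g x = 4 * (exp (12 * x / r) - 1) + exp (12 * x / r) * (1990656 * x / r)" for x :: real
  have gmono: "g x \<le> g y" if "0 \<le> x" "x \<le> y" for x y
    unfolding g_def using that r
    by (intro add_mono mult_mono diff_mono) (auto simp: divide_right_mono)
  have est: "cmod (metric_curvature (capacity_function D) p - (- 4)) \<le> g (cmod (p - p\<^sub>0))"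
    if p: "p \<in> D" "cmod (p - p\<^sub>0) < min (\<eta> / 2) (r / 6)" for p
  proof -
    obtain q where q: "q \<in> frontier D" "cmod (p - q) \<le> cmod (p - p\<^sub>0)" "ball p (cmod (p - q)) \<subseteq> D"
      using nearest_boundary_point[OF D p(1) p0] by metis
    have pq: "p \<noteq> q" using q(1) p(1) D by (auto simp: frontier_def interior_open)
    have "cmod (q - p\<^sub>0) \<le> cmod (p - p\<^sub>0) + cmod (p - q)"
      using norm_triangle_ineq4[of "p - p\<^sub>0" "p - q"] by simp
    then have "cmod (q - p\<^sub>0) < \<eta>" using q(2) p(2) by auto
    then obtain \<nu> where \<nu>: "cmod \<nu> = 1" "ball (q - of_real r * \<nu>) r \<subseteq> D" "D \<inter> ball (q + of_real r * \<nu>) r = {}"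
      using discs[OF q(1)] by blast
    have peq: "p = q - of_real (cmod (p - q)) * \<nu>"
      by (rule inner_normal_direction[OF \<nu>(1) r pq q(3) \<nu>(3)])
    have "cmod (metric_curvature (capacity_function D) (q - of_real (cmod (p - q)) * \<nu>) + 4) \<le> g (cmod (p - q))"
      unfolding g_def by (rule curvature_estimate[OF \<nu>(1) r \<nu>(2,3)]) (use pq q(2) p(2) in auto)
    also have "\<dots> \<le> g (cmod (p - p\<^sub>0))" using q(2) by (intro gmono) auto
    finally show ?thesis using peq by simp
  qed
  have "((\<lambda>p. g (cmod (p - p\<^sub>0))) \<longlongrightarrow> g (cmod (p\<^sub>0 - p\<^sub>0))) (at p\<^sub>0 within D)"
    unfolding g_def by (intro tendsto_intros) (use r in auto)
  then have lim: "((\<lambda>p. g (cmod (p - p\<^sub>0))) \<longlongrightarrow> 0) (at p\<^sub>0 within D)" by (simp add: g_def)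
  have "\<forall>\<^sub>F p in at p\<^sub>0 within D. p \<in> D \<and> cmod (p - p\<^sub>0) < min (\<eta> / 2) (r / 6)"
    unfolding eventually_at using r \<eta>
    by (intro exI[of _ "min (\<eta> / 2) (r / 6)"]) (auto simp: dist_norm)
  then have "\<forall>\<^sub>F p in at p\<^sub>0 within D. norm (metric_curvature (capacity_function D) p - (- 4)) \<le> g (cmod (p - p\<^sub>0))"
    by eventually_elim (use est in auto)
  from Lim_null_comparison[OF this lim] show ?thesis
    by (simp only: LIM_zero_iff)
qed

end
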